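(* There exists an absolute constant $\epsilon_0>0$ such that for every $\epsilon\in(0,\epsilon_0]$ there exist constants $c_\epsilon>0$ and $d_\epsilon\in\mathbb{N}$ with the following property. For every dimension $d\ge d_\epsilon$, every sample size $N\le c_\epsilon d^2$, and every (possibly randomized) test $f:(\mathbb{R}^d)^N\to\{0,1\}$, it is NOT the case that both of the following hold: (i) $\Pr_{x\sim \mathcal{N}(0,I_d)^{\otimes N}}[f(x)=0]\ge 2/3$; and (ii) for every positive definite symmetric $d\times d$ matrix $\Sigma$ with $\|\Sigma-I_d\|_F>1/2$ and every probability distribution $B$ on $\mathbb{R}^d$, $\Pr_{x\sim Z^{\otimes N}}[f(x)=1]\ge 2/3$, where $Z=(1-\epsilon)\mathcal{N}(0,\Sigma)+\epsilon B$. In other words, distinguishing $\mathcal{N}(0,I_d)$ from $\epsilon$-contaminated Gaussians $(1-\epsilon)\mathcal{N}(0,\Sigma)+\epsilon B$ with $\|\Sigma-I\|_F>1/2$ requires $\Omega(d^2)$ i.i.d. samples.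
   Context: $\mathcal{N}(\mu,\Sigma)$ denotes the Gaussian distribution on $\mathbb{R}^d$ with mean $\mu$ and covariance $\Sigma$; $\|\cdot\|_F$ is the Frobenius norm; $D^{\otimes N}$ denotes the distribution of $N$ i.i.d. samples from $D$. The mixture $(1-\epsilon)P+\epsilon Q$ is the distribution that samples from $P$ with probability $1-\epsilon$ and from $Q$ with probability $\epsilon$. *)

theory Defs
  imports "HOL-Probability.Probability"
begin

text \<open>Vectors in R^d are functions nat => real (product space over the index set {..<d});
  d x d matrices are functions nat => nat => real, only entries with indices < d matter.\<close>

definition Rd :: "nat \<Rightarrow> (nat \<Rightarrow> real) measure" where
  "Rd d = PiM {..<d} (\<lambda>_. borel)"

definition std_normal :: "real measure" where
  "std_normal = density lborel (\<lambda>x. ennreal (std_normal_density x))"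

definition std_gaussian :: "nat \<Rightarrow> (nat \<Rightarrow> real) measure" where
  "std_gaussian d = PiM {..<d} (\<lambda>_. std_normal)"

definition sym_pos_def :: "nat \<Rightarrow> (nat \<Rightarrow> nat \<Rightarrow> real) \<Rightarrow> bool" where
  "sym_pos_def d S \<longleftrightarrow>
     (\<forall>i<d. \<forall>j<d. S i j = S j i) \<and>
     (\<forall>x :: nat \<Rightarrow> real. (\<exists>i<d. x i \<noteq> 0) \<longrightarrow> (\<Sum>i<d. \<Sum>j<d. x i * S i j * x j) > 0)"

definition frob_dist_id :: "nat \<Rightarrow> (nat \<Rightarrow> nat \<Rightarrow> real) \<Rightarrow> real" where
  "frob_dist_id d S = sqrt (\<Sum>i<d. \<Sum>j<d. (S i j - (if i = j then 1 else 0))\<^sup>2)"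

definition gaussian :: "nat \<Rightarrow> (nat \<Rightarrow> nat \<Rightarrow> real) \<Rightarrow> (nat \<Rightarrow> real) measure" where
  "gaussian d S =
     (let A = (SOME A :: nat \<Rightarrow> nat \<Rightarrow> real. \<forall>i<d. \<forall>j<d. (\<Sum>k<d. A i k * A j k) = S i j)
      in distr (std_gaussian d) (Rd d) (\<lambda>g. \<lambda>i\<in>{..<d}. \<Sum>k<d. A i k * g k))"

definition mixture :: "real \<Rightarrow> 'a measure \<Rightarrow> 'a measure \<Rightarrow> 'a measure" where
  "mixture e P Q = measure_of (space P) (sets P)
     (\<lambda>A. ennreal (1 - e) * emeasure P A + ennreal e * emeasure Q A)"

definition iid :: "nat \<Rightarrow> 'a measure \<Rightarrow> (nat \<Rightarrow> 'a) measure" where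
  "iid N D = PiM {..<N} (\<lambda>_. D)"

end

theory Submission
  imports Defs
begin

text \<open>
Split the coordinates into two halves \<open>y\<close> and \<open>z\<close> and let \<open>K\<close> be a random sign matrix, scaled to
Frobenius norm one. The hidden Gaussian is \<open>y ~ N(0, I)\<close>, \<open>z = K y + g\<close>. The contamination consists of
copies of it with \<open>K\<close> replaced by \<open>t K\<close>, weighted such that the first and third moments of \<open>t\<close>
vanish, and of one component with density proportional to \<open>exp (- \<tau> |K\<^sup>T z|\<^sup>2 / 2)\<close>, which compensates
the excess covariance of \<open>z\<close>.

All correlations between the mixtures for \<open>K\<close> and \<open>K'\<close> are Gaussian averages of exponentials or
cosines of the bilinear form of \<open>P = K\<^sup>T K'\<close>. The chosen moments remove every term of order
\<open>|P|\<^sub>F\<^sup>2\<close>, so that the correlation is \<open>1 + O((tr P)\<^sup>2 + tr (P\<^sup>2) + d\<^sup>-\<^sup>2)\<close> as soon as \<open>|P|\<^sub>F\<^sup>2 = O(1/d)\<close>.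
The latter bound follows from \<open>|K K\<^sup>T|\<^sub>F\<^sup>2 = O(1/d)\<close>, which holds for half of all sign matrices.
Since \<open>(tr P)\<^sup>2\<close> and \<open>tr (P\<^sup>2)\<close> are quadratic forms in the signs with coefficients of size
\<open>d\<^sup>-\<^sup>4\<close>, the average of the \<open>N\<close>-th power of the correlation stays close to one
for \<open>N \<le> c d\<^sup>2\<close>, and the second moment method applies.
\<close>

subsection \<open>Uniqueness of characteristic functions in several dimensions\<close>

text \<open>For hidden Gaussians alone the correlation contains the term
  \<open>|P|\<^sub>F\<^sup>2\<close>, of order 1/d on average, and the second moment method would
  stop at order d samples; d^2 samples require every term to be of order d^-2. The odd moments of
  \<open>t\<close> have to vanish because \<open>tr P\<close> fluctuates on the scale 1/d and the
  cubic term is only bounded by d^(-3/2). The second moment \<open>T\<close> of real atoms cannot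
  vanish, whence the extra component with too little variance along the range of \<open>K\<close>.
  The four pairings of atoms and extra component contribute \<open>|P|\<^sub>F\<^sup>2\<close> with
  the factors T^2/2, -T^2/2, -T^2/2 and T^2/2 once \<open>\<delta> * \<tau> = T\<close>, up to
  reweighting errors that are again of order d^-2. The atom 1 carries the mass 1 - \<epsilon>, so
  the remaining mass can balance its first moment only with atoms of size about 1/\<epsilon>; every
  constant inherits its dependence on \<epsilon> from there. The definition of
  \<open>gaussian\<close> chooses an arbitrary root of the covariance. Uniqueness of characteristic
  functions shows that the choice is immaterial, so that the triangular root (y, z) -> (y, z + K y)
  may be used.\<close>

lemma finite_measure_eqI_cos_sin:
  fixes M N :: "real measure"
  assumes fin: "finite_measure M" "finite_measure N"
    and sets: "sets M = sets borel" "sets N = sets borel"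
    and cos: "\<And>t. (\<integral>x. cos (t * x) \<partial>M) = (\<integral>x. cos (t * x) \<partial>N)"
    and sin: "\<And>t. (\<integral>x. sin (t * x) \<partial>M) = (\<integral>x. sin (t * x) \<partial>N)"
  shows "M = N"
proof -
  interpret M: finite_measure M by fact
  interpret N: finite_measure N by fact
  note [measurable_cong] = sets
  have sp: "space M = UNIV" "space N = UNIV"
    using sets[THEN sets_eq_imp_space_eq] by auto
  define c where "c = measure M UNIV"
  have c: "measure M UNIV = c" "measure N UNIV = c"
    using cos[of 0] by (auto simp: c_def sp)
  have em: "emeasure M UNIV = ennreal c" "emeasure N UNIV = ennreal c"
    using c by (simp_all add: M.emeasure_eq_measure N.emeasure_eq_measure)
  show ?thesis
  proof (cases "c = 0")
    case True
    have "emeasure M A = 0" "emeasure N A = 0" for A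
      using emeasure_space[of M A] emeasure_space[of N A] True em by (auto simp: sp)
    then show ?thesis by (intro measure_eqI) (auto simp: sets)
  next
    case False
    then have "c > 0" by (simp add: c_def less_le)
    \<comment> \<open>Levy uniqueness speaks of probability measures. Dividing by the common mass
      \<open>c\<close>, which is the cosine integral at frequency zero, reduces to it; the constant
      density \<open>c\<close> undoes the scaling at the end.\<close>
    define F where "F = (\<lambda>L :: real measure. density L (\<lambda>_. ennreal (1 / c)))"
    have rd: "real_distribution (F L)"
      if "sets L = sets borel" "space L = UNIV" "emeasure L UNIV = ennreal c" for L
    proof -
      have "emeasure (F L) (space (F L)) = 1"
        using that \<open>c > 0\<close> by (simp add: F_def emeasure_density_const ennreal_mult[symmetric])
      then show ?thesis
        using that by (auto simp: real_distribution_def real_distribution_axioms_def F_def intro!: prob_spaceI)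
    qed
    have ch: "char (F L) t = Complex ((\<integral>x. cos (t * x) \<partial>L) / c) ((\<integral>x. sin (t * x) \<partial>L) / c)"
      if [measurable_cong]: "sets L = sets borel" and fL: "finite_measure L" for L t
    proof -
      interpret finite_measure L by (rule fL)
      have int: "integrable L (\<lambda>x. iexp (t * x))"
        by (rule integrable_const_bound[where B=1]) auto
      have "char (F L) t = (\<integral>x. (1 / c) *\<^sub>R iexp (t * x) \<partial>L)"
        unfolding char_def F_def using \<open>c > 0\<close> by (subst integral_density) auto
      also have "\<dots> = (1 / c) *\<^sub>R (\<integral>x. iexp (t * x) \<partial>L)" by simp
      also have "\<dots> = Complex ((\<integral>x. cos (t * x) \<partial>L) / c) ((\<integral>x. sin (t * x) \<partial>L) / c)"
      proof -
        have "Re (\<integral>x. iexp (t * x) \<partial>L) = (\<integral>x. Re (iexp (t * x)) \<partial>L)"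
          "Im (\<integral>x. iexp (t * x) \<partial>L) = (\<integral>x. Im (iexp (t * x)) \<partial>L)"
          using int by simp_all
        then show ?thesis by (simp add: complex_eq_iff Re_exp Im_exp)
      qed
      finally show ?thesis .
    qed
    have "F M = F N"
      by (intro Levy_uniqueness rd ext) (simp_all add: sets sp em ch fin cos sin)
    moreover have "density (F L) (\<lambda>_. ennreal c) = L" if "sets L = sets borel" for L
      unfolding F_def using \<open>c > 0\<close> that
      by (subst density_density_eq) (auto simp: ennreal_mult[symmetric] density_1)
    ultimately show ?thesis using sets by metis
  qed
qed

text \<open>Induction on the coordinates. The new coordinate \<open>i\<close> is split off by
  restricting it to a Borel set \<open>E\<close>; the induction hypothesis then needs trigonometric
  integrals over such slabs, and these are supplied by \<open>key\<close>, which is one-dimensional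
  uniqueness in \<open>x i\<close> with the trigonometric factor of the other coordinates as a
  weight.\<close>

lemma PiM_borel_eqI_cos_sin:
  fixes M N :: "('i \<Rightarrow> real) measure"
  assumes "finite I" "finite_measure M" "finite_measure N"
    and "sets M = sets (PiM I (\<lambda>_. borel))" "sets N = sets (PiM I (\<lambda>_. borel))"
    and "\<And>t. (\<integral>x. cos (\<Sum>i\<in>I. t i * x i) \<partial>M) = (\<integral>x. cos (\<Sum>i\<in>I. t i * x i) \<partial>N)"
    and "\<And>t. (\<integral>x. sin (\<Sum>i\<in>I. t i * x i) \<partial>M) = (\<integral>x. sin (\<Sum>i\<in>I. t i * x i) \<partial>N)"
  shows "M = N"
  using assms
proof (induction I arbitrary: M N rule: finite_induct)
  case empty
  interpret M: finite_measure M by fact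
  interpret N: finite_measure N by fact
  have eq: "measure M (space M) = measure N (space N)"
    using empty.prems(5) by simp
  have sp: "space M = space N" using empty.prems by (metis sets_eq_imp_space_eq)
  show ?case
  proof (rule measure_eqI)
    fix A assume "A \<in> sets M"
    then have "A = {} \<or> A = space M"
      using empty.prems sets_eq_imp_space_eq[OF empty.prems(3)] by (auto simp: sets_PiM_empty space_PiM)
    then show "emeasure M A = emeasure N A"
      using eq sp by (auto simp: M.emeasure_eq_measure N.emeasure_eq_measure)
  qed (use empty.prems in simp)
next
  case (insert i I)
  interpret M: finite_measure M by fact
  interpret N: finite_measure N by fact
  note [measurable_cong] = insert.prems(3,4)
  let ?P = "PiM I (\<lambda>_. borel :: real measure)"
  let ?Q = "PiM (insert i I) (\<lambda>_. borel :: real measure)"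
  have sp: "space M = extensional (insert i I)" "space N = extensional (insert i I)"
    using insert.prems(3,4)[THEN sets_eq_imp_space_eq] by (auto simp: space_PiM PiE_def)
  define sl where "sl = (\<lambda>(t :: 'i \<Rightarrow> real) (x :: 'i \<Rightarrow> real). \<Sum>j\<in>I. t j * x j)"
  have slm[measurable]: "sl t \<in> borel_measurable ?Q" for t
    unfolding sl_def by measurable
  have lin: "(\<Sum>j\<in>insert i I. (t(i := s)) j * x j) = s * x i + sl t x" for t s x
    using insert.hyps by (auto simp: sl_def intro!: sum.cong)
  have neg: "sl (\<lambda>j. - t j) x = - sl t x" for t x
    by (simp add: sl_def sum_negf)
  have C: "(\<integral>x. cos (s * x i + sl t x) \<partial>M) = (\<integral>x. cos (s * x i + sl t x) \<partial>N)"
    "(\<integral>x. sin (s * x i + sl t x) \<partial>M) = (\<integral>x. sin (s * x i + sl t x) \<partial>N)"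
    "(\<integral>x. cos (s * x i - sl t x) \<partial>M) = (\<integral>x. cos (s * x i - sl t x) \<partial>N)"
    "(\<integral>x. sin (s * x i - sl t x) \<partial>M) = (\<integral>x. sin (s * x i - sl t x) \<partial>N)" for s t
    using insert.prems(5,6)[of "t(i := s)"] insert.prems(5,6)[of "(\<lambda>j. - t j)(i := s)"]
    unfolding lin neg by simp_all
  have C0: "(\<integral>x. cos (s * x i) \<partial>M) = (\<integral>x. cos (s * x i) \<partial>N)"
    "(\<integral>x. sin (s * x i) \<partial>M) = (\<integral>x. sin (s * x i) \<partial>N)" for s
    using C(1,2)[of s "\<lambda>_. 0"] by (simp_all add: sl_def)
  have key: "(\<integral>x. indicator E (x i) * g (sl t x) \<partial>M) = (\<integral>x. indicator E (x i) * g (sl t x) \<partial>N)"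
    if E[measurable]: "E \<in> sets borel" and g: "g = cos \<or> g = sin" for E t and g :: "real \<Rightarrow> real"
  proof -
    have [measurable]: "g \<in> borel_measurable borel" using g by auto
    have gb: "\<bar>g x\<bar> \<le> 1" for x using g by auto
    have g0: "0 \<le> 1 + g x" for x using gb[of x] by linarith
    have int: "integrable M (\<lambda>x. h x * g (sl t x))" "integrable N (\<lambda>x. h x * g (sl t x))"
      "integrable M h" "integrable N h"
      if [measurable]: "h \<in> borel_measurable ?Q" and hb: "\<And>x. \<bar>h x\<bar> \<le> 1" for h :: "('i \<Rightarrow> real) \<Rightarrow> real"
    proof -
      have "\<bar>h x * g (sl t x)\<bar> \<le> 1" for x
        unfolding abs_mult using mult_mono[OF hb[of x] gb[of "sl t x"]] by simp
      then show "integrable M (\<lambda>x. h x * g (sl t x))" "integrable N (\<lambda>x. h x * g (sl t x))"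
        "integrable M h" "integrable N h"
        by (auto intro!: M.integrable_const_bound[where B=1] N.integrable_const_bound[where B=1] hb)
    qed
    \<comment> \<open>\<open>g\<close> takes both signs, but \<open>1 + g\<close> is a bounded
      nonnegative density, so \<open>F L\<close> is a finite measure on the line. The part due to
      the constant 1 is the marginal of coordinate \<open>i\<close>; it is treated separately and
      subtracted at the end.\<close>
    define F where "F = (\<lambda>L. distr (density L (\<lambda>x. ennreal (1 + g (sl t x)))) borel (\<lambda>x. x i))"
    have dens: "(\<integral>y. h y \<partial>F L) = (\<integral>x. h (x i) \<partial>L) + (\<integral>x. h (x i) * g (sl t x) \<partial>L)"
      if L: "L = M \<or> L = N" and [measurable]: "h \<in> borel_measurable borel" and "\<And>x. \<bar>h x\<bar> \<le> 1"
      for h :: "real \<Rightarrow> real" and L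
    proof -
      have [measurable_cong]: "sets L = sets ?Q" using L insert.prems by auto
      have hm: "(\<lambda>x. h (x i)) \<in> borel_measurable ?Q" by measurable
      note ih = int[of "\<lambda>x. h (x i)", OF hm that(3)]
      have i: "integrable L (\<lambda>x. h (x i))" "integrable L (\<lambda>x. h (x i) * g (sl t x))"
        using L ih by metis+
      have "(\<integral>y. h y \<partial>F L) = (\<integral>x. (1 + g (sl t x)) * h (x i) \<partial>L)"
        unfolding F_def by (subst integral_distr, simp, simp, subst integral_density) (auto simp: g0)
      also have "\<dots> = (\<integral>x. h (x i) + h (x i) * g (sl t x) \<partial>L)" by (simp add: algebra_simps)
      also have "\<dots> = (\<integral>x. h (x i) \<partial>L) + (\<integral>x. h (x i) * g (sl t x) \<partial>L)" using i by simp
      finally show ?thesis .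
    qed
    have fin: "finite_measure (F L)" if L: "L = M \<or> L = N" for L
    proof -
      interpret L: finite_measure L using L insert.prems by auto
      have [measurable_cong]: "sets L = sets ?Q" using L insert.prems by auto
      have "emeasure (density L (\<lambda>x. ennreal (1 + g (sl t x)))) (space L) = (\<integral>\<^sup>+x. ennreal (1 + g (sl t x)) \<partial>L)"
        by (subst emeasure_density) (auto intro!: nn_integral_cong)
      also have "\<dots> \<le> (\<integral>\<^sup>+x. ennreal 2 \<partial>L)"
      proof (intro nn_integral_mono ennreal_leI)
        show "1 + g (sl t x) \<le> 2" for x using gb[of "sl t x"] by linarith
      qed
      also have "\<dots> < \<infinity>" by (simp add: ennreal_mult_less_top L.emeasure_eq_measure)
      finally show ?thesis unfolding F_def
        by (intro finite_measure.finite_measure_distr finite_measureI) auto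
    qed
    \<comment> \<open>Product-to-sum formulas lead back to \<open>cos\<close> and \<open>sin\<close>
      of linear forms, with the coefficients \<open>t\<close> and \<open>- t\<close> on the old
      coordinates; these are the integrals compared in \<open>C\<close>.\<close>
    have prod: "cos a * g b = (if g = cos then (cos (a + b) + cos (a - b)) / 2 else (sin (a + b) - sin (a - b)) / 2)"
       "sin a * g b = (if g = cos then (sin (a + b) + sin (a - b)) / 2 else (cos (a - b) - cos (a + b)) / 2)" for a b
      using g by (auto simp: cos_add cos_diff sin_add sin_diff)
    have icos: "integrable M (\<lambda>x. cos (f x))" "integrable M (\<lambda>x. sin (f x))"
       "integrable N (\<lambda>x. cos (f x))" "integrable N (\<lambda>x. sin (f x))"
      if [measurable]: "f \<in> borel_measurable ?Q" for f :: "('i \<Rightarrow> real) \<Rightarrow> real"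
      by (auto intro!: M.integrable_const_bound[where B=1] N.integrable_const_bound[where B=1])
    have fm: "(\<lambda>x. s * x i + sl t x) \<in> borel_measurable ?Q" "(\<lambda>x. s * x i - sl t x) \<in> borel_measurable ?Q" for s
      by measurable
    note ic = icos[OF fm(1)] icos[OF fm(2)]
    have P: "(\<integral>x. cos (s * x i) * g (sl t x) \<partial>M) = (\<integral>x. cos (s * x i) * g (sl t x) \<partial>N)"
      "(\<integral>x. sin (s * x i) * g (sl t x) \<partial>M) = (\<integral>x. sin (s * x i) * g (sl t x) \<partial>N)" for s
      unfolding prod by (cases "g = cos"; simp add: ic C)+
    have setF: "sets (F L) = sets borel" for L by (simp add: F_def)
    have "F M = F N"
      by (rule finite_measure_eqI_cos_sin[OF fin fin])
        (simp_all add: setF dens C0 P)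
    then have "(\<integral>y. indicator E y \<partial>F M) = (\<integral>y. indicator E y \<partial>F N :: real)" by simp
    moreover have "(\<integral>x. indicator E (x i) \<partial>M) = (\<integral>x. indicator E (x i) \<partial>N :: real)"
    proof -
      have "distr M borel (\<lambda>x. x i) = distr N borel (\<lambda>x. x i)"
        by (rule finite_measure_eqI_cos_sin)
          (auto simp: integral_distr C0 intro!: M.finite_measure_distr N.finite_measure_distr)
      moreover have "(\<integral>y. indicator E y \<partial>distr M borel (\<lambda>x. x i)) = (\<integral>x. indicator E (x i) \<partial>M :: real)"
        "(\<integral>y. indicator E y \<partial>distr N borel (\<lambda>x. x i)) = (\<integral>x. indicator E (x i) \<partial>N :: real)"
        by (rule integral_distr; measurable)+
      ultimately show ?thesis by metis
    qed
    ultimately show ?thesis using dens[of M "indicator E"] dens[of N "indicator E"]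
      by (auto simp: indicator_def)
  qed
  \<comment> \<open>Restriction to the slab over \<open>E\<close>, then projection along
    \<open>i\<close>. The measure of a box with side \<open>E\<close> in direction \<open>i\<close>
    is the value of \<open>G E M\<close> on the remaining box, so equality for all \<open>E\<close>
    suffices.\<close>
  define G where "G = (\<lambda>E L. distr (density L (\<lambda>x. indicator E (x i))) ?P (\<lambda>x. restrict x I))"
  have rm: "(\<lambda>x. restrict x I) \<in> measurable ?Q ?P" by (rule measurable_restrict_subset) auto
  have GE: "G E M = G E N" if E[measurable]: "E \<in> sets borel" for E
  proof (rule insert.IH)
    note rm[measurable]
    have fin: "finite_measure (G E L)" if L: "L = M \<or> L = N" for L
    proof -
      interpret L: finite_measure L using L insert.prems by auto
      have [measurable_cong]: "sets L = sets ?Q" using L insert.prems by auto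
      have "emeasure (density L (\<lambda>x. indicator E (x i))) (space L) = (\<integral>\<^sup>+x. indicator E (x i) \<partial>L)"
        by (subst emeasure_density) (auto intro!: nn_integral_cong)
      also have "\<dots> \<le> (\<integral>\<^sup>+x. 1 \<partial>L)"
        by (intro nn_integral_mono) (auto simp: indicator_def)
      also have "\<dots> < \<infinity>" by (simp add: L.emeasure_eq_measure)
      finally show ?thesis unfolding G_def
        by (intro finite_measure.finite_measure_distr finite_measureI) auto
    qed
    show "finite_measure (G E M)" "finite_measure (G E N)" using fin by auto
    show "sets (G E M) = sets ?P" "sets (G E N) = sets ?P" by (auto simp: G_def)
    have val: "(\<integral>x. g (\<Sum>j\<in>I. t j * x j) \<partial>G E L) = (\<integral>x. indicator E (x i) * g (sl t x) \<partial>L)"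
      if L: "L = M \<or> L = N" and [measurable]: "g \<in> borel_measurable borel" for L t and g :: "real \<Rightarrow> real"
    proof -
      have [measurable_cong]: "sets L = sets ?Q" using L insert.prems by auto
      have "(\<integral>x. g (\<Sum>j\<in>I. t j * x j) \<partial>G E L) = (\<integral>x. g (\<Sum>j\<in>I. t j * restrict x I j) \<partial>density L (\<lambda>x. indicator E (x i)))"
        unfolding G_def by (subst integral_distr) auto
      also have "\<dots> = (\<integral>x. g (sl t x) \<partial>density L (\<lambda>x. ennreal (indicator E (x i))))"
        by (simp add: sl_def ennreal_indicator)
      also have "\<dots> = (\<integral>x. indicator E (x i) * g (sl t x) \<partial>L)"
        by (subst integral_density) auto
      finally show ?thesis .
    qed
    show "(\<integral>x. cos (\<Sum>i\<in>I. t i * x i) \<partial>G E M) = (\<integral>x. cos (\<Sum>i\<in>I. t i * x i) \<partial>G E N)" for t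
      by (simp add: val key E)
    show "(\<integral>x. sin (\<Sum>i\<in>I. t i * x i) \<partial>G E M) = (\<integral>x. sin (\<Sum>i\<in>I. t i * x i) \<partial>G E N)" for t
      by (simp add: val key E)
  qed
  show ?case
  proof (rule measure_eqI_PiM_finite[where M="\<lambda>_. borel" and I="insert i I"])
    show "finite (insert i I)" using insert.hyps by simp
    show "sets M = sets ?Q" "sets N = sets ?Q" by fact+
    fix A :: "'i \<Rightarrow> real set" assume A: "\<And>j. j \<in> insert i I \<Longrightarrow> A j \<in> sets borel"
    have Ai[measurable]: "A i \<in> sets borel" using A by auto
    have AI: "Pi\<^sub>E I A \<in> sets ?P" using A insert.hyps by (auto intro!: sets_PiM_I_finite)
    have "emeasure (G (A i) L) (Pi\<^sub>E I A) = emeasure L (Pi\<^sub>E (insert i I) A)" if L: "L = M \<or> L = N" for L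
    proof -
      note rm[measurable] AI[measurable]
      have [measurable_cong]: "sets L = sets ?Q" using L insert.prems by auto
      have spL: "space L = extensional (insert i I)" using L sp by auto
      have AQ: "Pi\<^sub>E (insert i I) A \<in> sets L"
        using A insert.hyps \<open>sets L = sets ?Q\<close> by (auto intro!: sets_PiM_I_finite)
      have "emeasure (G (A i) L) (Pi\<^sub>E I A)
        = emeasure (density L (\<lambda>x. indicator (A i) (x i))) ((\<lambda>x. restrict x I) -` Pi\<^sub>E I A \<inter> space L)"
        unfolding G_def by (subst emeasure_distr) auto
      also have "\<dots> = (\<integral>\<^sup>+x. indicator (A i) (x i) * indicator ((\<lambda>x. restrict x I) -` Pi\<^sub>E I A \<inter> space L) x \<partial>L)"
        by (subst emeasure_density) auto
      also have "\<dots> = (\<integral>\<^sup>+x. indicator (Pi\<^sub>E (insert i I) A) x \<partial>L)"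
        by (intro nn_integral_cong) (auto simp: indicator_def PiE_def Pi_def spL extensional_def split: if_splits)
      also have "\<dots> = emeasure L (Pi\<^sub>E (insert i I) A)" using AQ by simp
      finally show ?thesis .
    qed
    then show "emeasure M (Pi\<^sub>E (insert i I) A) = emeasure N (Pi\<^sub>E (insert i I) A)"
      using GE[OF Ai] by metis
  next
    show "range (\<lambda>_::nat. space ?Q) \<subseteq> prod_algebra (insert i I) (\<lambda>_. borel :: real measure)"
      using space_in_prod_algebra[of "insert i I" "\<lambda>_. borel :: real measure"] by (auto simp: space_PiM)
    show "(\<Union>i::nat. space ?Q) = space ?Q" by auto
    show "emeasure M (space ?Q) \<noteq> \<infinity>" by (simp add: M.emeasure_eq_measure)
  qed
qed

subsection \<open>Product Gaussian measures\<close>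

lemma sets_std_normal[simp, measurable_cong]: "sets std_normal = sets borel"
  by (simp add: std_normal_def)

lemma space_std_normal[simp]: "space std_normal = UNIV"
  by (simp add: std_normal_def)

lemma prob_space_std_normal: "prob_space std_normal"
  unfolding std_normal_def by (rule prob_space_normal_density) simp

interpretation std_normal: prob_space std_normal
  by (rule prob_space_std_normal)

interpretation std_normals: product_prob_space "\<lambda>_. std_normal" UNIV
  by (rule product_prob_spaceI) (rule prob_space_std_normal)

lemma measure_std_normal_UNIV[simp]: "measure std_normal UNIV = 1"
  using std_normal.prob_space by simp

lemma std_normal_moments:
  "integrable std_normal (\<lambda>x. x ^ k)"
  "(\<integral>x. x \<partial>std_normal) = 0"
  "(\<integral>x. x ^ 2 \<partial>std_normal) = 1"
  "(\<integral>x. x ^ 3 \<partial>std_normal) = 0"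
  "(\<integral>x. x ^ 4 \<partial>std_normal) = 3"
  using integrable_std_normal_distribution_moment[of k]
    integral_std_normal_distribution_moment_odd[of 1] integral_std_normal_distribution_moment_odd[of 3]
    std_normal_distribution_even_moments(1)[of 1] std_normal_distribution_even_moments(1)[of 2]
  by (simp_all add: std_normal_def fact_numeral)

text \<open>Completing the square gives the exact value
  \<open>s * exp (2 * b\<^sup>2 * s\<^sup>2)\<close>. The logarithm of \<open>s\<close> is
  \<open>a\<close> up to a quadratic error, and \<open>\<bar>a\<bar> \<le> 1/16\<close> gives
  \<open>2 * s\<^sup>2 \<le> 3\<close>. The leading term \<open>a\<close> must be kept exactly,
  since it adds up to the trace.\<close>

lemma nn_integral_std_normal_quadratic_le:
  assumes "\<bar>a\<bar> \<le> 1/16"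
  shows "(\<integral>\<^sup>+x. ennreal (exp (a * x\<^sup>2 + 2 * b * x)) \<partial>std_normal) \<le> ennreal (exp (a + 4 * a\<^sup>2 + 3 * b\<^sup>2))"
proof -
  define s where "s = 1 / sqrt (1 - 2 * a)"
  have a: "1 - 2 * a > 0" using assms by (simp add: abs_le_iff)
  have s: "s > 0" "s\<^sup>2 = 1 / (1 - 2 * a)" using a by (simp_all add: s_def power_divide)
  have eq: "std_normal_density x * exp (a * x\<^sup>2 + 2 * b * x)
      = s * exp (2 * b\<^sup>2 * s\<^sup>2) * normal_density (2 * b * s\<^sup>2) s x" for x
  proof -
    have "- (x\<^sup>2 / 2) + (a * x\<^sup>2 + 2 * b * x) = 2 * b\<^sup>2 * s\<^sup>2 - (x - 2 * b * s\<^sup>2)\<^sup>2 / (2 * s\<^sup>2)"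
    proof -
      have "(x - 2 * b * s\<^sup>2)\<^sup>2 / (2 * s\<^sup>2) = x\<^sup>2 * (1 / s\<^sup>2) / 2 - 2 * b * x + 2 * b\<^sup>2 * s\<^sup>2"
        using s(1) by (simp add: field_simps power2_eq_square)
      moreover have "1 / s\<^sup>2 = 1 - 2 * a" using s(2) a by simp
      ultimately show ?thesis by (simp add: field_simps)
    qed
    then have "exp (- (x\<^sup>2 / 2)) * exp (a * x\<^sup>2 + 2 * b * x) = exp (2 * b\<^sup>2 * s\<^sup>2) * exp (- (x - 2 * b * s\<^sup>2)\<^sup>2 / (2 * s\<^sup>2))"
      by (simp add: exp_add[symmetric])
    then show ?thesis using s(1)
      by (simp add: normal_density_def real_sqrt_mult field_simps)
  qed
  have "(\<integral>\<^sup>+x. ennreal (exp (a * x\<^sup>2 + 2 * b * x)) \<partial>std_normal)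
      = (\<integral>\<^sup>+x. ennreal (s * exp (2 * b\<^sup>2 * s\<^sup>2) * normal_density (2 * b * s\<^sup>2) s x) \<partial>lborel)"
    unfolding std_normal_def
    by (subst nn_integral_density) (simp_all add: ennreal_mult'[symmetric] eq)
  also have "\<dots> = ennreal (s * exp (2 * b\<^sup>2 * s\<^sup>2))"
    using s(1) by (simp add: nn_integral_cmult ennreal_mult nn_integral_eq_integral)
  also have "\<dots> \<le> ennreal (exp (a + 4 * a\<^sup>2 + 3 * b\<^sup>2))"
  proof (rule ennreal_leI)
    have "\<bar>ln (1 + (- 2 * a)) - (- 2 * a)\<bar> \<le> 2 * (- 2 * a)\<^sup>2"
      by (rule abs_ln_one_plus_x_minus_x_bound) (use assms in auto)
    then have "- ln (1 - 2 * a) / 2 \<le> a + 4 * a\<^sup>2" by (simp add: power2_eq_square abs_le_iff)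
    moreover have "ln s = - ln (1 - 2 * a) / 2" using a by (simp add: s_def ln_div ln_sqrt)
    ultimately have 1: "s \<le> exp (a + 4 * a\<^sup>2)" using s(1) by (metis exp_le_cancel_iff exp_ln)
    have "2 * s\<^sup>2 \<le> 3" using assms unfolding s(2) by (simp add: field_simps abs_le_iff)
    then have "2 * b\<^sup>2 * s\<^sup>2 \<le> 3 * b\<^sup>2" using mult_right_mono[of "2 * s\<^sup>2" 3 "b\<^sup>2"] by (simp add: algebra_simps)
    then have 2: "exp (2 * b\<^sup>2 * s\<^sup>2) \<le> exp (3 * b\<^sup>2)" by simp
    show "s * exp (2 * b\<^sup>2 * s\<^sup>2) \<le> exp (a + 4 * a\<^sup>2 + 3 * b\<^sup>2)"
      unfolding exp_add[of "a + 4 * a\<^sup>2"] by (intro mult_mono 1 2) auto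
  qed
  finally show ?thesis .
qed

text \<open>The one-dimensional Cameron-Martin formula: the exponential is the quotient of the
  normal densities at \<open>x - a\<close> and at \<open>x\<close>.\<close>

lemma distr_std_normal_shift:
  "distr std_normal std_normal (\<lambda>x. x + a) = density std_normal (\<lambda>x. ennreal (exp (a * x - a\<^sup>2 / 2)))"
proof (rule measure_eqI)
  fix A assume "A \<in> sets (distr std_normal std_normal (\<lambda>x. x + a))"
  then have [measurable]: "A \<in> sets borel" by simp
  have e: "std_normal_density x * exp (a * x - a\<^sup>2 / 2) = std_normal_density (x - a)" for x
  proof -
    have "exp (- x\<^sup>2 / 2) * exp (a * x - a\<^sup>2 / 2) = exp (- (x - a)\<^sup>2 / 2)"
      unfolding exp_add[symmetric] by (simp add: power2_eq_square algebra_simps diff_divide_distrib add_divide_distrib)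
    then show ?thesis unfolding std_normal_density_def by (simp add: field_simps)
  qed
  have "emeasure (distr std_normal std_normal (\<lambda>x. x + a)) A = (\<integral>\<^sup>+x. indicator A (x + a) \<partial>std_normal)"
    by (subst nn_integral_indicator[symmetric], simp, subst nn_integral_distr) auto
  also have "\<dots> = (\<integral>\<^sup>+x. ennreal (std_normal_density x) * indicator A (x + a) \<partial>lborel)"
    unfolding std_normal_def by (subst nn_integral_density) auto
  also have "\<dots> = (\<integral>\<^sup>+x. ennreal (std_normal_density x) * indicator A (x + a) \<partial>distr lborel borel (\<lambda>x. - a + x))"
    using lborel_distr_plus[of "-a"] by metis
  also have "\<dots> = (\<integral>\<^sup>+x. ennreal (std_normal_density (x - a)) * indicator A x \<partial>lborel)"
    by (subst nn_integral_distr) auto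
  also have "\<dots> = (\<integral>\<^sup>+x. ennreal (std_normal_density x) * (ennreal (exp (a * x - a\<^sup>2 / 2)) * indicator A x) \<partial>lborel)"
    by (simp add: e[symmetric] ennreal_mult' mult.assoc)
  also have "\<dots> = emeasure (density std_normal (\<lambda>x. ennreal (exp (a * x - a\<^sup>2 / 2)))) A"
    by (subst emeasure_density, simp, simp, simp add: std_normal_def, subst nn_integral_density) auto
  finally show "emeasure (distr std_normal std_normal (\<lambda>x. x + a)) A = \<dots>" .
qed simp

text \<open>A measure on a finite product is determined by boxes, and on a box both the density and
  the indicator factorize. Used for shifted Gaussian vectors and again for the likelihood ratio of
  \<open>N\<close> samples.\<close>

lemma density_PiM:
  fixes f :: "'i \<Rightarrow> 'a \<Rightarrow> ennreal"
  assumes I: "finite I"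
    and M: "\<And>i. sigma_finite_measure (M i)" and f[measurable]: "\<And>i. f i \<in> borel_measurable (M i)"
    and D: "\<And>i. sigma_finite_measure (density (M i) (f i))"
  shows "PiM I (\<lambda>i. density (M i) (f i)) = density (PiM I M) (\<lambda>x. \<Prod>i\<in>I. f i (x i))"
proof -
  interpret M: product_sigma_finite M using M by (simp add: product_sigma_finite_def)
  interpret D: product_sigma_finite "\<lambda>i. density (M i) (f i)" using D by (simp add: product_sigma_finite_def)
  have m[measurable]: "(\<lambda>x. \<Prod>i\<in>I. f i (x i)) \<in> borel_measurable (PiM I M)"
    by (intro borel_measurable_prod_ennreal) measurable
  show ?thesis
  proof (rule D.PiM_eqI[symmetric, OF I])
    show "sets (density (PiM I M) (\<lambda>x. \<Prod>i\<in>I. f i (x i))) = sets (PiM I (\<lambda>i. density (M i) (f i)))"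
      by (simp cong: sets_PiM_cong)
    fix A assume "\<And>i. i \<in> I \<Longrightarrow> A i \<in> sets (density (M i) (f i))"
    then have A[measurable]: "\<And>i. i \<in> I \<Longrightarrow> A i \<in> sets (M i)" by simp
    then have AI[measurable]: "Pi\<^sub>E I A \<in> sets (PiM I M)" using I by (auto intro!: sets_PiM_I_finite)
    have "emeasure (density (PiM I M) (\<lambda>x. \<Prod>i\<in>I. f i (x i))) (Pi\<^sub>E I A)
      = (\<integral>\<^sup>+x. (\<Prod>i\<in>I. f i (x i)) * indicator (Pi\<^sub>E I A) x \<partial>PiM I M)"
      by (rule emeasure_density) auto
    also have "\<dots> = (\<integral>\<^sup>+x. (\<Prod>i\<in>I. f i (x i) * indicator (A i) (x i)) \<partial>PiM I M)"
    proof (rule nn_integral_cong)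
      fix x assume x: "x \<in> space (PiM I M)"
      show "(\<Prod>i\<in>I. f i (x i)) * indicator (Pi\<^sub>E I A) x = (\<Prod>i\<in>I. f i (x i) * indicator (A i) (x i))"
      proof (cases "x \<in> Pi\<^sub>E I A")
        case True then show ?thesis by (auto intro!: prod.cong dest: PiE_mem)
      next
        case False
        then obtain i where "i \<in> I" "x i \<notin> A i" using x by (auto simp: space_PiM PiE_def Pi_def)
        then have "f i (x i) * indicator (A i) (x i) = 0" by simp
        then have "(\<Prod>i\<in>I. f i (x i) * indicator (A i) (x i)) = 0" using I \<open>i \<in> I\<close> by (auto simp: prod_zero_iff)
        then show ?thesis using False by simp
      qed
    qed
    also have "\<dots> = (\<Prod>i\<in>I. \<integral>\<^sup>+x. f i x * indicator (A i) x \<partial>M i)"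
      by (rule M.product_nn_integral_prod[OF I]) auto
    also have "\<dots> = (\<Prod>i\<in>I. emeasure (density (M i) (f i)) (A i))"
      by (intro prod.cong) (auto simp: emeasure_density)
    finally show "emeasure (density (PiM I M) (\<lambda>x. \<Prod>i\<in>I. f i (x i))) (Pi\<^sub>E I A) = \<dots>" .
  qed
qed

text \<open>A general index set, so that the two coordinate blocks and the single steps of the
  inductions are covered as well as the whole space.\<close>

definition gauss :: "'i set \<Rightarrow> ('i \<Rightarrow> real) measure" where
  "gauss I = PiM I (\<lambda>_. std_normal)"

lemma sets_gauss[simp, measurable_cong]: "sets (gauss I) = sets (PiM I (\<lambda>_. borel))"
  unfolding gauss_def by (intro sets_PiM_cong) auto

lemma space_gauss: "space (gauss I) = extensional I"
  by (simp add: gauss_def space_PiM PiE_def)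

lemma prob_space_gauss: "prob_space (gauss I)"
  unfolding gauss_def by (rule prob_space_PiM) (rule prob_space_std_normal)

lemma nn_integral_gauss_insert:
  assumes "finite I" "i \<notin> I" "f \<in> borel_measurable (PiM (insert i I) (\<lambda>_. borel))"
  shows "(\<integral>\<^sup>+x. f x \<partial>gauss (insert i I)) = (\<integral>\<^sup>+x. (\<integral>\<^sup>+y. f (x(i := y)) \<partial>std_normal) \<partial>gauss I)"
  unfolding gauss_def
  by (rule std_normals.product_nn_integral_insert[OF assms(1,2)])
    (use assms(3) measurable_cong_sets[OF sets_gauss[unfolded gauss_def] refl] in blast)

lemma nn_integral_gauss_union:
  assumes "finite I" "finite J" "I \<inter> J = {}" "f \<in> borel_measurable (PiM (I \<union> J) (\<lambda>_. borel))"
  shows "(\<integral>\<^sup>+x. f x \<partial>gauss (I \<union> J)) = (\<integral>\<^sup>+y. (\<integral>\<^sup>+z. f (merge I J (y, z)) \<partial>gauss J) \<partial>gauss I)"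
  unfolding gauss_def
  by (rule std_normals.product_nn_integral_fold[OF assms(3,1,2)])
    (use assms(4) measurable_cong_sets[OF sets_gauss[unfolded gauss_def] refl] in blast)

lemma integral_gauss_insert:
  fixes f :: "('i \<Rightarrow> real) \<Rightarrow> real"
  assumes "finite I" "i \<notin> I" "integrable (gauss (insert i I)) f"
  shows "(\<integral>x. f x \<partial>gauss (insert i I)) = (\<integral>x. (\<integral>y. f (x(i := y)) \<partial>std_normal) \<partial>gauss I)"
  using assms unfolding gauss_def by (rule std_normals.product_integral_insert)

lemma integral_gauss_cis:
  assumes "finite J"
  shows "(\<integral>z. cis (\<Sum>j\<in>J. b j * z j) \<partial>gauss J) = complex_of_real (exp (- (\<Sum>j\<in>J. (b j)\<^sup>2) / 2))"
proof -
  have "(\<integral>z. cis (\<Sum>j\<in>J. b j * z j) \<partial>gauss J) = (\<integral>z. (\<Prod>j\<in>J. iexp (b j * z j)) \<partial>gauss J)"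
    using assms by (simp add: cis_conv_exp exp_sum sum_distrib_left)
  also have "\<dots> = (\<Prod>j\<in>J. \<integral>x. iexp (b j * x) \<partial>std_normal)"
    unfolding gauss_def using assms
    by (intro std_normals.product_integral_prod)
      (auto intro!: std_normal.integrable_const_bound[where B=1])
  also have "\<dots> = (\<Prod>j\<in>J. complex_of_real (exp (- ((b j)\<^sup>2) / 2)))"
    using fun_cong[OF char_std_normal_distribution] by (simp add: char_def std_normal_def)
  also have "\<dots> = complex_of_real (exp (- (\<Sum>j\<in>J. (b j)\<^sup>2) / 2))"
    using assms by (simp add: exp_sum sum_negf[symmetric] sum_divide_distrib)
  finally show ?thesis .
qed

lemma integral_gauss_cos_sin:
  assumes "finite J"
  shows "(\<integral>z. cos ((\<Sum>j\<in>J. b j * z j) + s) \<partial>gauss J) = exp (- (\<Sum>j\<in>J. (b j)\<^sup>2) / 2) * cos s" (is ?c)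
    and "(\<integral>z. sin ((\<Sum>j\<in>J. b j * z j) + s) \<partial>gauss J) = exp (- (\<Sum>j\<in>J. (b j)\<^sup>2) / 2) * sin s" (is ?s)
proof -
  interpret prob_space "gauss J" by (rule prob_space_gauss)
  have int: "integrable (gauss J) (\<lambda>z. cis (\<Sum>j\<in>J. b j * z j))"
    by (rule integrable_const_bound[where B=1]) (auto simp: cis_conv_exp)
  then have int': "integrable (gauss J) (\<lambda>z. cis s * cis (\<Sum>j\<in>J. b j * z j))" by simp
  have "(\<integral>z. cis s * cis (\<Sum>j\<in>J. b j * z j) \<partial>gauss J) = cis s * exp (- (\<Sum>j\<in>J. (b j)\<^sup>2) / 2)"
    using int integral_gauss_cis[OF assms, of b] by simp
  then have "Re (\<integral>z. cis s * cis (\<Sum>j\<in>J. b j * z j) \<partial>gauss J) = exp (- (\<Sum>j\<in>J. (b j)\<^sup>2) / 2) * cos s"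
     "Im (\<integral>z. cis s * cis (\<Sum>j\<in>J. b j * z j) \<partial>gauss J) = exp (- (\<Sum>j\<in>J. (b j)\<^sup>2) / 2) * sin s"
    by (simp_all add: Re_exp)
  moreover have "Re (cis s * cis x) = cos (x + s)" "Im (cis s * cis x) = sin (x + s)" for x
    by (simp_all add: cos_add sin_add)
  ultimately show ?c ?s
    using integral_Re[OF int'] integral_Im[OF int'] by simp_all
qed

text \<open>Cameron-Martin for vectors: the product measure \<open>PiM J D\<close> is identified
  once as a density and once as the law of the shifted vector. Every integral with a factor
  \<open>tilt\<close> is evaluated in this way.\<close>

lemma nn_integral_gauss_shift:
  assumes J: "finite J" and F[measurable]: "F \<in> borel_measurable (PiM J (\<lambda>_. borel))"
  shows "(\<integral>\<^sup>+z. ennreal (exp (\<Sum>j\<in>J. a j * z j - (a j)\<^sup>2 / 2)) * F z \<partial>gauss J)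
    = (\<integral>\<^sup>+z. F (\<lambda>j\<in>J. z j + a j) \<partial>gauss J)"
proof -
  define D where "D = (\<lambda>j. density std_normal (\<lambda>x. ennreal (exp (a j * x - (a j)\<^sup>2 / 2))))"
  have Dd: "D j = distr std_normal std_normal (\<lambda>x. x + a j)" for j
    by (simp add: D_def distr_std_normal_shift)
  have pD: "prob_space (D j)" for j unfolding Dd by (rule std_normal.prob_space_distr) simp
  have sD: "sets (D j) = sets borel" for j by (simp add: D_def)
  interpret D: product_prob_space D by (rule product_prob_spaceI) (rule pD)
  have 1: "PiM J D = density (gauss J) (\<lambda>x. \<Prod>j\<in>J. ennreal (exp (a j * x j - (a j)\<^sup>2 / 2)))"
    unfolding D_def gauss_def
    by (rule density_PiM[OF J]) (use D.sigma_finite_measures std_normal.sigma_finite_measure_axioms in \<open>auto simp: D_def\<close>)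
  have sets: "sets (PiM J D) = sets (PiM J (\<lambda>_. borel))" by (intro sets_PiM_cong) (auto simp: sD)
  have sm[measurable]: "(\<lambda>z. \<lambda>j\<in>J. z j + a j) \<in> measurable (gauss J) (PiM J (\<lambda>_. borel))" by measurable
  have 2: "distr (gauss J) (PiM J (\<lambda>_. borel)) (\<lambda>z. \<lambda>j\<in>J. z j + a j) = PiM J D"
  proof (rule D.PiM_eqI[OF J])
    show "sets (distr (gauss J) (PiM J (\<lambda>_. borel)) (\<lambda>z. \<lambda>j\<in>J. z j + a j)) = sets (PiM J D)" by (simp add: sets)
    fix A assume "\<And>i. i \<in> J \<Longrightarrow> A i \<in> sets (D i)"
    then have A[measurable]: "\<And>i. i \<in> J \<Longrightarrow> A i \<in> sets borel" by (simp add: sD)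
    have AI: "Pi\<^sub>E J A \<in> sets (PiM J (\<lambda>_. borel))" using A J by (auto intro!: sets_PiM_I_finite)
    have "emeasure (distr (gauss J) (PiM J (\<lambda>_. borel)) (\<lambda>z. \<lambda>j\<in>J. z j + a j)) (Pi\<^sub>E J A)
      = emeasure (gauss J) (\<Pi>\<^sub>E j\<in>J. (\<lambda>x. x + a j) -` A j)"
      using AI by (subst emeasure_distr) (auto intro!: arg_cong[where f="emeasure _"] simp: space_gauss PiE_def Pi_def)
    also have "\<dots> = (\<Prod>j\<in>J. emeasure std_normal ((\<lambda>x. x + a j) -` A j))"
      unfolding gauss_def using J A
      by (intro std_normals.emeasure_PiM) (auto intro!: measurable_sets_borel[OF _ A])
    also have "\<dots> = (\<Prod>j\<in>J. emeasure (D j) (A j))"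
      unfolding Dd by (intro prod.cong refl, subst emeasure_distr) auto
    finally show "emeasure (distr (gauss J) (PiM J (\<lambda>_. borel)) (\<lambda>z. \<lambda>j\<in>J. z j + a j)) (Pi\<^sub>E J A) = \<dots>" .
  qed
  have "(\<integral>\<^sup>+z. F (\<lambda>j\<in>J. z j + a j) \<partial>gauss J) = (\<integral>\<^sup>+z. F z \<partial>PiM J D)"
    unfolding 2[symmetric] by (subst nn_integral_distr) auto
  also have "\<dots> = (\<integral>\<^sup>+z. (\<Prod>j\<in>J. ennreal (exp (a j * z j - (a j)\<^sup>2 / 2))) * F z \<partial>gauss J)"
    unfolding 1 by (subst nn_integral_density) auto
  also have "\<dots> = (\<integral>\<^sup>+z. ennreal (exp (\<Sum>j\<in>J. a j * z j - (a j)\<^sup>2 / 2)) * F z \<partial>gauss J)"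
    using J by (simp add: exp_sum prod_ennreal)
  finally show ?thesis by simp
qed

lemma nn_integral_gauss_exp_linear:
  assumes J: "finite J"
  shows "(\<integral>\<^sup>+z. ennreal (exp (\<Sum>j\<in>J. a j * z j)) \<partial>gauss J) = ennreal (exp ((\<Sum>j\<in>J. (a j)\<^sup>2) / 2))"
proof -
  interpret prob_space "gauss J" by (rule prob_space_gauss)
  have "(\<integral>\<^sup>+z. ennreal (exp (\<Sum>j\<in>J. a j * z j)) \<partial>gauss J)
    = (\<integral>\<^sup>+z. ennreal (exp (\<Sum>j\<in>J. a j * z j - (a j)\<^sup>2 / 2)) * ennreal (exp ((\<Sum>j\<in>J. (a j)\<^sup>2) / 2)) \<partial>gauss J)"
    by (intro nn_integral_cong)
      (simp add: ennreal_mult'[symmetric] exp_add[symmetric] sum_subtractf sum_divide_distrib)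
  also have "\<dots> = (\<integral>\<^sup>+z. ennreal (exp ((\<Sum>j\<in>J. (a j)\<^sup>2) / 2)) \<partial>gauss J)"
    by (rule nn_integral_gauss_shift[OF J]) simp
  finally show ?thesis by (simp add: emeasure_space_1)
qed

lemma std_gaussian_gauss: "std_gaussian d = gauss {..<d}"
  by (simp add: std_gaussian_def gauss_def)

text \<open>The arbitrary choice of the square root in the definition of gaussian does not matter.\<close>
lemma gaussian_eq_distr:
  assumes L: "\<And>i j. i < d \<Longrightarrow> j < d \<Longrightarrow> (\<Sum>k<d. L i k * L j k) = S i j"
  shows "gaussian d S = distr (std_gaussian d) (Rd d) (\<lambda>g. \<lambda>i\<in>{..<d}. \<Sum>k<d. L i k * g k)"
proof -
  define A where "A = (SOME A :: nat \<Rightarrow> nat \<Rightarrow> real. \<forall>i<d. \<forall>j<d. (\<Sum>k<d. A i k * A j k) = S i j)"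
  have A: "\<forall>i<d. \<forall>j<d. (\<Sum>k<d. A i k * A j k) = S i j"
    unfolding A_def by (rule someI[of _ L]) (use L in auto)
  define G where "G = (\<lambda>A. distr (gauss {..<d}) (PiM {..<d} (\<lambda>_. borel)) (\<lambda>g. \<lambda>i\<in>{..<d}. \<Sum>k<d. A i k * g k))"
  interpret prob_space "gauss {..<d}" by (rule prob_space_gauss)
  have m[measurable]: "(\<lambda>g. \<lambda>i\<in>{..<d}. \<Sum>k<d. A i k * g k) \<in> measurable (gauss {..<d}) (PiM {..<d} (\<lambda>_. borel))" for A
    by measurable
  have fin: "finite_measure (G A)" for A unfolding G_def by (intro finite_measure_distr m)
  \<comment> \<open>The characteristic function sees the root only through its product with its
    transpose, that is through \<open>S\<close>; hence it is the same for the chosen root and for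
    \<open>L\<close>.\<close>
  have E: "(\<integral>x. cos (\<Sum>i<d. t i * x i) \<partial>G A) = exp (- (\<Sum>i<d. \<Sum>j<d. t i * t j * S i j) / 2) \<and>
     (\<integral>x. sin (\<Sum>i<d. t i * x i) \<partial>G A) = 0"
    if A: "\<forall>i<d. \<forall>j<d. (\<Sum>k<d. A i k * A j k) = S i j" for A t
  proof -
    have l: "(\<Sum>i<d. t i * (\<Sum>k<d. A i k * g k)) = (\<Sum>k<d. (\<Sum>i<d. t i * A i k) * g k)" for g
      by (simp add: sum_distrib_left sum_distrib_right mult.assoc) (rule sum.swap)
    have "(\<Sum>k<d. (\<Sum>i<d. t i * A i k)\<^sup>2) = (\<Sum>k<d. \<Sum>i<d. \<Sum>j<d. t i * t j * (A i k * A j k))"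
      by (simp add: power2_eq_square sum_product mult_ac)
    also have "\<dots> = (\<Sum>i<d. \<Sum>k<d. \<Sum>j<d. t i * t j * (A i k * A j k))" by (rule sum.swap)
    also have "\<dots> = (\<Sum>i<d. \<Sum>j<d. t i * t j * (\<Sum>k<d. A i k * A j k))"
      by (rule sum.cong[OF refl], unfold sum_distrib_left, rule sum.swap)
    also have "\<dots> = (\<Sum>i<d. \<Sum>j<d. t i * t j * S i j)" using A by simp
    finally have q: "(\<Sum>k<d. (\<Sum>i<d. t i * A i k)\<^sup>2) = (\<Sum>i<d. \<Sum>j<d. t i * t j * S i j)" .
    show ?thesis
      using integral_gauss_cos_sin[of "{..<d}" "\<lambda>k. \<Sum>i<d. t i * A i k" 0]
      unfolding G_def by (subst (1 2) integral_distr) (simp_all add: l q)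
  qed
  have "G A = G L"
    by (rule PiM_borel_eqI_cos_sin[where I="{..<d}"]) (use E[OF A] E[of L] L fin in \<open>auto simp: G_def\<close>)
  then show ?thesis
    by (simp add: gaussian_def Let_def A_def[symmetric] G_def std_gaussian_gauss Rd_def)
qed

subsection \<open>Exponential moments of quadratic forms\<close>

lemma exp_taylor4:
  fixes x :: real
  shows "exp x \<le> 1 + x + x\<^sup>2 / 2 + x ^ 3 / 6 + x ^ 4 * exp \<bar>x\<bar>"
proof -
  obtain t where t: "\<bar>t\<bar> \<le> \<bar>x\<bar>" "exp x = (\<Sum>m<4. (x ^ m) / fact m) + (exp t / fact 4) * x ^ 4"
    using Maclaurin_exp_le[of x 4] by auto
  have "exp t / fact 4 \<le> exp \<bar>x\<bar> / 1" using t(1) by (intro frac_le) (auto simp: fact_numeral)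
  then have "(exp t / fact 4) * x ^ 4 \<le> x ^ 4 * exp \<bar>x\<bar>"
    using mult_right_mono[of "exp t / fact 4" "exp \<bar>x\<bar>" "x ^ 4"] by (simp add: mult.commute)
  moreover have "(\<Sum>m<4. (x ^ m) / fact m) = 1 + x + x\<^sup>2 / 2 + x ^ 3 / 6"
    by (simp add: eval_nat_numeral)
  ultimately show ?thesis using t(2) by linarith
qed

lemma cosh_taylor4:
  fixes x :: real
  shows "cosh x \<le> 1 + x\<^sup>2 / 2 + x ^ 4 / 8 * exp \<bar>x\<bar>"
proof -
  have *: "exp y \<le> 1 + y + y\<^sup>2 / 2 + y ^ 3 / 6 + y ^ 4 / 8 * exp \<bar>y\<bar>" for y :: real
  proof -
    obtain t where t: "\<bar>t\<bar> \<le> \<bar>y\<bar>" "exp y = (\<Sum>m<4. (y ^ m) / fact m) + (exp t / fact 4) * y ^ 4"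
      using Maclaurin_exp_le[of y 4] by auto
    have "exp t / fact 4 \<le> exp \<bar>y\<bar> / 8" using t(1) by (intro frac_le) (auto simp: fact_numeral)
    then have "(exp t / fact 4) * y ^ 4 \<le> y ^ 4 / 8 * exp \<bar>y\<bar>"
      using mult_right_mono[of "exp t / fact 4" "exp \<bar>y\<bar> / 8" "y ^ 4"] by (simp add: mult.commute)
    moreover have "(\<Sum>m<4. (y ^ m) / fact m) = 1 + y + y\<^sup>2 / 2 + y ^ 3 / 6"
      by (simp add: eval_nat_numeral)
    ultimately show ?thesis using t(2) by linarith
  qed
  define e where "e = x ^ 4 / 8 * exp \<bar>x\<bar>"
  have "exp x \<le> 1 + x + x\<^sup>2 / 2 + x ^ 3 / 6 + e" "exp (- x) \<le> 1 - x + x\<^sup>2 / 2 - x ^ 3 / 6 + e"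
    using *[of x] *[of "-x"] by (simp_all add: e_def)
  then have "(exp x + exp (- x)) / 2 \<le> 1 + x\<^sup>2 / 2 + e" by (simp add: field_simps)
  then show ?thesis by (simp add: cosh_field_def e_def)
qed

lemma cos_taylor4:
  fixes x :: real
  shows "cos x \<le> 1 - x\<^sup>2 / 2 + x ^ 4"
proof -
  obtain t where t: "cos x = (\<Sum>m<4. cos_coeff m * x ^ m) + (cos (t + 1/2 * real 4 * pi) / fact 4) * x ^ 4"
    using Maclaurin_cos_expansion[of x 4] by auto
  have "cos (t + 1/2 * real 4 * pi) / fact 4 \<le> 1 / 1" by (intro frac_le) (auto simp: fact_numeral)
  then have "(cos (t + 1/2 * real 4 * pi) / fact 4) * x ^ 4 \<le> x ^ 4"
    using mult_right_mono[of "cos (t + 1/2 * real 4 * pi) / fact 4" 1 "x ^ 4"] by simp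
  moreover have "(\<Sum>m<4. cos_coeff m * x ^ m) = 1 - x\<^sup>2 / 2"
  proof -
    have "{..<4::nat} = {0, 1, 2, 3}" by auto
    then show ?thesis by (simp add: cos_coeff_def fact_numeral)
  qed
  ultimately show ?thesis using t by linarith
qed

text \<open>A single term of the exponential series; 384 is \<open>2 ^ 4 * fact 4\<close>. Only half
  of the exponent is spent, which leaves room for another factor
  \<open>exp (\<bar>x\<bar> / 2)\<close> in \<open>pow4_exp\<close>.\<close>

lemma pow4_le_exp:
  fixes x :: real
  shows "x ^ 4 \<le> 384 * exp (\<bar>x\<bar> / 2)"
proof -
  obtain t where t: "exp (\<bar>x\<bar> / 2) = (\<Sum>m<5. ((\<bar>x\<bar> / 2) ^ m) / fact m) + (exp t / fact 5) * (\<bar>x\<bar> / 2) ^ 5"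
    using Maclaurin_exp_le[of "\<bar>x\<bar> / 2" 5] by auto
  have "((\<bar>x\<bar> / 2) ^ 4) / fact 4 \<le> (\<Sum>m<5. ((\<bar>x\<bar> / 2) ^ m) / fact m)"
    by (rule member_le_sum) auto
  also have "\<dots> \<le> exp (\<bar>x\<bar> / 2)" unfolding t by simp
  finally show ?thesis by (simp add: fact_numeral power_divide)
qed

text \<open>Subgaussianity of a random sign. For small \<open>x\<close> the Taylor bound is at most
  \<open>1 + x\<^sup>2\<close>; otherwise \<open>exp \<bar>x\<bar>\<close> is already small
  enough.\<close>

lemma cosh_le_exp_square:
  fixes x :: real
  shows "cosh x \<le> exp (x\<^sup>2)"
proof (cases "\<bar>x\<bar> \<le> 1")
  case True
  have "x\<^sup>2 \<le> 1" using True by (simp add: abs_square_le_1)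
  then have "x\<^sup>2 * x\<^sup>2 \<le> x\<^sup>2 * 1" by (intro mult_left_mono) auto
  then have x4: "x ^ 4 \<le> x\<^sup>2" by (simp add: power2_eq_square eval_nat_numeral mult_ac)
  have "exp \<bar>x\<bar> \<le> 3" using True exp_le order_trans[of "exp \<bar>x\<bar>" "exp 1" 3] by simp
  then have "x ^ 4 / 8 * exp \<bar>x\<bar> \<le> x\<^sup>2 / 8 * 3" using x4 by (intro mult_mono) auto
  then have "cosh x \<le> 1 + x\<^sup>2" using cosh_taylor4[of x] zero_le_power2[of x] by linarith
  also have "\<dots> \<le> exp (x\<^sup>2)" by (rule exp_ge_add_one_self)
  finally show ?thesis .
next
  case False
  have "cosh x \<le> exp \<bar>x\<bar>" by (simp add: cosh_def field_simps abs_if) 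
  also have "\<bar>x\<bar> * 1 \<le> \<bar>x\<bar> * \<bar>x\<bar>" using False by (intro mult_left_mono) auto
  then have "exp \<bar>x\<bar> \<le> exp (x\<^sup>2)" by (simp add: power2_eq_square)
  finally show ?thesis .
qed

section \<open>Quadratic forms of Gaussian vectors: trace, Frobenius norm, exponential
  moments\<close>

definition qform :: "'i set \<Rightarrow> ('i \<Rightarrow> 'i \<Rightarrow> real) \<Rightarrow> ('i \<Rightarrow> real) \<Rightarrow> real" where
  "qform I M y = (\<Sum>i\<in>I. \<Sum>j\<in>I. M i j * y i * y j)"

definition mtrace :: "'i set \<Rightarrow> ('i \<Rightarrow> 'i \<Rightarrow> real) \<Rightarrow> real" where
  "mtrace I M = (\<Sum>i\<in>I. M i i)"

definition frob_sq :: "'i set \<Rightarrow> ('i \<Rightarrow> 'i \<Rightarrow> real) \<Rightarrow> real" where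
  "frob_sq I M = (\<Sum>i\<in>I. \<Sum>j\<in>I. (M i j)\<^sup>2)"

lemma frob_sq_nonneg: "0 \<le> frob_sq I M"
  by (simp add: frob_sq_def sum_nonneg)

lemma qform_insert:
  assumes "finite I" "k \<notin> I"
  shows "qform (insert k I) M y = M k k * (y k)\<^sup>2 + y k * (\<Sum>j\<in>I. (M k j + M j k) * y j) + qform I M y"
  using assms
  by (simp add: qform_def sum.distrib sum_distrib_left power2_eq_square algebra_simps)

lemma frob_sq_insert:
  assumes "finite I" "k \<notin> I"
  shows "frob_sq (insert k I) M = (M k k)\<^sup>2 + (\<Sum>j\<in>I. (M k j)\<^sup>2) + (\<Sum>j\<in>I. (M j k)\<^sup>2) + frob_sq I M"
  using assms by (simp add: frob_sq_def sum.distrib)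

lemma qform_cong: "(\<And>i. i \<in> I \<Longrightarrow> y i = z i) \<Longrightarrow> qform I M y = qform I M z"
  unfolding qform_def by (intro sum.cong) auto

lemma qform_rank_one: "qform I (\<lambda>i j. v i * v j) y = (\<Sum>i\<in>I. v i * y i)\<^sup>2"
  by (simp add: qform_def power2_eq_square sum_product mult_ac)

text \<open>Cauchy-Schwarz on pairs of indices, applied to \<open>M\<close> and the rank-one matrix
  of \<open>v\<close>: the Frobenius norm dominates the operator norm.\<close>

lemma qform_le: "qform I M v \<le> sqrt (frob_sq I M) * (\<Sum>i\<in>I. (v i)\<^sup>2)"
proof -
  have "qform I M v = (\<Sum>p\<in>I\<times>I. M (fst p) (snd p) * (v (fst p) * v (snd p)))"
    by (simp add: qform_def sum.cartesian_product case_prod_beta mult.assoc)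
  then have "(qform I M v)\<^sup>2 \<le> (\<Sum>p\<in>I\<times>I. (M (fst p) (snd p))\<^sup>2) * (\<Sum>p\<in>I\<times>I. (v (fst p) * v (snd p))\<^sup>2)"
    using Cauchy_Schwarz_ineq_sum by metis
  also have "(\<Sum>p\<in>I\<times>I. (M (fst p) (snd p))\<^sup>2) = frob_sq I M"
    by (simp add: frob_sq_def sum.cartesian_product case_prod_beta)
  also have "(\<Sum>p\<in>I\<times>I. (v (fst p) * v (snd p))\<^sup>2) = (\<Sum>i\<in>I. (v i)\<^sup>2)\<^sup>2"
    by (simp add: sum.cartesian_product case_prod_beta power2_eq_square sum_product mult_ac)
  finally have "\<bar>qform I M v\<bar> \<le> sqrt (frob_sq I M * (\<Sum>i\<in>I. (v i)\<^sup>2)\<^sup>2)"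
    using real_le_rsqrt real_sqrt_le_mono[of "(qform I M v)\<^sup>2"] by fastforce
  also have "\<dots> = sqrt (frob_sq I M) * (\<Sum>i\<in>I. (v i)\<^sup>2)"
    by (simp add: real_sqrt_mult sum_nonneg)
  finally show ?thesis by linarith
qed

text \<open>Averaging \<open>exp (y\<^sup>T M y)\<close> over one subgaussian coordinate \<open>k\<close> leaves such an exponential
  with matrix \<open>M'\<close>. The potential \<open>tr + 4 |.|\<^sub>F\<^sup>2\<close> does not increase.\<close>
lemma peel_potential:
  fixes M :: "'i \<Rightarrow> 'i \<Rightarrow> real"
  assumes I: "finite I" "k \<notin> I" and sym: "\<And>i j. M i j = M j i"
    and small: "frob_sq (insert k I) M \<le> 1 / 256"
  defines "M' \<equiv> \<lambda>i j. M i j + 4 * (M k i * M k j)"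
  shows "frob_sq I M' \<le> 1 / 256" "\<bar>M k k\<bar> \<le> 1 / 16"
    "M k k + 4 * (M k k)\<^sup>2 + (mtrace I M' + 4 * frob_sq I M') \<le> mtrace (insert k I) M + 4 * frob_sq (insert k I) M"
    "M k k * x\<^sup>2 + x * (\<Sum>j\<in>I. (M k j + M j k) * y j) = M k k * x\<^sup>2 + 2 * (\<Sum>j\<in>I. M k j * y j) * x"
    "qform I M y + 4 * (\<Sum>j\<in>I. M k j * y j)\<^sup>2 = qform I M' y"
proof -
  define V A2 where "V = (\<Sum>j\<in>I. (M k j)\<^sup>2)" and "A2 = frob_sq I M"
  define A where "A = sqrt A2"
  have sym': "(\<Sum>j\<in>I. (M j k)\<^sup>2) = V" unfolding V_def by (simp add: sym[of _ k])
  have V: "0 \<le> V" by (simp add: V_def sum_nonneg)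
  have A2: "0 \<le> A2" by (simp add: A2_def frob_sq_nonneg)
  have A: "0 \<le> A" "A\<^sup>2 = A2" using A2 by (simp_all add: A_def)
  have F: "frob_sq (insert k I) M = (M k k)\<^sup>2 + 2 * V + A2"
    using I by (simp add: frob_sq_insert sym' V_def A2_def)
  have "frob_sq I M' = (\<Sum>i\<in>I. \<Sum>j\<in>I. (M i j)\<^sup>2 + 8 * (M i j * M k i * M k j) + 16 * ((M k i)\<^sup>2 * (M k j)\<^sup>2))"
    unfolding frob_sq_def M'_def by (intro sum.cong refl) (simp add: power2_eq_square algebra_simps)
  also have "\<dots> = A2 + 8 * qform I M (M k) + 16 * V\<^sup>2"
    by (simp add: sum.distrib A2_def frob_sq_def qform_def V_def power2_eq_square sum_product sum_distrib_left mult_ac)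
  also have "\<dots> \<le> A2 + 8 * (A * V) + 16 * V\<^sup>2"
    using qform_le[of I M "M k"] by (simp add: V_def A_def A2_def)
  finally have F': "frob_sq I M' \<le> A2 + 8 * (A * V) + 16 * V\<^sup>2" .
  have bounds: "A2 \<le> 1 / 256" "V \<le> 1 / 512" "(M k k)\<^sup>2 \<le> 1/256"
    using small F V A2 zero_le_power2[of "M k k"] by linarith+
  have A16: "A \<le> 1 / 16"
    using real_sqrt_le_mono[OF bounds(1)] by (simp add: A_def real_sqrt_divide)
  have "A * V \<le> 1 / 16 * V" using A16 V by (intro mult_right_mono)
  moreover have "V\<^sup>2 \<le> 1 / 512 * V" unfolding power2_eq_square using bounds(2) V by (intro mult_right_mono)
  \<comment> \<open>The coefficient is 8/16 + 16/512 = 17/32. Removing row and column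
    \<open>k\<close> frees \<open>2 * V\<close> of the squared norm; multiplied by 4 this pays for
    four times the increase here and for the gain \<open>4 * V\<close> of the trace.\<close>
  ultimately have F'': "frob_sq I M' \<le> A2 + 17/32 * V" using F' by linarith
  then show "frob_sq I M' \<le> 1 / 256" using small F V zero_le_power2[of "M k k"] by linarith
  show "\<bar>M k k\<bar> \<le> 1 / 16"
    using real_sqrt_le_mono[OF bounds(3)] by (simp add: real_sqrt_divide)
  have "mtrace I M' = mtrace I M + 4 * V"
    by (simp add: mtrace_def M'_def sum.distrib V_def sum_distrib_left power2_eq_square)
  moreover have "mtrace (insert k I) M = M k k + mtrace I M" using I by (simp add: mtrace_def)
  ultimately show "M k k + 4 * (M k k)\<^sup>2 + (mtrace I M' + 4 * frob_sq I M') \<le> mtrace (insert k I) M + 4 * frob_sq (insert k I) M"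
    using F F'' V by linarith
  show "M k k * x\<^sup>2 + x * (\<Sum>j\<in>I. (M k j + M j k) * y j) = M k k * x\<^sup>2 + 2 * (\<Sum>j\<in>I. M k j * y j) * x"
  proof -
    have "(\<Sum>j\<in>I. (M k j + M j k) * y j) = (\<Sum>j\<in>I. 2 * (M k j * y j))"
      by (rule sum.cong[OF refl]) (use sym[of _ k] in simp)
    then show ?thesis by (simp add: sum_distrib_left[symmetric])
  qed
  have "qform I M' y = (\<Sum>i\<in>I. \<Sum>j\<in>I. M i j * y i * y j + 4 * ((M k i * M k j) * y i * y j))"
    unfolding qform_def M'_def by (intro sum.cong refl) (simp add: algebra_simps)
  also have "\<dots> = qform I M y + 4 * qform I (\<lambda>i j. M k i * M k j) y"
    by (simp add: sum.distrib qform_def sum_distrib_left)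
  finally show "qform I M y + 4 * (\<Sum>j\<in>I. M k j * y j)\<^sup>2 = qform I M' y"
    by (simp add: qform_rank_one)
qed

lemma measurable_qform[measurable]: "(\<lambda>y. qform I M y) \<in> borel_measurable (PiM I (\<lambda>_. borel))"
  unfolding qform_def by measurable

text \<open>The exact value is the inverse square root of det (1 - 2 M). Integrating out one
  coordinate at a time avoids diagonalization: by \<open>peel_potential\<close> the smallness
  condition survives each step and the exponent never grows, so the bound does not depend on the
  dimension.\<close>

lemma nn_integral_gauss_exp_qform_sym:
  assumes "finite I" "\<And>i j. M i j = M j i" "frob_sq I M \<le> 1 / 256"
  shows "(\<integral>\<^sup>+y. ennreal (exp (qform I M y)) \<partial>gauss I) \<le> ennreal (exp (mtrace I M + 4 * frob_sq I M))"
  using assms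
proof (induction I arbitrary: M rule: finite_induct)
  case empty
  interpret prob_space "gauss {}" by (rule prob_space_gauss)
  show ?case by (simp add: qform_def mtrace_def frob_sq_def emeasure_space_1)
next
  case (insert k I)
  define M' where "M' = (\<lambda>i j. M i j + 4 * (M k i * M k j))"
  note P = peel_potential[OF insert.hyps insert.prems, folded M'_def]
  have "(\<integral>\<^sup>+y. ennreal (exp (qform (insert k I) M y)) \<partial>gauss (insert k I))
    = (\<integral>\<^sup>+y. (\<integral>\<^sup>+x. ennreal (exp (qform (insert k I) M (y(k := x)))) \<partial>std_normal) \<partial>gauss I)"
    by (rule nn_integral_gauss_insert[OF insert.hyps]) measurable
  also have "\<dots> \<le> (\<integral>\<^sup>+y. ennreal (exp (M k k + 4 * (M k k)\<^sup>2)) * ennreal (exp (qform I M' y)) \<partial>gauss I)"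
  proof (rule nn_integral_mono)
    fix y
    define b where "b = (\<Sum>j\<in>I. M k j * y j)"
    have [simp]: "(\<Sum>j\<in>I. M k j * (if j = k then x else y j)) = b" for x
      using insert.hyps by (auto simp: b_def intro!: sum.cong)
    have q: "qform (insert k I) M (y(k := x)) = (M k k * x\<^sup>2 + 2 * b * x) + qform I M y" for x
    proof -
      have "qform I M (y(k := x)) = qform I M y" by (rule qform_cong) (use insert.hyps in auto)
      then show ?thesis using P(4)[of x "y(k := x)"] insert.hyps by (simp add: qform_insert)
    qed
    have "(\<integral>\<^sup>+x. ennreal (exp (qform (insert k I) M (y(k := x)))) \<partial>std_normal)
      = (\<integral>\<^sup>+x. ennreal (exp (M k k * x\<^sup>2 + 2 * b * x)) * ennreal (exp (qform I M y)) \<partial>std_normal)"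
      by (simp add: q exp_add ennreal_mult')
    also have "\<dots> = (\<integral>\<^sup>+x. ennreal (exp (M k k * x\<^sup>2 + 2 * b * x)) \<partial>std_normal) * ennreal (exp (qform I M y))"
      by (rule nn_integral_multc) simp
    also have "\<dots> \<le> ennreal (exp (M k k + 4 * (M k k)\<^sup>2 + 3 * b\<^sup>2)) * ennreal (exp (qform I M y))"
      by (intro mult_right_mono nn_integral_std_normal_quadratic_le P) simp
    also have "\<dots> \<le> ennreal (exp (M k k + 4 * (M k k)\<^sup>2 + (qform I M y + 4 * b\<^sup>2)))"
      by (simp add: ennreal_mult'[symmetric] exp_add[symmetric] del: ennreal_le_iff) (intro ennreal_leI, simp)
    also have "\<dots> = ennreal (exp (M k k + 4 * (M k k)\<^sup>2)) * ennreal (exp (qform I M' y))"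
      unfolding b_def P(5) by (simp add: exp_add ennreal_mult')
    finally show "(\<integral>\<^sup>+x. ennreal (exp (qform (insert k I) M (y(k := x)))) \<partial>std_normal)
      \<le> ennreal (exp (M k k + 4 * (M k k)\<^sup>2)) * ennreal (exp (qform I M' y))" .
  qed
  also have "\<dots> = ennreal (exp (M k k + 4 * (M k k)\<^sup>2)) * (\<integral>\<^sup>+y. ennreal (exp (qform I M' y)) \<partial>gauss I)"
    by (rule nn_integral_cmult) measurable
  also have "\<dots> \<le> ennreal (exp (M k k + 4 * (M k k)\<^sup>2)) * ennreal (exp (mtrace I M' + 4 * frob_sq I M'))"
    using insert.prems(1) P(1) by (intro mult_left_mono insert.IH) (auto simp: M'_def mult.commute)
  also have "\<dots> \<le> ennreal (exp (mtrace (insert k I) M + 4 * frob_sq (insert k I) M))"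
    using P(3) by (simp add: ennreal_mult'[symmetric] exp_add[symmetric])
  finally show ?case .
qed

text \<open>Passing to the symmetric part \<open>S\<close> preserves the form and the trace and does
  not increase the Frobenius norm. Overlap matrices are not symmetric in general.\<close>

lemma nn_integral_gauss_exp_qform:
  assumes "finite I" "frob_sq I M \<le> 1 / 256"
  shows "(\<integral>\<^sup>+y. ennreal (exp (qform I M y)) \<partial>gauss I) \<le> ennreal (exp (mtrace I M + 4 * frob_sq I M))"
proof -
  define S where "S = (\<lambda>i j. (M i j + M j i) / 2)"
  have tr: "mtrace I S = mtrace I M" by (simp add: S_def mtrace_def)
  have sw: "(\<Sum>i\<in>I. \<Sum>j\<in>I. f j i) = (\<Sum>i\<in>I. \<Sum>j\<in>I. f i j)" for f :: "_ \<Rightarrow> _ \<Rightarrow> real"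
    by (rule sum.swap)
  have q: "qform I S y = qform I M y" for y
  proof -
    have "qform I S y = (\<Sum>i\<in>I. \<Sum>j\<in>I. M i j * y i * y j / 2) + (\<Sum>i\<in>I. \<Sum>j\<in>I. M j i * y j * y i / 2)"
      unfolding qform_def S_def sum.distrib[symmetric] by (intro sum.cong refl) (simp add: field_simps)
    then show ?thesis by (simp add: sw[of "\<lambda>i j. M i j * y i * y j"] qform_def sum_divide_distrib[symmetric])
  qed
  have "frob_sq I S \<le> (\<Sum>i\<in>I. \<Sum>j\<in>I. (M i j)\<^sup>2 / 2 + (M j i)\<^sup>2 / 2)"
    unfolding frob_sq_def
  proof (intro sum_mono)
    show "(S i j)\<^sup>2 \<le> (M i j)\<^sup>2 / 2 + (M j i)\<^sup>2 / 2" for i j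
      using sum_squares_bound[of "M i j" "M j i"] by (simp add: S_def power2_eq_square field_simps)
  qed
  also have "\<dots> = frob_sq I M"
    by (simp add: sum.distrib sw[of "\<lambda>i j. (M i j)\<^sup>2"] frob_sq_def sum_divide_distrib[symmetric])
  finally have f: "frob_sq I S \<le> frob_sq I M" .
  have "(\<integral>\<^sup>+y. ennreal (exp (qform I S y)) \<partial>gauss I) \<le> ennreal (exp (mtrace I S + 4 * frob_sq I S))"
    by (rule nn_integral_gauss_exp_qform_sym) (use assms f in \<open>auto simp: S_def\<close>)
  also have "\<dots> \<le> ennreal (exp (mtrace I M + 4 * frob_sq I M))"
    using f by (intro ennreal_leI) (simp add: tr)
  finally show ?thesis by (simp add: q)
qed

section \<open>Quadratic forms in random signs\<close>

definition signs :: "'i set \<Rightarrow> ('i \<Rightarrow> real) set" where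
  "signs A = A \<rightarrow>\<^sub>E {- 1, 1}"

lemma finite_signs: "finite A \<Longrightarrow> finite (signs A)"
  by (simp add: signs_def finite_PiE)

lemma card_signs: "finite A \<Longrightarrow> card (signs A) = 2 ^ card A"
  by (simp add: signs_def card_funcsetE numeral_eq_Suc)

lemma sum_signs_insert:
  fixes f :: "('i \<Rightarrow> real) \<Rightarrow> real"
  assumes "k \<notin> I"
  shows "(\<Sum>s\<in>signs (insert k I). f s) = (\<Sum>s\<in>signs I. f (s(k := - 1)) + f (s(k := 1)))"
proof -
  have "(\<Sum>s\<in>signs (insert k I). f s) = (\<Sum>(x, s)\<in>{- 1, 1} \<times> signs I. f (s(k := x)))"
    unfolding signs_def PiE_insert_eq
    by (subst sum.reindex[OF inj_combinator[OF assms]]) (simp add: case_prod_beta comp_def)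
  also have "\<dots> = (\<Sum>s\<in>signs I. f (s(k := - 1)) + f (s(k := 1)))"
    by (simp add: sum.cartesian_product[symmetric] sum.distrib)
  finally show ?thesis .
qed

text \<open>The same peeling with the average over a sign in place of the Gaussian integral: the
  square of the coordinate is 1, and the linear term averages to
  \<open>cosh (2 * b)\<close>.\<close>

lemma sum_signs_exp_qform:
  assumes "finite I" "\<And>i j. M i j = M j i" "frob_sq I M \<le> 1 / 256"
  shows "(\<Sum>s\<in>signs I. exp (qform I M s)) \<le> 2 ^ card I * exp (mtrace I M + 4 * frob_sq I M)"
  using assms
proof (induction I arbitrary: M rule: finite_induct)
  case empty
  show ?case by (simp add: qform_def mtrace_def frob_sq_def signs_def)
next
  case (insert k I)
  define M' where "M' = (\<lambda>i j. M i j + 4 * (M k i * M k j))"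
  note P = peel_potential[OF insert.hyps insert.prems, folded M'_def]
  have "(\<Sum>s\<in>signs (insert k I). exp (qform (insert k I) M s))
    = (\<Sum>s\<in>signs I. exp (qform (insert k I) M (s(k := - 1))) + exp (qform (insert k I) M (s(k := 1))))"
    by (rule sum_signs_insert) fact
  also have "\<dots> \<le> (\<Sum>s\<in>signs I. 2 * exp (M k k + 4 * (M k k)\<^sup>2) * exp (qform I M' s))"
  proof (rule sum_mono)
    fix y :: "'a \<Rightarrow> real"
    define b where "b = (\<Sum>j\<in>I. M k j * y j)"
    have [simp]: "(\<Sum>j\<in>I. M k j * (if j = k then x else y j)) = b" for x
      using insert.hyps by (auto simp: b_def intro!: sum.cong)
    have q: "qform (insert k I) M (y(k := x)) = (M k k * x\<^sup>2 + 2 * b * x) + qform I M y" for x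
    proof -
      have "qform I M (y(k := x)) = qform I M y" by (rule qform_cong) (use insert.hyps in auto)
      then show ?thesis using P(4)[of x "y(k := x)"] insert.hyps by (simp add: qform_insert)
    qed
    have "exp (qform (insert k I) M (y(k := - 1))) + exp (qform (insert k I) M (y(k := 1)))
      = 2 * exp (M k k) * exp (qform I M y) * cosh (2 * b)"
      by (simp add: q cosh_def exp_add exp_diff exp_minus field_simps)
    \<comment> \<open>The origin of the factor 4 in \<open>M'\<close>: the sign case gives
      \<open>4 * b\<^sup>2\<close> in the exponent, the Gaussian case only
      \<open>3 * b\<^sup>2\<close>.\<close>
    also have "\<dots> \<le> 2 * exp (M k k) * exp (qform I M y) * exp ((2 * b)\<^sup>2)"
      by (intro mult_left_mono cosh_le_exp_square) auto
    also have "\<dots> = 2 * exp (M k k) * exp (qform I M y + 4 * b\<^sup>2)"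
      by (simp add: exp_add power_mult_distrib)
    also have "\<dots> \<le> 2 * exp (M k k + 4 * (M k k)\<^sup>2) * exp (qform I M' y)"
      unfolding b_def P(5) by (intro mult_mono) auto
    finally show "exp (qform (insert k I) M (y(k := - 1))) + exp (qform (insert k I) M (y(k := 1)))
      \<le> 2 * exp (M k k + 4 * (M k k)\<^sup>2) * exp (qform I M' y)" .
  qed
  also have "\<dots> = 2 * exp (M k k + 4 * (M k k)\<^sup>2) * (\<Sum>s\<in>signs I. exp (qform I M' s))"
    by (simp add: sum_distrib_left)
  also have "\<dots> \<le> 2 * exp (M k k + 4 * (M k k)\<^sup>2) * (2 ^ card I * exp (mtrace I M' + 4 * frob_sq I M'))"
    using insert.prems(1) P(1) by (intro mult_left_mono insert.IH) (auto simp: M'_def mult.commute)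
  also have "\<dots> = 2 ^ card (insert k I) * exp (M k k + 4 * (M k k)\<^sup>2 + (mtrace I M' + 4 * frob_sq I M'))"
    using insert.hyps by (simp add: exp_add)
  also have "\<dots> \<le> 2 ^ card (insert k I) * exp (mtrace (insert k I) M + 4 * frob_sq (insert k I) M)"
    using P(3) by simp
  finally show ?case .
qed

section \<open>Second moments of Gaussian quadratic and bilinear forms\<close>

lemma integrable_gauss_coord_power:
  assumes "i \<in> I"
  shows "integrable (gauss I) (\<lambda>y. (y i) ^ n)"
proof -
  have "distr (PiM I (\<lambda>_. std_normal)) std_normal (\<lambda>\<omega>. \<omega> i) = std_normal"
    using distr_PiM_component[of I "\<lambda>_. std_normal" i] prob_space_std_normal assms by simp
  then have "integrable (distr (gauss I) std_normal (\<lambda>\<omega>. \<omega> i)) (\<lambda>x. x ^ n)"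
    using std_normal_moments(1)[of n] by (simp add: gauss_def)
  then show ?thesis
    by (subst (asm) integrable_distr_eq) (use assms in \<open>auto\<close>)
qed

lemma integrable_gauss_prod4:
  assumes "i \<in> I" "j \<in> I" "k \<in> I" "l \<in> I"
  shows "integrable (gauss I) (\<lambda>y. y i * y j * (y k * y l))"
proof (rule Bochner_Integration.integrable_bound)
  show "integrable (gauss I) (\<lambda>y. y i ^ 4 + y j ^ 4 + y k ^ 4 + y l ^ 4)"
    using assms by (intro Bochner_Integration.integrable_add integrable_gauss_coord_power)
  show "(\<lambda>y. y i * y j * (y k * y l)) \<in> borel_measurable (gauss I)"
    using assms by measurable
  have "norm (a * b * (c * d)) \<le> norm (a ^ 4 + b ^ 4 + c ^ 4 + d ^ 4)" for a b c d :: real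
  proof -
    have 1: "\<bar>x * y\<bar> \<le> (x\<^sup>2 + y\<^sup>2) / 2" for x y :: real
      using sum_squares_bound[of "\<bar>x\<bar>" "\<bar>y\<bar>"] by (simp add: abs_mult)
    have 2: "(a * b)\<^sup>2 \<le> (a ^ 4 + b ^ 4) / 2" for a b :: real
      using 1[of "a\<^sup>2" "b\<^sup>2"] by (simp add: power_mult_distrib power_mult[symmetric])
    have "\<bar>a * b * (c * d)\<bar> \<le> ((a * b)\<^sup>2 + (c * d)\<^sup>2) / 2" by (rule 1)
    also have "\<dots> \<le> a ^ 4 + b ^ 4 + c ^ 4 + d ^ 4"
    proof -
      have "0 \<le> x ^ 4" for x :: real by simp
      from this[of a] this[of b] this[of c] this[of d] show ?thesis
        using 2[of a b] 2[of c d] by argo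
    qed
    finally show ?thesis by simp
  qed
  then show "AE y in gauss I. norm (y i * y j * (y k * y l)) \<le> norm (y i ^ 4 + y j ^ 4 + y k ^ 4 + y l ^ 4)"
    by simp
qed

lemma integrable_gauss_prod2:
  assumes "i \<in> I" "j \<in> I"
  shows "integrable (gauss I) (\<lambda>y. y i * y j)"
proof (rule Bochner_Integration.integrable_bound)
  show "integrable (gauss I) (\<lambda>y. y i ^ 2 + y j ^ 2)"
    using assms by (intro Bochner_Integration.integrable_add integrable_gauss_coord_power)
  show "(\<lambda>y. y i * y j) \<in> borel_measurable (gauss I)" using assms by measurable
  have "norm (a * b) \<le> norm (a\<^sup>2 + b\<^sup>2)" for a b :: real
    using sum_squares_bound[of "\<bar>a\<bar>" "\<bar>b\<bar>"] mult_nonneg_nonneg[of "\<bar>a\<bar>" "\<bar>b\<bar>"] by (simp add: abs_mult del: mult_nonneg_nonneg)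
  then show "AE y in gauss I. norm (y i * y j) \<le> norm (y i ^ 2 + y j ^ 2)" by simp
qed

lemma integrable_qform:
  assumes "finite I"
  shows "integrable (gauss I) (qform I P)" "integrable (gauss I) (\<lambda>y. (qform I P y)\<^sup>2)"
proof -
  have "integrable (gauss I) (\<lambda>y. \<Sum>i\<in>I. \<Sum>j\<in>I. P i j * (y i * y j))"
    by (intro Bochner_Integration.integrable_sum integrable_mult_right integrable_gauss_prod2)
  then show "integrable (gauss I) (qform I P)" unfolding qform_def[abs_def] by (simp add: mult.assoc)
  have "integrable (gauss I) (\<lambda>y. \<Sum>i\<in>I. \<Sum>j\<in>I. \<Sum>k\<in>I. \<Sum>l\<in>I. (P i j * P k l) * (y i * y j * (y k * y l)))"
    by (intro Bochner_Integration.integrable_sum integrable_mult_right integrable_gauss_prod4)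
  moreover have "(qform I P y)\<^sup>2 = (\<Sum>i\<in>I. \<Sum>j\<in>I. \<Sum>k\<in>I. \<Sum>l\<in>I. (P i j * P k l) * (y i * y j * (y k * y l)))" for y
    unfolding qform_def power2_eq_square sum_distrib_left sum_distrib_right
    by (intro sum.cong refl sum.swap[THEN trans]) (simp_all add: mult_ac)
  ultimately show "integrable (gauss I) (\<lambda>y. (qform I P y)\<^sup>2)" by simp
qed

lemma qform_update:
  assumes "finite I" "k \<notin> I"
  shows "qform (insert k I) P (y(k := x)) = P k k * x\<^sup>2 + x * (\<Sum>j\<in>I. (P k j + P j k) * y j) + qform I P y"
proof -
  have "qform I P (y(k := x)) = qform I P y" by (rule qform_cong) (use assms in auto)
  moreover have "(\<Sum>j\<in>I. (P k j + P j k) * (if j = k then x else y j)) = (\<Sum>j\<in>I. (P k j + P j k) * y j)"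
    by (rule sum.cong) (use assms in auto)
  ultimately show ?thesis using assms by (simp add: qform_insert)
qed

lemma integral_qform:
  assumes "finite I"
  shows "(\<integral>y. qform I P y \<partial>gauss I) = mtrace I P"
  using assms
proof (induction I rule: finite_induct)
  case (insert k I)
  interpret prob_space "gauss I" by (rule prob_space_gauss)
  have "(\<integral>y. qform (insert k I) P y \<partial>gauss (insert k I))
    = (\<integral>y. (\<integral>x. qform (insert k I) P (y(k := x)) \<partial>std_normal) \<partial>gauss I)"
    using insert.hyps by (intro integral_gauss_insert integrable_qform) auto
  also have "\<dots> = (\<integral>y. P k k + qform I P y \<partial>gauss I)"
    using insert.hyps std_normal_moments(1)[of 1] std_normal_moments(1)[of 2]
    by (simp add: qform_update std_normal_moments std_normal.prob_space)
  also have "\<dots> = mtrace (insert k I) P"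
    using insert integrable_qform(1)[of I P] by (simp add: mtrace_def prob_space)
  finally show ?case .
qed (simp add: qform_def mtrace_def)

lemma integral_linear_square:
  assumes "finite I"
  shows "integrable (gauss I) (\<lambda>y. (\<Sum>i\<in>I. a i * y i)\<^sup>2)"
    "(\<integral>y. (\<Sum>i\<in>I. a i * y i)\<^sup>2 \<partial>gauss I) = (\<Sum>i\<in>I. (a i)\<^sup>2)"
proof -
  have q: "qform I (\<lambda>i j. a i * a j) = (\<lambda>y. (\<Sum>i\<in>I. a i * y i)\<^sup>2)"
    by (simp add: qform_rank_one fun_eq_iff)
  show "integrable (gauss I) (\<lambda>y. (\<Sum>i\<in>I. a i * y i)\<^sup>2)"
    "(\<integral>y. (\<Sum>i\<in>I. a i * y i)\<^sup>2 \<partial>gauss I) = (\<Sum>i\<in>I. (a i)\<^sup>2)"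
    using integrable_qform(1)[OF assms, of "\<lambda>i j. a i * a j"] integral_qform[OF assms, of "\<lambda>i j. a i * a j"]
    unfolding q by (simp_all add: mtrace_def power2_eq_square)
qed

text \<open>Wick's formula for a possibly nonsymmetric matrix: the three terms are the three
  pairings of four Gaussian factors. For an overlap matrix the first and the last are of order d^-2
  on average, whereas the Frobenius norm is of order 1/d and has to be cancelled later.\<close>

lemma integral_qform_square:
  assumes "finite I"
  shows "(\<integral>y. (qform I P y)\<^sup>2 \<partial>gauss I) = (mtrace I P)\<^sup>2 + frob_sq I P + (\<Sum>i\<in>I. \<Sum>j\<in>I. P i j * P j i)"
  using assms
proof (induction I rule: finite_induct)
  case empty
  show ?case by (simp add: qform_def mtrace_def frob_sq_def)
next
  case (insert k I)
  interpret prob_space "gauss I" by (rule prob_space_gauss)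
  define l where "l y = (\<Sum>j\<in>I. (P k j + P j k) * y j)" for y
  note int = integrable_qform[OF insert.hyps(1), of P] integral_linear_square[OF insert.hyps(1), of "\<lambda>j. P k j + P j k", folded l_def]
  have inner: "(\<integral>x. (P k k * x\<^sup>2 + x * b + q)\<^sup>2 \<partial>std_normal) = 3 * (P k k)\<^sup>2 + b\<^sup>2 + 2 * P k k * q + q\<^sup>2" for b q
  proof -
    have "(P k k * x\<^sup>2 + x * b + q)\<^sup>2 = (P k k)\<^sup>2 * x ^ 4 + (2 * P k k * b) * x ^ 3 + (b\<^sup>2 + 2 * P k k * q) * x\<^sup>2 + (2 * b * q) * x + q\<^sup>2" for x
      by (simp add: power2_eq_square eval_nat_numeral algebra_simps)
    then show ?thesis
      using std_normal_moments(1)[of 1] std_normal_moments(1)[of 2] std_normal_moments(1)[of 3] std_normal_moments(1)[of 4]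
      by (simp add: std_normal_moments std_normal.prob_space)
  qed
  have "(\<integral>y. (qform (insert k I) P y)\<^sup>2 \<partial>gauss (insert k I))
    = (\<integral>y. (\<integral>x. (qform (insert k I) P (y(k := x)))\<^sup>2 \<partial>std_normal) \<partial>gauss I)"
    using insert.hyps by (intro integral_gauss_insert integrable_qform) auto
  also have "\<dots> = (\<integral>y. 3 * (P k k)\<^sup>2 + (l y)\<^sup>2 + 2 * P k k * qform I P y + (qform I P y)\<^sup>2 \<partial>gauss I)"
    using insert.hyps by (simp add: qform_update l_def inner)
  also have "\<dots> = 3 * (P k k)\<^sup>2 + (\<Sum>j\<in>I. (P k j + P j k)\<^sup>2) + 2 * P k k * mtrace I P + (\<integral>y. (qform I P y)\<^sup>2 \<partial>gauss I)"
    using int by (simp add: prob_space integral_qform[OF insert.hyps(1)])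
  also have "\<dots> = (mtrace (insert k I) P)\<^sup>2 + frob_sq (insert k I) P + (\<Sum>i\<in>insert k I. \<Sum>j\<in>insert k I. P i j * P j i)"
    using insert.hyps unfolding insert.IH
    by (simp add: mtrace_def frob_sq_insert power2_sum sum.distrib sum_distrib_left power2_eq_square algebra_simps)
  finally show ?case .
qed

text \<open>A common interface for the centred quadratic form and the bilinear form. Both are scaled
  to have exponential moments at most 2, and all Taylor remainders are then dominated by multiples
  of \<open>exp \<bar>X\<bar>\<close>, whose mean is at most 2 + 2.\<close>

locale exp_moment = prob_space +
  fixes X :: "'a \<Rightarrow> real"
  assumes measurable_X[measurable]: "X \<in> borel_measurable M"
    and exp_moment: "(\<integral>\<^sup>+x. ennreal (exp (X x)) \<partial>M) \<le> 2" "(\<integral>\<^sup>+x. ennreal (exp (- X x)) \<partial>M) \<le> 2"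
begin

lemma exp_abs: "integrable M (\<lambda>x. exp \<bar>X x\<bar>)" "(\<integral>x. exp \<bar>X x\<bar> \<partial>M) \<le> 4"
proof -
  have "(\<integral>\<^sup>+x. ennreal (exp \<bar>X x\<bar>) \<partial>M) \<le> (\<integral>\<^sup>+x. ennreal (exp (X x)) + ennreal (exp (- X x)) \<partial>M)"
    by (intro nn_integral_mono) (auto simp: abs_if)
  also have "\<dots> \<le> 2 + 2" unfolding nn_integral_add[OF measurable_X[THEN measurable_compose, of "\<lambda>x. ennreal (exp x)" borel] measurable_X[THEN measurable_compose, of "\<lambda>x. ennreal (exp (- x))" borel], simplified]
    by (intro add_mono exp_moment)
  finally have *: "(\<integral>\<^sup>+x. ennreal (exp \<bar>X x\<bar>) \<partial>M) \<le> 4" by simp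
  show i: "integrable M (\<lambda>x. exp \<bar>X x\<bar>)"
    by (rule integrableI_bounded) (use * in \<open>auto intro: le_less_trans\<close>)
  have "ennreal (\<integral>x. exp \<bar>X x\<bar> \<partial>M) \<le> ennreal 4"
    using * nn_integral_eq_integral[OF i] by simp
  then show "(\<integral>x. exp \<bar>X x\<bar> \<partial>M) \<le> 4" by (subst (asm) ennreal_le_iff) auto
qed

lemma integrable_dominated:
  assumes [measurable]: "f \<in> borel_measurable M" and "\<And>x. x \<in> space M \<Longrightarrow> \<bar>f x\<bar> \<le> C * exp \<bar>X x\<bar>"
  shows "integrable M f" "(\<integral>x. f x \<partial>M) \<le> 4 * C"
proof -
  obtain x0 where "x0 \<in> space M" using not_empty by auto
  then have "0 \<le> C * exp \<bar>X x0\<bar>" using assms(2)[of x0] by linarith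
  then have C: "0 \<le> C" by (simp add: zero_le_mult_iff)
  show i: "integrable M f"
    by (rule Bochner_Integration.integrable_bound[where f="\<lambda>x. C * exp \<bar>X x\<bar>"])
      (use exp_abs(1) assms(2) in \<open>auto intro!: AE_I2 intro: order_trans[OF _ abs_ge_self]\<close>)
  have "(\<integral>x. f x \<partial>M) \<le> (\<integral>x. C * exp \<bar>X x\<bar> \<partial>M)"
    by (rule integral_mono) (use i exp_abs(1) assms(2) in \<open>auto dest: abs_le_D1\<close>)
  also have "\<dots> \<le> C * 4" using exp_abs C by (simp add: mult_left_mono)
  finally show "(\<integral>x. f x \<partial>M) \<le> 4 * C" by simp
qed

lemma pow4_exp: "\<bar>(X x) ^ 4 * exp (\<bar>X x\<bar> / 2)\<bar> \<le> 384 * exp \<bar>X x\<bar>"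
proof -
  have "(X x) ^ 4 * exp (\<bar>X x\<bar> / 2) \<le> 384 * exp (\<bar>X x\<bar> / 2) * exp (\<bar>X x\<bar> / 2)"
    by (intro mult_right_mono pow4_le_exp) auto
  also have "\<dots> = 384 * exp \<bar>X x\<bar>" by (simp add: exp_add[symmetric])
  finally show ?thesis by simp
qed

end

definition bform :: "'i set \<Rightarrow> ('i \<Rightarrow> 'i \<Rightarrow> real) \<Rightarrow> ('i \<Rightarrow> real) \<Rightarrow> ('i \<Rightarrow> real) \<Rightarrow> real" where
  "bform I P h g = (\<Sum>i\<in>I. \<Sum>j\<in>I. P i j * h i * g j)"

lemma qform_scale: "qform I (\<lambda>i j. c * M i j) y = c * qform I M y"
  by (simp add: qform_def sum_distrib_left mult.assoc)

lemma mtrace_scale: "mtrace I (\<lambda>i j. c * M i j) = c * mtrace I M"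
  by (simp add: mtrace_def sum_distrib_left)

lemma frob_sq_scale: "frob_sq I (\<lambda>i j. c * M i j) = c\<^sup>2 * frob_sq I M"
  by (simp add: frob_sq_def sum_distrib_left power_mult_distrib)

lemma bform_eq_linear: "bform I P h g = (\<Sum>j\<in>I. (\<Sum>i\<in>I. P i j * h i) * g j)"
  unfolding bform_def by (subst sum.swap) (simp add: sum_distrib_right)

lemma measurable_bform[measurable]:
  "(\<lambda>x. bform I P (fst x) (snd x)) \<in> borel_measurable (PiM I (\<lambda>_. borel) \<Otimes>\<^sub>M PiM I (\<lambda>_. borel))"
  unfolding bform_def by measurable

text \<open>The factor 16 brings the squared Frobenius norm exactly to the threshold 1/256 of
  \<open>nn_integral_gauss_exp_qform\<close>. Centring removes the trace, and only
  \<open>exp (4 / 256)\<close> remains.\<close>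

lemma exp_moment_qform:
  assumes I: "finite I" and s: "s > 0" "frob_sq I P \<le> s\<^sup>2"
  shows "exp_moment (gauss I) (\<lambda>y. (qform I P y - mtrace I P) / (16 * s))"
proof -
  interpret prob_space "gauss I" by (rule prob_space_gauss)
  have *: "(\<integral>\<^sup>+y. ennreal (exp (c * (qform I P y - mtrace I P))) \<partial>gauss I) \<le> 2"
    if c: "c\<^sup>2 = 1 / (16 * s)\<^sup>2" for c
  proof -
    define M where "M = (\<lambda>i j. c * P i j)"
    have "frob_sq I M \<le> c\<^sup>2 * s\<^sup>2" using s by (simp add: M_def frob_sq_scale mult_left_mono)
    also have "\<dots> = 1 / 256" using s(1) unfolding c by (simp add: power_mult_distrib)
    finally have F: "frob_sq I M \<le> 1 / 256" .
    have "(\<integral>\<^sup>+y. ennreal (exp (c * (qform I P y - mtrace I P))) \<partial>gauss I)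
      = (\<integral>\<^sup>+y. ennreal (exp (qform I M y)) * ennreal (exp (- mtrace I M)) \<partial>gauss I)"
      by (simp add: M_def qform_scale mtrace_scale ennreal_mult'[symmetric] exp_add[symmetric] algebra_simps)
    also have "\<dots> = (\<integral>\<^sup>+y. ennreal (exp (qform I M y)) \<partial>gauss I) * ennreal (exp (- mtrace I M))"
      by (rule nn_integral_multc) measurable
    also have "\<dots> \<le> ennreal (exp (mtrace I M + 4 * frob_sq I M)) * ennreal (exp (- mtrace I M))"
      by (intro mult_right_mono nn_integral_gauss_exp_qform I F) simp
    also have "\<dots> = ennreal (exp (4 * frob_sq I M))"
      by (simp add: ennreal_mult'[symmetric] exp_add[symmetric])
    also have "\<dots> \<le> ennreal 2"
    proof (rule ennreal_leI)
      have "exp (4 * frob_sq I M) \<le> exp (1/2)" using F by simp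
      also have "\<dots> \<le> 2" using exp_half_le2 by simp
      finally show "exp (4 * frob_sq I M) \<le> 2" .
    qed
    finally show ?thesis by simp
  qed
  show ?thesis
  proof
    show "(\<lambda>y. (qform I P y - mtrace I P) / (16 * s)) \<in> borel_measurable (gauss I)" by measurable
    show "(\<integral>\<^sup>+x. ennreal (exp ((qform I P x - mtrace I P) / (16 * s))) \<partial>gauss I) \<le> 2"
      "(\<integral>\<^sup>+x. ennreal (exp (- ((qform I P x - mtrace I P) / (16 * s)))) \<partial>gauss I) \<le> 2"
      using *[of "1 / (16 * s)"] *[of "- 1 / (16 * s)"] by (simp_all add: power_divide power_mult_distrib)
  qed
qed

lemma pair_gauss:
  "pair_prob_space (gauss I) (gauss J)"
  using prob_space_gauss[of I] prob_space_gauss[of J] by (auto simp: pair_prob_space_def pair_sigma_finite_def intro: prob_space_imp_sigma_finite)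

text \<open>Integrating over the second vector leaves the exponential of a quadratic form in the
  first, with matrix \<open>M\<close> proportional to \<open>P P\<^sup>T\<close>, whose Frobenius
  norm is at most \<open>frob_sq I P\<close> up to that factor. Its trace is itself of order
  \<open>c\<^sup>2 * s\<^sup>2\<close>, so no centring takes place.\<close>

lemma exp_moment_bform:
  assumes I: "finite I" and s: "s > 0" "frob_sq I P \<le> s\<^sup>2"
  shows "exp_moment (gauss I \<Otimes>\<^sub>M gauss I) (\<lambda>x. bform I P (fst x) (snd x) / (4 * s))"
proof -
  interpret G: prob_space "gauss I" by (rule prob_space_gauss)
  interpret P: pair_prob_space "gauss I" "gauss I" by (rule pair_gauss)
  have *: "(\<integral>\<^sup>+x. ennreal (exp (c * bform I P (fst x) (snd x))) \<partial>(gauss I \<Otimes>\<^sub>M gauss I)) \<le> 2"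
    if c: "c\<^sup>2 = 1 / (4 * s)\<^sup>2" for c
  proof -
    define W where "W = (\<lambda>i k. \<Sum>j\<in>I. P i j * P k j)"
    define M where "M = (\<lambda>i k. c\<^sup>2 / 2 * W i k)"
    have "frob_sq I W \<le> (\<Sum>i\<in>I. \<Sum>k\<in>I. (\<Sum>j\<in>I. (P i j)\<^sup>2) * (\<Sum>j\<in>I. (P k j)\<^sup>2))"
      unfolding frob_sq_def W_def by (intro sum_mono Cauchy_Schwarz_ineq_sum)
    also have "\<dots> = (frob_sq I P)\<^sup>2" by (simp add: frob_sq_def power2_eq_square sum_product)
    finally have FW: "frob_sq I W \<le> (frob_sq I P)\<^sup>2" .
    have cs: "c\<^sup>2 * frob_sq I P \<le> 1 / 16"
    proof -
      have "c\<^sup>2 * frob_sq I P \<le> c\<^sup>2 * s\<^sup>2" using s by (intro mult_left_mono) auto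
      also have "\<dots> = 1 / 16" using s(1) unfolding c by (simp add: power_mult_distrib)
      finally show ?thesis .
    qed
    have c0: "0 \<le> c\<^sup>2 * frob_sq I P" by (simp add: frob_sq_nonneg)
    have "frob_sq I M = (c\<^sup>2)\<^sup>2 / 4 * frob_sq I W"
      unfolding M_def frob_sq_scale by (simp add: power_divide)
    also have "\<dots> \<le> (c\<^sup>2)\<^sup>2 / 4 * (frob_sq I P)\<^sup>2" by (intro mult_left_mono FW) auto
    also have "\<dots> = (c\<^sup>2 * frob_sq I P)\<^sup>2 / 4" by (simp add: power_mult_distrib)
    also have "\<dots> \<le> (1/16)\<^sup>2 / 4" using cs c0 by (intro divide_right_mono power_mono) auto
    finally have FM: "frob_sq I M \<le> 1 / 1024" by (simp add: power2_eq_square)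
    have "mtrace I M = c\<^sup>2 * frob_sq I P / 2"
      unfolding M_def mtrace_scale by (simp add: mtrace_def W_def frob_sq_def power2_eq_square)
    then have TM: "mtrace I M \<le> 1 / 32" using cs by simp
    have lin: "qform I M h = (\<Sum>j\<in>I. (c * (\<Sum>i\<in>I. P i j * h i))\<^sup>2) / 2" for h
    proof -
      have "qform I W h = (\<Sum>i\<in>I. \<Sum>k\<in>I. \<Sum>j\<in>I. (P i j * h i) * (P k j * h k))"
        by (simp add: qform_def W_def sum_distrib_left sum_distrib_right mult_ac)
      also have "\<dots> = (\<Sum>i\<in>I. \<Sum>j\<in>I. \<Sum>k\<in>I. (P i j * h i) * (P k j * h k))"
        by (rule sum.cong[OF refl], rule sum.swap)
      also have "\<dots> = (\<Sum>j\<in>I. \<Sum>i\<in>I. \<Sum>k\<in>I. (P i j * h i) * (P k j * h k))" by (rule sum.swap)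
      also have "\<dots> = (\<Sum>j\<in>I. (\<Sum>i\<in>I. P i j * h i)\<^sup>2)" by (simp add: power2_eq_square sum_product)
      finally show ?thesis
        unfolding M_def qform_scale power_mult_distrib sum_distrib_left[symmetric] by simp
    qed
    have "(\<integral>\<^sup>+x. ennreal (exp (c * bform I P (fst x) (snd x))) \<partial>(gauss I \<Otimes>\<^sub>M gauss I))
      = (\<integral>\<^sup>+h. (\<integral>\<^sup>+g. ennreal (exp (c * bform I P h g)) \<partial>gauss I) \<partial>gauss I)"
      by (subst G.nn_integral_fst[symmetric]) auto
    also have "\<dots> = (\<integral>\<^sup>+h. ennreal (exp (qform I M h)) \<partial>gauss I)"
    proof (rule nn_integral_cong)
      fix h
      have "c * bform I P h g = (\<Sum>j\<in>I. (c * (\<Sum>i\<in>I. P i j * h i)) * g j)" for g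
        by (simp add: bform_eq_linear sum_distrib_left sum_distrib_right mult.assoc)
      then show "(\<integral>\<^sup>+g. ennreal (exp (c * bform I P h g)) \<partial>gauss I) = ennreal (exp (qform I M h))"
        by (simp only: nn_integral_gauss_exp_linear[OF I] lin)
    qed
    also have "\<dots> \<le> ennreal (exp (mtrace I M + 4 * frob_sq I M))"
      by (rule nn_integral_gauss_exp_qform[OF I]) (use FM in simp)
    also have "\<dots> \<le> ennreal 2"
    proof (rule ennreal_leI)
      have "exp (mtrace I M + 4 * frob_sq I M) \<le> exp (1/2)" using FM TM by simp
      also have "\<dots> \<le> 2" using exp_half_le2 by simp
      finally show "exp (mtrace I M + 4 * frob_sq I M) \<le> 2" .
    qed
    finally show ?thesis by simp
  qed
  show ?thesis
  proof
    show "(\<lambda>x. bform I P (fst x) (snd x) / (4 * s)) \<in> borel_measurable (gauss I \<Otimes>\<^sub>M gauss I)" by measurable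
    show "(\<integral>\<^sup>+x. ennreal (exp (bform I P (fst x) (snd x) / (4 * s))) \<partial>(gauss I \<Otimes>\<^sub>M gauss I)) \<le> 2"
      "(\<integral>\<^sup>+x. ennreal (exp (- (bform I P (fst x) (snd x) / (4 * s)))) \<partial>(gauss I \<Otimes>\<^sub>M gauss I)) \<le> 2"
      using *[of "1 / (4 * s)"] *[of "- 1 / (4 * s)"] by (simp_all add: power_divide power_mult_distrib)
  qed
qed

lemma integral_bform_square:
  assumes I: "finite I"
  shows "integrable (gauss I \<Otimes>\<^sub>M gauss I) (\<lambda>x. (bform I P (fst x) (snd x))\<^sup>2)"
    "(\<integral>x. (bform I P (fst x) (snd x))\<^sup>2 \<partial>(gauss I \<Otimes>\<^sub>M gauss I)) = frob_sq I P"
proof -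
  interpret P: pair_prob_space "gauss I" "gauss I" by (rule pair_gauss)
  \<comment> \<open>The summand 1 only makes \<open>s\<close> positive when \<open>P\<close>
    vanishes.\<close>
  define s where "s = sqrt (frob_sq I P + 1)"
  have s: "s > 0" "frob_sq I P \<le> s\<^sup>2" using frob_sq_nonneg[of I P] by (simp_all add: s_def)
  interpret E: exp_moment "gauss I \<Otimes>\<^sub>M gauss I" "\<lambda>x. bform I P (fst x) (snd x) / (4 * s)"
    by (rule exp_moment_bform[OF I s])
  show int: "integrable (gauss I \<Otimes>\<^sub>M gauss I) (\<lambda>x. (bform I P (fst x) (snd x))\<^sup>2)"
  proof (rule E.integrable_dominated(1)[where C="32 * s\<^sup>2"])
    fix x
    let ?b = "bform I P (fst x) (snd x)"
    have "?b\<^sup>2 = 16 * s\<^sup>2 * \<bar>?b / (4 * s)\<bar>\<^sup>2" using s(1) by (simp add: power_divide power_mult_distrib)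
    moreover have "\<bar>?b / (4 * s)\<bar>\<^sup>2 \<le> 2 * exp \<bar>?b / (4 * s)\<bar>"
      using exp_lower_Taylor_quadratic[of "\<bar>?b / (4 * s)\<bar>"] abs_ge_zero[of "?b / (4 * s)"] by argo
    then have "16 * s\<^sup>2 * \<bar>?b / (4 * s)\<bar>\<^sup>2 \<le> 16 * s\<^sup>2 * (2 * exp \<bar>?b / (4 * s)\<bar>)"
      by (intro mult_left_mono) auto
    ultimately show "\<bar>?b\<^sup>2\<bar> \<le> 32 * s\<^sup>2 * exp \<bar>?b / (4 * s)\<bar>" by simp
  qed measurable
  have "(\<integral>x. (bform I P (fst x) (snd x))\<^sup>2 \<partial>(gauss I \<Otimes>\<^sub>M gauss I))
    = (\<integral>h. (\<integral>g. (bform I P h g)\<^sup>2 \<partial>gauss I) \<partial>gauss I)"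
    using P.integral_fst'[OF int] by simp
  also have "\<dots> = (\<integral>h. (\<Sum>j\<in>I. (\<Sum>i\<in>I. P i j * h i)\<^sup>2) \<partial>gauss I)"
    by (simp add: bform_eq_linear integral_linear_square[OF I])
  also have "\<dots> = (\<Sum>j\<in>I. \<Sum>i\<in>I. (P i j)\<^sup>2)"
    by (subst Bochner_Integration.integral_sum) (simp_all add: integral_linear_square[OF I])
  also have "\<dots> = frob_sq I P" unfolding frob_sq_def by (rule sum.swap)
  finally show "(\<integral>x. (bform I P (fst x) (snd x))\<^sup>2 \<partial>(gauss I \<Otimes>\<^sub>M gauss I)) = frob_sq I P" .
qed

section \<open>The weight of the auxiliary Gaussian vector\<close>

definition gibbs_norm :: "'i set \<Rightarrow> real \<Rightarrow> ('i \<Rightarrow> 'i \<Rightarrow> real) \<Rightarrow> real" where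
  "gibbs_norm I \<tau> U = (\<integral>h. exp (- (\<tau> * qform I U h / 2)) \<partial>gauss I)"

text \<open>A probability density with respect to \<open>gauss I\<close>. It arises when
  \<open>damp\<close> is written as an average over an auxiliary vector \<open>h\<close> and
  \<open>z\<close> is integrated out. It is close to 1, because \<open>qform I U h\<close>
  concentrates near its mean \<open>mtrace I U = 1\<close>.\<close>

definition gibbs :: "'i set \<Rightarrow> real \<Rightarrow> ('i \<Rightarrow> 'i \<Rightarrow> real) \<Rightarrow> ('i \<Rightarrow> real) \<Rightarrow> real" where
  "gibbs I \<tau> U h = exp (- (\<tau> * qform I U h / 2)) / gibbs_norm I \<tau> U"

locale gibbs_matrix =
  fixes I :: "'i set" and \<tau> :: real and U :: "'i \<Rightarrow> 'i \<Rightarrow> real" and s :: real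
  assumes I: "finite I" and \<tau>: "0 \<le> \<tau>" and psd: "\<And>h. 0 \<le> qform I U h"
    and sym: "\<And>i j. U i j = U j i" and trace: "mtrace I U = 1" and frob: "frob_sq I U \<le> s\<^sup>2"
begin

lemma measurable_gibbs[measurable]: "gibbs I \<tau> U \<in> borel_measurable (PiM I (\<lambda>_. borel))"
  unfolding gibbs_def[abs_def] by measurable

lemma exp_le_1: "exp (- (\<tau> * qform I U h / 2)) \<le> 1"
  using psd[of h] \<tau> by simp

lemma integrable_exp: "integrable (gauss I) (\<lambda>h. exp (- (\<tau> * qform I U h / 2)))"
proof -
  interpret prob_space "gauss I" by (rule prob_space_gauss)
  show ?thesis by (rule integrable_const_bound[where B=1]) (use exp_le_1 in auto)
qed

text \<open>Jensen's inequality, carried out with the tangent of the exponential at the mean value 1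
  of the quadratic form.\<close>

lemma gibbs_norm_ge: "exp (- \<tau> / 2) \<le> gibbs_norm I \<tau> U"
proof -
  interpret prob_space "gauss I" by (rule prob_space_gauss)
  note i = integrable_qform(1)[OF I, of U]
  have "exp (- \<tau> / 2) = (\<integral>h. exp (- \<tau> / 2) * (1 - \<tau> / 2 * (qform I U h - 1)) \<partial>gauss I)"
    using i by (simp add: integral_qform[OF I] trace prob_space)
  also have "\<dots> \<le> gibbs_norm I \<tau> U"
    unfolding gibbs_norm_def
  proof (rule integral_mono[OF _ integrable_exp])
    show "integrable (gauss I) (\<lambda>h. exp (- \<tau> / 2) * (1 - \<tau> / 2 * (qform I U h - 1)))" using i by simp
    fix h
    have "exp (- \<tau> / 2) * (1 - \<tau> / 2 * (qform I U h - 1)) \<le> exp (- \<tau> / 2) * exp (- \<tau> / 2 * (qform I U h - 1))"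
      using exp_ge_add_one_self[of "- \<tau> / 2 * (qform I U h - 1)"] by (intro mult_left_mono) auto
    also have "\<dots> = exp (- (\<tau> * qform I U h / 2))" by (simp add: exp_add[symmetric] field_simps)
    finally show "exp (- \<tau> / 2) * (1 - \<tau> / 2 * (qform I U h - 1)) \<le> exp (- (\<tau> * qform I U h / 2))" .
  qed
  finally show ?thesis .
qed

lemma gibbs_norm_pos: "0 < gibbs_norm I \<tau> U"
  using gibbs_norm_ge exp_gt_zero[of "- \<tau> / 2"] by linarith

lemma gibbs_nonneg: "0 \<le> gibbs I \<tau> U h"
  using gibbs_norm_pos by (simp add: gibbs_def)

lemma inverse_norm_le: "1 / gibbs_norm I \<tau> U \<le> exp (\<tau> / 2)"
proof -
  have "1 / gibbs_norm I \<tau> U \<le> 1 / exp (- \<tau> / 2)"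
    by (intro divide_left_mono gibbs_norm_ge) (use gibbs_norm_pos in auto)
  then show ?thesis by (simp add: exp_minus inverse_eq_divide)
qed

lemma gibbs_le: "gibbs I \<tau> U h \<le> exp (\<tau> / 2)"
proof -
  have "gibbs I \<tau> U h \<le> 1 / gibbs_norm I \<tau> U"
    unfolding gibbs_def using exp_le_1[of h] gibbs_norm_pos by (intro divide_right_mono) auto
  then show ?thesis using inverse_norm_le by linarith
qed

lemma gibbs_bound: "\<bar>gibbs I \<tau> U h\<bar> \<le> exp (\<tau> / 2)"
  using gibbs_le[of h] gibbs_nonneg[of h] by simp

lemma integral_gibbs: "integrable (gauss I) (gibbs I \<tau> U)" "(\<integral>h. gibbs I \<tau> U h \<partial>gauss I) = 1"
proof -
  show "integrable (gauss I) (gibbs I \<tau> U)" using integrable_exp by (simp add: gibbs_def[abs_def])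
  have "(\<integral>h. gibbs I \<tau> U h \<partial>gauss I) = gibbs_norm I \<tau> U / gibbs_norm I \<tau> U"
    unfolding gibbs_def by (simp add: gibbs_norm_def)
  then show "(\<integral>h. gibbs I \<tau> U h \<partial>gauss I) = 1" using gibbs_norm_pos by simp
qed

text \<open>The mean \<open>D\<close> minimizes the mean squared deviation, so it may be replaced by
  the explicit constant \<open>c\<close>. The exponential is Lipschitz on the relevant half-line,
  which leaves the variance of the quadratic form, \<open>2 * frob_sq I U\<close>.\<close>

lemma gibbs_variance: "(\<integral>h. (1 - gibbs I \<tau> U h)\<^sup>2 \<partial>gauss I) \<le> exp \<tau> * \<tau>\<^sup>2 * s\<^sup>2"
proof -
  interpret prob_space "gauss I" by (rule prob_space_gauss)
  define D c where "D = gibbs_norm I \<tau> U" and "c = exp (- \<tau> / 2)"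
  define g where "g h = exp (- (\<tau> * qform I U h / 2))" for h
  note iq = integrable_qform[OF I, of U]
  have ig: "integrable (gauss I) g" using integrable_exp by (simp add: g_def[abs_def])
  have g01: "0 \<le> g h" "g h \<le> 1" for h using exp_le_1[of h] by (simp_all add: g_def)
  have [measurable]: "g \<in> borel_measurable (gauss I)" using ig by auto
  have ig2: "integrable (gauss I) (\<lambda>h. (g h)\<^sup>2)"
    by (rule integrable_const_bound[where B=1]) (use g01 in \<open>auto simp: power_le_one\<close>)
  have Eg: "(\<integral>h. g h \<partial>gauss I) = D" by (simp add: g_def D_def gibbs_norm_def)
  have exp_: "(\<integral>h. (g h - z)\<^sup>2 \<partial>gauss I) = (\<integral>h. (g h)\<^sup>2 \<partial>gauss I) - 2 * z * D + z\<^sup>2" for z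
    using ig ig2 by (simp add: power2_diff Eg prob_space mult.assoc mult.left_commute)
  have D: "0 < D" "1 / D \<le> exp (\<tau> / 2)" using gibbs_norm_pos inverse_norm_le by (simp_all add: D_def)
  have "(1 - gibbs I \<tau> U h)\<^sup>2 = (1 / D)\<^sup>2 * (g h - D)\<^sup>2" for h
    using D(1) unfolding gibbs_def D_def[symmetric] g_def[symmetric] by (simp add: power2_eq_square field_simps)
  then have "(\<integral>h. (1 - gibbs I \<tau> U h)\<^sup>2 \<partial>gauss I) = (1 / D)\<^sup>2 * (\<integral>h. (g h - D)\<^sup>2 \<partial>gauss I)" by simp
  also have "\<dots> \<le> (exp (\<tau> / 2))\<^sup>2 * (\<integral>h. (g h - c)\<^sup>2 \<partial>gauss I)"
  proof (intro mult_mono power_mono D)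
    have "0 \<le> (c - D)\<^sup>2" by simp
    then show "(\<integral>h. (g h - D)\<^sup>2 \<partial>gauss I) \<le> (\<integral>h. (g h - c)\<^sup>2 \<partial>gauss I)"
      unfolding exp_ by (simp add: power2_eq_square algebra_simps)
  qed (use D in auto)
  also have "(\<integral>h. (g h - c)\<^sup>2 \<partial>gauss I) \<le> (\<integral>h. \<tau>\<^sup>2 / 4 * ((qform I U h)\<^sup>2 - 2 * qform I U h + 1) \<partial>gauss I)"
  proof (rule integral_mono)
    show "integrable (gauss I) (\<lambda>h. (g h - c)\<^sup>2)" using ig ig2 by (simp add: power2_diff)
    show "integrable (gauss I) (\<lambda>h. \<tau>\<^sup>2 / 4 * ((qform I U h)\<^sup>2 - 2 * qform I U h + 1))" using iq by simp
    fix h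
    have lip: "\<bar>exp (- x) - exp (- y)\<bar> \<le> \<bar>x - y\<bar>" if "0 \<le> x" "0 \<le> y" for x y :: real
    proof -
      have *: "exp (- x) - exp (- y) \<le> y - x" if "0 \<le> x" "x \<le> y" for x y :: real
      proof -
        have "exp (- x) - exp (- y) = exp (- x) * (1 - exp (- (y - x)))" by (simp add: algebra_simps exp_add[symmetric])
        also have "\<dots> \<le> 1 * (y - x)"
        proof (intro mult_mono)
          show "1 - exp (- (y - x)) \<le> y - x" using exp_ge_add_one_self[of "- (y - x)"] by linarith
        qed (use that in auto)
        finally show ?thesis by simp
      qed
      show ?thesis using *[of x y] *[of y x] that by (cases "x \<le> y") auto
    qed
    have "\<bar>g h - c\<bar> \<le> \<bar>\<tau> / 2 * (qform I U h - 1)\<bar>"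
      using lip[of "\<tau> * qform I U h / 2" "\<tau> / 2"] psd[of h] \<tau> by (simp add: g_def c_def algebra_simps diff_divide_distrib)
    then have "(g h - c)\<^sup>2 \<le> (\<tau> / 2 * (qform I U h - 1))\<^sup>2" by (rule abs_le_square_iff[THEN iffD1])
    also have "\<dots> = \<tau>\<^sup>2 / 4 * ((qform I U h)\<^sup>2 - 2 * qform I U h + 1)"
      by (simp add: power2_eq_square algebra_simps)
    finally show "(g h - c)\<^sup>2 \<le> \<tau>\<^sup>2 / 4 * ((qform I U h)\<^sup>2 - 2 * qform I U h + 1)" .
  qed
  also have "\<dots> = \<tau>\<^sup>2 / 4 * (2 * frob_sq I U)"
  proof -
    have "(\<Sum>i\<in>I. \<Sum>j\<in>I. U i j * U j i) = frob_sq I U"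
      unfolding frob_sq_def power2_eq_square by (intro sum.cong refl) (metis sym)
    then show ?thesis using iq by (simp add: integral_qform[OF I] integral_qform_square[OF I] trace prob_space)
  qed
  also have "(exp (\<tau> / 2))\<^sup>2 * (\<tau>\<^sup>2 / 4 * (2 * frob_sq I U)) \<le> exp \<tau> * \<tau>\<^sup>2 * s\<^sup>2"
  proof -
    have "(exp (\<tau> / 2))\<^sup>2 = exp \<tau>" by (simp add: exp_double[symmetric])
    moreover have "\<tau>\<^sup>2 / 4 * (2 * frob_sq I U) \<le> \<tau>\<^sup>2 * s\<^sup>2"
    proof -
      have "\<tau>\<^sup>2 / 4 * (2 * frob_sq I U) \<le> \<tau>\<^sup>2 / 4 * (2 * s\<^sup>2)" using frob by (intro mult_left_mono) auto
      moreover have "0 \<le> \<tau>\<^sup>2 * s\<^sup>2" by simp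
      ultimately show ?thesis by argo
    qed
    ultimately show ?thesis by (simp add: mult.assoc)
  qed
  finally show ?thesis by (simp add: mult_left_mono)
qed

end

subsection \<open>Correlation of the mixtures\<close>

lemma integral_pair_gauss_times:
  fixes f g :: "_ \<Rightarrow> real"
  assumes [measurable]: "f \<in> borel_measurable (PiM I (\<lambda>_. borel))" "g \<in> borel_measurable (PiM I (\<lambda>_. borel))"
    and b: "\<And>h. \<bar>f h\<bar> \<le> a" "\<And>h. \<bar>g h\<bar> \<le> b"
  shows "integrable (gauss I \<Otimes>\<^sub>M gauss I) (\<lambda>x. f (fst x) * g (snd x))"
    "(\<integral>x. f (fst x) * g (snd x) \<partial>(gauss I \<Otimes>\<^sub>M gauss I)) = (\<integral>h. f h \<partial>gauss I) * (\<integral>h. g h \<partial>gauss I)"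
proof -
  interpret P: pair_prob_space "gauss I" "gauss I" by (rule pair_gauss)
  have "0 \<le> a" using b(1)[of undefined] by linarith
  then have "\<bar>f h * g h'\<bar> \<le> a * b" for h h' unfolding abs_mult by (intro mult_mono b) auto
  then show i: "integrable (gauss I \<Otimes>\<^sub>M gauss I) (\<lambda>x. f (fst x) * g (snd x))"
    by (intro P.P.integrable_const_bound[where B="a * b"]) auto
  show "(\<integral>x. f (fst x) * g (snd x) \<partial>(gauss I \<Otimes>\<^sub>M gauss I)) = (\<integral>h. f h \<partial>gauss I) * (\<integral>h. g h \<partial>gauss I)"
    using P.integral_fst'[OF i] by simp
qed

lemma pow4_le_square: "0 \<le> x \<Longrightarrow> x \<le> 1 \<Longrightarrow> x ^ 4 \<le> x\<^sup>2" for x :: real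
  using power_decreasing[of 2 4 x] by simp

text \<open>The atoms \<open>t \<in> A\<close> with weights \<open>p t\<close> scale the hidden matrix; \<open>\<delta>\<close> is the weight of the
  compensating component. The first and third moments vanish and the second one is compensated.\<close>
locale test_weights =
  fixes A :: "real set" and p :: "real \<Rightarrow> real" and \<delta> \<tau> T l :: real
  assumes A: "finite A" and p: "\<And>t. t \<in> A \<Longrightarrow> 0 \<le> p t" and \<delta>: "0 < \<delta>" and \<tau>: "0 \<le> \<tau>"
    and p0: "(\<Sum>t\<in>A. p t) = 1 - \<delta>" and p1: "(\<Sum>t\<in>A. p t * t) = 0"
    and p2: "(\<Sum>t\<in>A. p t * t\<^sup>2) = T" and p3: "(\<Sum>t\<in>A. p t * t ^ 3) = 0"
    and T: "\<delta> * \<tau> = T" and l: "\<And>t. t \<in> A \<Longrightarrow> \<bar>t\<bar> \<le> l"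
begin

lemma \<delta>1: "\<delta> \<le> 1"
proof -
  have "0 \<le> (\<Sum>t\<in>A. p t)" using p by (intro sum_nonneg) auto
  then show ?thesis using p0 by simp
qed

text \<open>The moments of the product of two independent atoms are squares of moments of
  \<open>p\<close>, so \<open>p1\<close> and \<open>p3\<close> delete the odd Taylor terms of the
  correlation.\<close>

lemma sum_sum_weights: "(\<Sum>t\<in>A. \<Sum>u\<in>A. p t * p u * (t * u) ^ k) = (\<Sum>t\<in>A. p t * t ^ k)\<^sup>2"
  by (simp add: power2_eq_square sum_product power_mult_distrib mult_ac)

text \<open>The correlation of two families of tilts given \<open>y\<close>, with \<open>w\<close>
  the quadratic form of the overlap matrix in \<open>y\<close>; see
  \<open>has_integral_tilt_tilt\<close>.\<close>

definition mean_exp :: "real \<Rightarrow> real" where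
  "mean_exp w = (\<Sum>t\<in>A. \<Sum>u\<in>A. p t * p u * exp (t * u * w))"

lemma abs_mult_le: "t \<in> A \<Longrightarrow> u \<in> A \<Longrightarrow> \<bar>t * u\<bar> \<le> l\<^sup>2"
  unfolding abs_mult power2_eq_square by (intro mult_mono l) (use l[of t] in auto)

text \<open>The expansion has to reach order four: stopping at a cubic remainder would leave an
  error of size \<open>s ^ 3\<close>, that is d^(-3/2), which is too large for d^2 samples.\<close>

lemma mean_exp_le: "mean_exp w \<le> (1 - \<delta>)\<^sup>2 + T\<^sup>2 / 2 * w\<^sup>2 + l ^ 8 * (w ^ 4 * exp (l\<^sup>2 * \<bar>w\<bar>))"
proof -
  have "mean_exp w \<le> (\<Sum>t\<in>A. \<Sum>u\<in>A. p t * p u * (1 + (t * u * w) + (t * u * w)\<^sup>2 / 2 + (t * u * w) ^ 3 / 6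
      + l ^ 8 * (w ^ 4 * exp (l\<^sup>2 * \<bar>w\<bar>))))"
    unfolding mean_exp_def
  proof (intro sum_mono mult_left_mono)
    fix t u assume tu: "t \<in> A" "u \<in> A"
    note le = abs_mult_le[OF tu]
    have "(t * u * w) ^ 4 * exp \<bar>t * u * w\<bar> = \<bar>t * u\<bar> ^ 4 * (w ^ 4 * exp (\<bar>t * u\<bar> * \<bar>w\<bar>))"
      by (simp add: power_mult_distrib abs_mult)
    also have "\<dots> \<le> (l\<^sup>2) ^ 4 * (w ^ 4 * exp (l\<^sup>2 * \<bar>w\<bar>))"
    proof -
      have "\<bar>t * u\<bar> * \<bar>w\<bar> \<le> l\<^sup>2 * \<bar>w\<bar>" using le by (intro mult_right_mono) auto
      then have "exp (\<bar>t * u\<bar> * \<bar>w\<bar>) \<le> exp (l\<^sup>2 * \<bar>w\<bar>)" by (simp only: exp_le_cancel_iff)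
      then have e: "w ^ 4 * exp (\<bar>t * u\<bar> * \<bar>w\<bar>) \<le> w ^ 4 * exp (l\<^sup>2 * \<bar>w\<bar>)" by (intro mult_left_mono) auto
      show ?thesis by (rule mult_mono[OF power_mono[OF le] e]) auto
    qed
    finally show "exp (t * u * w) \<le> 1 + (t * u * w) + (t * u * w)\<^sup>2 / 2 + (t * u * w) ^ 3 / 6
      + l ^ 8 * (w ^ 4 * exp (l\<^sup>2 * \<bar>w\<bar>))"
      using exp_taylor4[of "t * u * w"] by (simp add: power_mult[symmetric])
  qed (use p in auto)
  also have "\<dots> = (\<Sum>t\<in>A. \<Sum>u\<in>A. p t * p u * (t * u) ^ 0) + (\<Sum>t\<in>A. \<Sum>u\<in>A. p t * p u * (t * u) ^ 1) * w
     + (\<Sum>t\<in>A. \<Sum>u\<in>A. p t * p u * (t * u) ^ 2) * (w\<^sup>2 / 2) + (\<Sum>t\<in>A. \<Sum>u\<in>A. p t * p u * (t * u) ^ 3) * (w ^ 3 / 6)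
     + (\<Sum>t\<in>A. \<Sum>u\<in>A. p t * p u * (t * u) ^ 0) * (l ^ 8 * (w ^ 4 * exp (l\<^sup>2 * \<bar>w\<bar>)))"
    unfolding sum_distrib_right sum.distrib[symmetric]
    by (intro sum.cong refl) (simp add: power_mult_distrib algebra_simps)
  also have "\<dots> = (1 - \<delta>)\<^sup>2 + T\<^sup>2 / 2 * w\<^sup>2 + (1 - \<delta>)\<^sup>2 * (l ^ 8 * (w ^ 4 * exp (l\<^sup>2 * \<bar>w\<bar>)))"
    unfolding sum_sum_weights by (simp add: p0 p1 p2 p3)
  also have "\<dots> \<le> (1 - \<delta>)\<^sup>2 + T\<^sup>2 / 2 * w\<^sup>2 + 1 * (l ^ 8 * (w ^ 4 * exp (l\<^sup>2 * \<bar>w\<bar>)))"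
    using \<delta> \<delta>1 by (intro add_left_mono mult_right_mono) (auto simp: power_le_one)
  finally show ?thesis by simp
qed

definition mean_cos :: "real \<Rightarrow> real" where
  "mean_cos b = (\<Sum>t\<in>A. p t * cos (sqrt \<tau> * t * b))"

lemma mean_cos_le: "mean_cos b \<le> (1 - \<delta>) - \<tau> * T / 2 * b\<^sup>2 + \<tau>\<^sup>2 * l ^ 4 * b ^ 4"
proof -
  have "mean_cos b \<le> (\<Sum>t\<in>A. p t * (1 - \<tau> * t\<^sup>2 * b\<^sup>2 / 2 + \<tau>\<^sup>2 * l ^ 4 * b ^ 4))"
    unfolding mean_cos_def
  proof (intro sum_mono mult_left_mono)
    fix t assume t: "t \<in> A"
    have s2: "(sqrt \<tau>)\<^sup>2 = \<tau>" using \<tau> by simp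
    have s4: "(sqrt \<tau>) ^ 4 = \<tau>\<^sup>2" using s2 power_mult[of "sqrt \<tau>" 2 2] by simp
    have "(sqrt \<tau> * t * b) ^ 4 = \<tau>\<^sup>2 * \<bar>t\<bar> ^ 4 * b ^ 4" by (simp add: power_mult_distrib s4)
    also have "\<dots> \<le> \<tau>\<^sup>2 * l ^ 4 * b ^ 4"
      using l[OF t] by (intro mult_right_mono mult_left_mono power_mono) auto
    finally show "cos (sqrt \<tau> * t * b) \<le> 1 - \<tau> * t\<^sup>2 * b\<^sup>2 / 2 + \<tau>\<^sup>2 * l ^ 4 * b ^ 4"
      using cos_taylor4[of "sqrt \<tau> * t * b"] by (simp add: power_mult_distrib s2)
  qed (use p in auto)
  also have "\<dots> = (\<Sum>t\<in>A. p t) - (\<Sum>t\<in>A. p t * t\<^sup>2) * (\<tau> * b\<^sup>2 / 2) + (\<Sum>t\<in>A. p t) * (\<tau>\<^sup>2 * l ^ 4 * b ^ 4)"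
    unfolding sum_distrib_right sum_subtractf[symmetric] sum.distrib[symmetric]
    by (intro sum.cong refl) (simp add: algebra_simps)
  also have "\<dots> \<le> (1 - \<delta>) - T * (\<tau> * b\<^sup>2 / 2) + 1 * (\<tau>\<^sup>2 * l ^ 4 * b ^ 4)"
    unfolding p0 p2 using \<delta> by (intro add_left_mono mult_right_mono) auto
  finally show ?thesis by (simp add: mult_ac)
qed

text \<open>The inner product of two contaminated likelihood ratios, as shown in
  \<open>has_integral_rho_rho\<close>. The four terms pair atoms with atoms, atoms with the
  compensating component in both orders, and the compensating components with each other.\<close>

definition overlap :: "'i set \<Rightarrow> ('i \<Rightarrow> 'i \<Rightarrow> real) \<Rightarrow> ('i \<Rightarrow> 'i \<Rightarrow> real) \<Rightarrow> ('i \<Rightarrow> 'i \<Rightarrow> real) \<Rightarrow> real" where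
  "overlap I P U U' = (\<integral>y. mean_exp (qform I P y) \<partial>gauss I)
    + \<delta> * (\<integral>x. gibbs I \<tau> U' (snd x) * mean_cos (bform I P (fst x) (snd x)) \<partial>(gauss I \<Otimes>\<^sub>M gauss I))
    + \<delta> * (\<integral>x. gibbs I \<tau> U (fst x) * mean_cos (bform I P (fst x) (snd x)) \<partial>(gauss I \<Otimes>\<^sub>M gauss I))
    + \<delta>\<^sup>2 * (\<integral>x. gibbs I \<tau> U (fst x) * gibbs I \<tau> U' (snd x) * cosh (\<tau> * bform I P (fst x) (snd x)) \<partial>(gauss I \<Otimes>\<^sub>M gauss I))"

text \<open>Here 25165824 is \<open>384 * 16 ^ 4\<close> and 393216 is
  \<open>4 * 384 * 4 ^ 4\<close>: 384 stems from \<open>pow4_le_exp\<close>, 16 and 4 from the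
  scalings of the two forms, the remaining 4 from the mean of \<open>exp \<bar>X\<bar>\<close>. The
  32 combines that 4 with the 8 of the inequality for \<open>(a + b) ^ 4\<close>.\<close>

definition C_exp :: real where "C_exp = l ^ 8 * (32 * exp (l\<^sup>2) * 25165824)"
definition C_rest :: real where
  "C_rest = T\<^sup>2 / 4 * ((exp \<tau> * \<tau>\<^sup>2)\<^sup>2 + 393216) + 2 * \<delta> * (\<tau>\<^sup>2 * l ^ 4 * exp (\<tau> / 2) * 393216)
     + \<delta>\<^sup>2 * (\<tau> ^ 4 * exp \<tau> * 393216)"

lemma C_nonneg: "0 \<le> C_exp" "0 \<le> C_rest"
  using \<delta> by (simp_all add: C_exp_def C_rest_def)

context
  fixes I :: "'i set" and P :: "'i \<Rightarrow> 'i \<Rightarrow> real" and s :: real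
  assumes I: "finite I" and s: "0 < s" and frob: "frob_sq I P \<le> s\<^sup>2" and trace: "\<bar>mtrace I P\<bar> \<le> 1"
    and small: "32 * l\<^sup>2 * s \<le> 1" "8 * \<tau> * s \<le> 1"
begin

lemma integral_mean_exp_le:
  shows "\<And>c. \<bar>c\<bar> \<le> l\<^sup>2 \<Longrightarrow> integrable (gauss I) (\<lambda>y. exp (c * qform I P y))"
  and "(\<integral>y. mean_exp (qform I P y) \<partial>gauss I) \<le> (1 - \<delta>)\<^sup>2
    + T\<^sup>2 / 2 * ((mtrace I P)\<^sup>2 + frob_sq I P + (\<Sum>i\<in>I. \<Sum>j\<in>I. P i j * P j i)) + C_exp * ((mtrace I P)\<^sup>2 + s ^ 4)"
proof -
  define X where "X y = (qform I P y - mtrace I P) / (16 * s)" for y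
  interpret E: exp_moment "gauss I" X
    unfolding X_def by (rule exp_moment_qform[OF I s frob])
  define \<theta> where "\<theta> = mtrace I P"
  have w: "qform I P y = \<theta> + 16 * s * X y" for y using s by (simp add: X_def \<theta>_def)
  \<comment> \<open>The smallness of \<open>s\<close> lets
    \<open>exp (l\<^sup>2 * \<bar>w\<bar>)\<close> consume only half of the exponential moment of
    \<open>X\<close>; the other half absorbs the fourth power.\<close>
  have ls: "l\<^sup>2 * (16 * s) \<le> 1 / 2" using small(1) by simp
  have wX: "c * \<bar>qform I P y\<bar> \<le> l\<^sup>2 + \<bar>X y\<bar> / 2" if "0 \<le> c" "c \<le> l\<^sup>2" for y c
  proof -
    have "\<bar>qform I P y\<bar> \<le> 1 + 16 * s * \<bar>X y\<bar>"
      using trace s unfolding w \<theta>_def[symmetric] by (simp add: abs_mult order_trans[OF abs_triangle_ineq])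
    then have "c * \<bar>qform I P y\<bar> \<le> l\<^sup>2 * (1 + 16 * s * \<bar>X y\<bar>)" using that by (intro mult_mono) auto
    also have "\<dots> = l\<^sup>2 + (l\<^sup>2 * (16 * s)) * \<bar>X y\<bar>" by (simp add: algebra_simps)
    also have "\<dots> \<le> l\<^sup>2 + 1 / 2 * \<bar>X y\<bar>" by (intro add_left_mono mult_right_mono ls) auto
    finally show ?thesis by simp
  qed
  have expX: "exp (l\<^sup>2 + \<bar>X y\<bar> / 2) \<le> exp (l\<^sup>2) * exp \<bar>X y\<bar>" for y by (simp add: exp_add)
  have int: "integrable (gauss I) (\<lambda>y. exp (c * qform I P y))" if "\<bar>c\<bar> \<le> l\<^sup>2" for c
  proof (rule E.integrable_dominated(1)[where C="exp (l\<^sup>2)"])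
    fix y
    have "c * qform I P y \<le> \<bar>c\<bar> * \<bar>qform I P y\<bar>" by (metis abs_ge_self abs_mult)
    also have "\<dots> \<le> l\<^sup>2 + \<bar>X y\<bar> / 2" by (rule wX) (use that in auto)
    finally show "\<bar>exp (c * qform I P y)\<bar> \<le> exp (l\<^sup>2) * exp \<bar>X y\<bar>"
      using order_trans[OF _ expX] by simp
  qed measurable
  show "integrable (gauss I) (\<lambda>y. exp (c * qform I P y))" if "\<bar>c\<bar> \<le> l\<^sup>2" for c by (rule int[OF that])
  have int_mean: "integrable (gauss I) (\<lambda>y. mean_exp (qform I P y))"
    unfolding mean_exp_def by (intro Bochner_Integration.integrable_sum integrable_mult_right int abs_mult_le)
  define R where "R y = (qform I P y) ^ 4 * exp (l\<^sup>2 * \<bar>qform I P y\<bar>)" for y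
  have Rb: "\<bar>R y\<bar> \<le> 8 * exp (l\<^sup>2) * (\<theta>\<^sup>2 + 25165824 * s ^ 4) * exp \<bar>X y\<bar>" for y
  proof -
    have "(a + b) ^ 4 \<le> 8 * (a ^ 4 + b ^ 4)" for a b :: real
    proof -
      have "(a + b)\<^sup>2 \<le> 2 * (a\<^sup>2 + b\<^sup>2)" using sum_squares_bound[of a b] by (simp add: power2_sum)
      then have "((a + b)\<^sup>2)\<^sup>2 \<le> (2 * (a\<^sup>2 + b\<^sup>2))\<^sup>2" by (intro power_mono) auto
      also have "\<dots> \<le> 8 * (a ^ 4 + b ^ 4)"
        using sum_squares_bound[of "a\<^sup>2" "b\<^sup>2"] by (simp add: power_mult_distrib power2_sum power_mult[symmetric])
      finally show ?thesis by (simp add: power_mult[symmetric])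
    qed
    then have "(qform I P y) ^ 4 \<le> 8 * (\<theta> ^ 4 + (16 * s * X y) ^ 4)" unfolding w .
    \<comment> \<open>The trace is at most 1 in modulus, so its fourth power is weakened to a
      square; squares of the trace are quadratic forms in the signs.\<close>
    also have "\<dots> \<le> 8 * (\<theta>\<^sup>2 + 65536 * s ^ 4 * X y ^ 4)"
      using pow4_le_square[of "\<bar>\<theta>\<bar>"] trace by (simp add: \<theta>_def power_mult_distrib)
    finally have 4: "(qform I P y) ^ 4 \<le> 8 * (\<theta>\<^sup>2 + 65536 * s ^ 4 * X y ^ 4)" .
    have "R y \<le> 8 * (\<theta>\<^sup>2 + 65536 * s ^ 4 * X y ^ 4) * exp (l\<^sup>2 + \<bar>X y\<bar> / 2)"
      unfolding R_def using 4 wX[of "l\<^sup>2" y] by (intro mult_mono) auto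
    also have "\<dots> = 8 * exp (l\<^sup>2) * (\<theta>\<^sup>2 * exp (\<bar>X y\<bar> / 2) + 65536 * s ^ 4 * (X y ^ 4 * exp (\<bar>X y\<bar> / 2)))"
      by (simp add: exp_add algebra_simps)
    also have "\<dots> \<le> 8 * exp (l\<^sup>2) * (\<theta>\<^sup>2 * exp \<bar>X y\<bar> + 65536 * s ^ 4 * (384 * exp \<bar>X y\<bar>))"
      using E.pow4_exp[of y] s by (intro mult_left_mono add_mono) auto
    also have "\<dots> = 8 * exp (l\<^sup>2) * (\<theta>\<^sup>2 + 25165824 * s ^ 4) * exp \<bar>X y\<bar>" by (simp add: algebra_simps)
    finally show ?thesis by (simp add: R_def)
  qed
  have Rm[measurable]: "R \<in> borel_measurable (gauss I)" unfolding R_def[abs_def] by measurable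
  note R = E.integrable_dominated[OF Rm Rb]
  note iq = integrable_qform[OF I, of P]
  have "(\<integral>y. mean_exp (qform I P y) \<partial>gauss I) \<le> (\<integral>y. (1 - \<delta>)\<^sup>2 + T\<^sup>2 / 2 * (qform I P y)\<^sup>2 + l ^ 8 * R y \<partial>gauss I)"
    by (rule integral_mono[OF int_mean]) (use iq R mean_exp_le in \<open>auto simp: R_def\<close>)
  also have "\<dots> = (1 - \<delta>)\<^sup>2 + T\<^sup>2 / 2 * (\<integral>y. (qform I P y)\<^sup>2 \<partial>gauss I) + l ^ 8 * (\<integral>y. R y \<partial>gauss I)"
    using iq R by (simp add: E.prob_space)
  also have "l ^ 8 * (\<integral>y. R y \<partial>gauss I) \<le> l ^ 8 * (4 * (8 * exp (l\<^sup>2) * (\<theta>\<^sup>2 + 25165824 * s ^ 4)))"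
    by (intro mult_left_mono R(2)) auto
  also have "\<dots> \<le> C_exp * (\<theta>\<^sup>2 + s ^ 4)"
    unfolding C_exp_def mult.assoc by (intro mult_left_mono) (auto simp: algebra_simps)
  finally show "(\<integral>y. mean_exp (qform I P y) \<partial>gauss I) \<le> (1 - \<delta>)\<^sup>2
    + T\<^sup>2 / 2 * ((mtrace I P)\<^sup>2 + frob_sq I P + (\<Sum>i\<in>I. \<Sum>j\<in>I. P i j * P j i)) + C_exp * ((mtrace I P)\<^sup>2 + s ^ 4)"
    by (simp add: integral_qform_square[OF I] \<theta>_def)
qed

end

end

context test_weights
begin

lemma measurable_mean_cos[measurable]: "mean_cos \<in> borel_measurable borel"
  unfolding mean_cos_def[abs_def] by measurable

lemma abs_mean_cos_le: "\<bar>mean_cos b\<bar> \<le> 1"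
proof -
  have "\<bar>mean_cos b\<bar> \<le> (\<Sum>t\<in>A. \<bar>p t * cos (sqrt \<tau> * t * b)\<bar>)"
    unfolding mean_cos_def by (rule sum_abs)
  also have "\<dots> \<le> (\<Sum>t\<in>A. p t * 1)"
    unfolding abs_mult using p by (intro sum_mono mult_mono) auto
  finally show ?thesis using p0 \<delta> by simp
qed

text \<open>The terms of second order carry the integrals of \<open>b\<^sup>2\<close> against the
  weights 1, \<open>v\<close>, \<open>v'\<close> and \<open>v * v'\<close>. With
  \<open>\<delta> * \<tau> = T\<close> they combine to \<open>T\<^sup>2 / 2\<close> times the mean
  of \<open>(1 - v) * (1 - v') * b\<^sup>2\<close>. Both \<open>1 - v\<close> and
  \<open>1 - v'\<close> have size \<open>s\<close> in mean square, and so has \<open>b\<close>, so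
  that this is of order \<open>s ^ 4\<close>.\<close>

theorem overlap_le:
  assumes U: "gibbs_matrix I \<tau> U s" and U': "gibbs_matrix I \<tau> U' s"
    and s: "0 < s" and frob: "frob_sq I P \<le> s\<^sup>2" and trace: "\<bar>mtrace I P\<bar> \<le> 1"
    and small: "32 * l\<^sup>2 * s \<le> 1" "8 * \<tau> * s \<le> 1"
  shows "overlap I P U U' \<le> 1 + T\<^sup>2 / 2 * ((mtrace I P)\<^sup>2 + (\<Sum>i\<in>I. \<Sum>j\<in>I. P i j * P j i))
    + (C_exp + C_rest) * ((mtrace I P)\<^sup>2 + s ^ 4)"
proof -
  interpret U: gibbs_matrix I \<tau> U s by fact
  interpret U': gibbs_matrix I \<tau> U' s by fact
  note I = U.I
  let ?G = "gauss I \<Otimes>\<^sub>M gauss I"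
  define b where "b x = bform I P (fst x) (snd x)" for x :: "('a \<Rightarrow> real) \<times> ('a \<Rightarrow> real)"
  define v where "v x = gibbs I \<tau> U (fst x)" for x :: "('a \<Rightarrow> real) \<times> ('a \<Rightarrow> real)"
  define v' where "v' x = gibbs I \<tau> U' (snd x)" for x :: "('a \<Rightarrow> real) \<times> ('a \<Rightarrow> real)"
  define X where "X x = b x / (4 * s)" for x
  interpret E: exp_moment ?G X
    unfolding X_def b_def by (rule exp_moment_bform[OF I s frob])
  have [measurable]: "b \<in> borel_measurable ?G" "v \<in> borel_measurable ?G" "v' \<in> borel_measurable ?G"
    unfolding b_def[abs_def] v_def[abs_def] v'_def[abs_def] by measurable
  have v: "0 \<le> v x" "v x \<le> exp (\<tau> / 2)" and v': "0 \<le> v' x" "v' x \<le> exp (\<tau> / 2)" for x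
    by (simp_all add: v_def v'_def U.gibbs_nonneg U'.gibbs_nonneg U.gibbs_le U'.gibbs_le)
  have vv': "0 \<le> v x * v' x" "v x * v' x \<le> exp \<tau>" for x
    using mult_mono[OF v(2) v'(2), of x x] v v' by (simp_all add: exp_add[symmetric])
  have bX: "b x = 4 * s * X x" for x using s by (simp add: X_def)
  have tb: "\<tau> * \<bar>b x\<bar> \<le> \<bar>X x\<bar> / 2" for x
  proof -
    have "\<tau> * \<bar>b x\<bar> = (4 * \<tau> * s) * \<bar>X x\<bar>" using s by (simp add: bX abs_mult)
    also have "\<dots> \<le> 1 / 2 * \<bar>X x\<bar>" using small(2) by (intro mult_right_mono) auto
    finally show ?thesis by simp
  qed
  \<comment> \<open>One majorant for all fourth-order remainders: it exceeds
    \<open>(b x) ^ 4\<close>, and by \<open>tb\<close> it also covers the exponential factor in the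
    remainder of \<open>cosh\<close>.\<close>
  define Q where "Q x = (b x) ^ 4 * exp (\<bar>X x\<bar> / 2)" for x
  have Qm[measurable]: "Q \<in> borel_measurable ?G" unfolding Q_def[abs_def] by measurable
  have Q0: "0 \<le> Q x" "(b x) ^ 4 \<le> Q x" for x
    using mult_left_mono[of 1 "exp (\<bar>X x\<bar> / 2)" "(b x) ^ 4"] by (simp_all add: Q_def)
  have Qb: "\<bar>Q x\<bar> \<le> (98304 * s ^ 4) * exp \<bar>X x\<bar>" for x
  proof -
    have "Q x = 256 * s ^ 4 * (X x ^ 4 * exp (\<bar>X x\<bar> / 2))" by (simp add: Q_def bX power_mult_distrib)
    also have "\<dots> \<le> 256 * s ^ 4 * (384 * exp \<bar>X x\<bar>)"
      using E.pow4_exp[of x] by (intro mult_left_mono) auto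
    finally show ?thesis using Q0(1)[of x] by simp
  qed
  note Q = E.integrable_dominated[OF Qm Qb]
  define e where "e = 393216 * s ^ 4"
  have EQ: "(\<integral>x. Q x \<partial>?G) \<le> e" using Q(2) by (simp add: e_def)
  have ib2: "integrable ?G (\<lambda>x. (b x)\<^sup>2)" "(\<integral>x. (b x)\<^sup>2 \<partial>?G) = frob_sq I P"
    using integral_bform_square[OF I, of P] by (simp_all add: b_def)
  have ivb: "integrable ?G (\<lambda>x. f x * (b x)\<^sup>2)"
    if [measurable]: "f \<in> borel_measurable ?G" and f: "\<And>x. 0 \<le> f x" "\<And>x. f x \<le> c" for f c
  proof (rule Bochner_Integration.integrable_bound)
    show "integrable ?G (\<lambda>x. c * (b x)\<^sup>2)" using ib2 by simp
    have "\<bar>f x * (b x)\<^sup>2\<bar> \<le> \<bar>c * (b x)\<^sup>2\<bar>" for x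
      using f[of x] by (simp add: abs_mult mult_right_mono)
    then show "AE x in ?G. norm (f x * (b x)\<^sup>2) \<le> norm (c * (b x)\<^sup>2)" by simp
  qed measurable
  note iv = ivb[OF _ v] ivb[OF _ v'] ivb[OF _ vv', simplified]
  have i1: "integrable ?G v" "(\<integral>x. v x \<partial>?G) = 1"
    using integral_pair_gauss_times[OF U.measurable_gibbs _ U.gibbs_bound, of "\<lambda>_. 1" 1] U.integral_gibbs
      prob_space.prob_space[OF prob_space_gauss] by (simp_all add: v_def[abs_def])
  have i2: "integrable ?G v'" "(\<integral>x. v' x \<partial>?G) = 1"
    using integral_pair_gauss_times[OF _ U'.measurable_gibbs _ U'.gibbs_bound, of "\<lambda>_. 1" 1] U'.integral_gibbs
      prob_space.prob_space[OF prob_space_gauss] by (simp_all add: v'_def[abs_def])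
  have i3: "integrable ?G (\<lambda>x. v x * v' x)" "(\<integral>x. v x * v' x \<partial>?G) = 1"
    using integral_pair_gauss_times[OF U.measurable_gibbs U'.measurable_gibbs U.gibbs_bound U'.gibbs_bound]
      U.integral_gibbs U'.integral_gibbs by (simp_all add: v_def v'_def)
  have cos_bound: "(\<integral>x. f x * mean_cos (b x) \<partial>?G) \<le> (1 - \<delta>) - \<tau> * T / 2 * (\<integral>x. f x * (b x)\<^sup>2 \<partial>?G) + \<tau>\<^sup>2 * l ^ 4 * exp (\<tau> / 2) * e"
    if fm[measurable]: "f \<in> borel_measurable ?G" and f: "\<And>x. 0 \<le> f x" "\<And>x. f x \<le> exp (\<tau> / 2)"
      and fi: "integrable ?G f" "(\<integral>x. f x \<partial>?G) = 1" for f
  proof -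
    have "(\<integral>x. f x * mean_cos (b x) \<partial>?G)
      \<le> (\<integral>x. (1 - \<delta>) * f x - \<tau> * T / 2 * (f x * (b x)\<^sup>2) + \<tau>\<^sup>2 * l ^ 4 * exp (\<tau> / 2) * Q x \<partial>?G)"
    proof (rule integral_mono)
      have "\<bar>f x * mean_cos (b x)\<bar> \<le> exp (\<tau> / 2) * 1" for x
        unfolding abs_mult using f[of x] by (intro mult_mono abs_mean_cos_le) auto
      then show "integrable ?G (\<lambda>x. f x * mean_cos (b x))"
        by (intro E.integrable_const_bound[where B="exp (\<tau> / 2)"]) auto
      show "integrable ?G (\<lambda>x. (1 - \<delta>) * f x - \<tau> * T / 2 * (f x * (b x)\<^sup>2) + \<tau>\<^sup>2 * l ^ 4 * exp (\<tau> / 2) * Q x)"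
        using fi(1) ivb[OF fm f] Q(1) by simp
      fix x
      have "f x * mean_cos (b x) \<le> f x * ((1 - \<delta>) - \<tau> * T / 2 * (b x)\<^sup>2 + \<tau>\<^sup>2 * l ^ 4 * (b x) ^ 4)"
        using f[of x] by (intro mult_left_mono mean_cos_le) auto
      also have "\<dots> = (1 - \<delta>) * f x - \<tau> * T / 2 * (f x * (b x)\<^sup>2) + \<tau>\<^sup>2 * l ^ 4 * (f x * (b x) ^ 4)"
        by (simp add: algebra_simps)
      also have "\<tau>\<^sup>2 * l ^ 4 * (f x * (b x) ^ 4) \<le> \<tau>\<^sup>2 * l ^ 4 * (exp (\<tau> / 2) * Q x)"
        using f[of x] Q0[of x] by (intro mult_left_mono mult_mono) auto
      finally show "f x * mean_cos (b x) \<le> (1 - \<delta>) * f x - \<tau> * T / 2 * (f x * (b x)\<^sup>2) + \<tau>\<^sup>2 * l ^ 4 * exp (\<tau> / 2) * Q x"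
        by simp
    qed
    also have "\<dots> = (1 - \<delta>) - \<tau> * T / 2 * (\<integral>x. f x * (b x)\<^sup>2 \<partial>?G) + \<tau>\<^sup>2 * l ^ 4 * exp (\<tau> / 2) * (\<integral>x. Q x \<partial>?G)"
      using fi ivb[OF fm f] Q(1) by simp
    also have "\<dots> \<le> (1 - \<delta>) - \<tau> * T / 2 * (\<integral>x. f x * (b x)\<^sup>2 \<partial>?G) + \<tau>\<^sup>2 * l ^ 4 * exp (\<tau> / 2) * e"
      by (intro add_left_mono mult_left_mono EQ) auto
    finally show ?thesis .
  qed
  have cosh_bound: "(\<integral>x. v x * v' x * cosh (\<tau> * b x) \<partial>?G) \<le> 1 + \<tau>\<^sup>2 / 2 * (\<integral>x. v x * v' x * (b x)\<^sup>2 \<partial>?G) + \<tau> ^ 4 * exp \<tau> * e"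
  proof -
    have "(\<integral>x. v x * v' x * cosh (\<tau> * b x) \<partial>?G)
      \<le> (\<integral>x. v x * v' x + \<tau>\<^sup>2 / 2 * (v x * v' x * (b x)\<^sup>2) + \<tau> ^ 4 * exp \<tau> * Q x \<partial>?G)"
    proof (rule integral_mono)
      show "integrable ?G (\<lambda>x. v x * v' x * cosh (\<tau> * b x))"
      proof (rule E.integrable_dominated(1)[where C="exp \<tau>"])
        fix x
        have "cosh (\<tau> * b x) \<le> exp \<bar>\<tau> * b x\<bar>" by (simp add: cosh_def field_simps abs_if)
        also have "\<dots> \<le> exp \<bar>X x\<bar>" using tb[of x] \<tau> by (simp add: abs_mult)
        finally have "v x * v' x * cosh (\<tau> * b x) \<le> exp \<tau> * exp \<bar>X x\<bar>"
          using vv'[of x] by (intro mult_mono) auto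
        then show "\<bar>v x * v' x * cosh (\<tau> * b x)\<bar> \<le> exp \<tau> * exp \<bar>X x\<bar>"
          using v(1)[of x] v'(1)[of x] by (simp add: abs_mult)
      qed (unfold cosh_field_def, measurable)
      show "integrable ?G (\<lambda>x. v x * v' x + \<tau>\<^sup>2 / 2 * (v x * v' x * (b x)\<^sup>2) + \<tau> ^ 4 * exp \<tau> * Q x)"
        using i3 iv Q(1) by simp
      fix x
      have "(\<tau> * b x) ^ 4 / 8 * exp \<bar>\<tau> * b x\<bar> \<le> \<tau> ^ 4 * Q x"
      proof -
        have "(b x) ^ 4 / 8 * exp \<bar>\<tau> * b x\<bar> \<le> (b x) ^ 4 * exp (\<bar>X x\<bar> / 2)"
          using tb[of x] \<tau> by (intro mult_mono) (auto simp: abs_mult)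
        from mult_left_mono[OF this, of "\<tau> ^ 4"] show ?thesis by (simp add: Q_def power_mult_distrib)
      qed
      then have c: "cosh (\<tau> * b x) \<le> 1 + \<tau>\<^sup>2 / 2 * (b x)\<^sup>2 + \<tau> ^ 4 * Q x"
        using cosh_taylor4[of "\<tau> * b x"] by (simp add: power_mult_distrib)
      have "v x * v' x * cosh (\<tau> * b x) \<le> v x * v' x * (1 + \<tau>\<^sup>2 / 2 * (b x)\<^sup>2 + \<tau> ^ 4 * Q x)"
        using vv'[of x] by (intro mult_left_mono c)
      also have "\<dots> = v x * v' x + \<tau>\<^sup>2 / 2 * (v x * v' x * (b x)\<^sup>2) + \<tau> ^ 4 * (v x * v' x * Q x)"
        by (simp add: algebra_simps)
      also have "\<tau> ^ 4 * (v x * v' x * Q x) \<le> \<tau> ^ 4 * (exp \<tau> * Q x)"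
        using vv'[of x] Q0[of x] by (intro mult_left_mono mult_right_mono) auto
      finally show "v x * v' x * cosh (\<tau> * b x) \<le> v x * v' x + \<tau>\<^sup>2 / 2 * (v x * v' x * (b x)\<^sup>2) + \<tau> ^ 4 * exp \<tau> * Q x"
        by simp
    qed
    also have "\<dots> = 1 + \<tau>\<^sup>2 / 2 * (\<integral>x. v x * v' x * (b x)\<^sup>2 \<partial>?G) + \<tau> ^ 4 * exp \<tau> * (\<integral>x. Q x \<partial>?G)"
      using i3 iv Q(1) by simp
    also have "\<dots> \<le> 1 + \<tau>\<^sup>2 / 2 * (\<integral>x. v x * v' x * (b x)\<^sup>2 \<partial>?G) + \<tau> ^ 4 * exp \<tau> * e"
      by (intro add_left_mono mult_left_mono EQ) auto
    finally show ?thesis .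
  qed
  define a c d where "a = (\<integral>x. v x * (b x)\<^sup>2 \<partial>?G)" and "c = (\<integral>x. v' x * (b x)\<^sup>2 \<partial>?G)" and "d = (\<integral>x. v x * v' x * (b x)\<^sup>2 \<partial>?G)"
  define z where "z = exp \<tau> * \<tau>\<^sup>2"
  \<comment> \<open>The inequality 2 x y <= x^2 + y^2 separates the weights from \<open>b\<close>.
    Since \<open>v\<close> depends on the first vector only and \<open>v'\<close> on the second
    only, their variances multiply.\<close>
  have second: "frob_sq I P - a - c + d \<le> (z\<^sup>2 * s ^ 4 + e) / 2"
  proof -
    have sq: "\<bar>(1 - x)\<^sup>2\<bar> \<le> (1 + exp (\<tau> / 2))\<^sup>2" if "0 \<le> x" "x \<le> exp (\<tau> / 2)" for x :: real
      unfolding power2_abs power_abs abs_power2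
      using that by (intro power2_le_iff_abs_le[THEN iffD2]) (auto simp: abs_le_iff)
    have mm: "(\<lambda>h. (1 - gibbs I \<tau> U h)\<^sup>2) \<in> borel_measurable (PiM I (\<lambda>_. borel))"
      "(\<lambda>h. (1 - gibbs I \<tau> U' h)\<^sup>2) \<in> borel_measurable (PiM I (\<lambda>_. borel))" by measurable
    note pr = integral_pair_gauss_times[OF mm sq[OF U.gibbs_nonneg U.gibbs_le] sq[OF U'.gibbs_nonneg U'.gibbs_le]]
    have prod: "(\<integral>x. (1 - v x)\<^sup>2 * (1 - v' x)\<^sup>2 \<partial>?G) \<le> (z * s\<^sup>2) * (z * s\<^sup>2)"
      unfolding v_def v'_def pr(2) z_def
      by (intro mult_mono U.gibbs_variance U'.gibbs_variance) auto
    have ib4: "integrable ?G (\<lambda>x. (b x) ^ 4)"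
      by (rule Bochner_Integration.integrable_bound[OF Q(1)]) (use Q0 in auto)
    have "(\<integral>x. (b x) ^ 4 \<partial>?G) \<le> (\<integral>x. Q x \<partial>?G)" by (rule integral_mono[OF ib4 Q(1)]) (use Q0 in auto)
    then have Eb4: "(\<integral>x. (b x) ^ 4 \<partial>?G) \<le> e" using EQ by linarith
    have "frob_sq I P - a - c + d = (\<integral>x. (b x)\<^sup>2 - v x * (b x)\<^sup>2 - v' x * (b x)\<^sup>2 + v x * v' x * (b x)\<^sup>2 \<partial>?G)"
      using ib2 iv by (simp add: a_def c_def d_def)
    also have "\<dots> \<le> (\<integral>x. ((1 - v x)\<^sup>2 * (1 - v' x)\<^sup>2 + (b x) ^ 4) / 2 \<partial>?G)"
    proof (rule integral_mono)
      show "integrable ?G (\<lambda>x. (b x)\<^sup>2 - v x * (b x)\<^sup>2 - v' x * (b x)\<^sup>2 + v x * v' x * (b x)\<^sup>2)"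
        using ib2 iv by simp
      show "integrable ?G (\<lambda>x. ((1 - v x)\<^sup>2 * (1 - v' x)\<^sup>2 + (b x) ^ 4) / 2)"
        using pr(1) ib4 by (simp add: v_def v'_def)
      fix x
      have "2 * ((1 - v x) * (1 - v' x)) * (b x)\<^sup>2 \<le> ((1 - v x) * (1 - v' x))\<^sup>2 + ((b x)\<^sup>2)\<^sup>2"
        by (rule sum_squares_bound)
      moreover have "((b x)\<^sup>2)\<^sup>2 = (b x) ^ 4" by (simp add: power_mult[symmetric])
      moreover have "(b x)\<^sup>2 - v x * (b x)\<^sup>2 - v' x * (b x)\<^sup>2 + v x * v' x * (b x)\<^sup>2 = (1 - v x) * (1 - v' x) * (b x)\<^sup>2"
        by (simp add: algebra_simps)
      ultimately show "(b x)\<^sup>2 - v x * (b x)\<^sup>2 - v' x * (b x)\<^sup>2 + v x * v' x * (b x)\<^sup>2 \<le> ((1 - v x)\<^sup>2 * (1 - v' x)\<^sup>2 + (b x) ^ 4) / 2"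
        unfolding power_mult_distrib mult.assoc by argo
    qed
    also have "\<dots> = ((\<integral>x. (1 - v x)\<^sup>2 * (1 - v' x)\<^sup>2 \<partial>?G) + (\<integral>x. (b x) ^ 4 \<partial>?G)) / 2"
      using pr(1) ib4 by (simp add: v_def v'_def)
    also have "\<dots> \<le> ((z * s\<^sup>2) * (z * s\<^sup>2) + e) / 2" using prod Eb4 by simp
    also have "(z * s\<^sup>2) * (z * s\<^sup>2) = z\<^sup>2 * s ^ 4" by (simp add: power2_eq_square eval_nat_numeral)
    finally show ?thesis .
  qed
  define \<theta> S where "\<theta> = mtrace I P" and "S = (\<Sum>i\<in>I. \<Sum>j\<in>I. P i j * P j i)"
  define r1 r2 where "r1 = \<tau>\<^sup>2 * l ^ 4 * exp (\<tau> / 2)" and "r2 = \<tau> ^ 4 * exp \<tau>"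
  have "overlap I P U U' \<le> ((1 - \<delta>)\<^sup>2 + T\<^sup>2 / 2 * (\<theta>\<^sup>2 + frob_sq I P + S) + C_exp * (\<theta>\<^sup>2 + s ^ 4))
    + \<delta> * ((1 - \<delta>) - \<tau> * T / 2 * c + r1 * e) + \<delta> * ((1 - \<delta>) - \<tau> * T / 2 * a + r1 * e)
    + \<delta>\<^sup>2 * (1 + \<tau>\<^sup>2 / 2 * d + r2 * e)"
    unfolding overlap_def b_def[symmetric] v_def[symmetric] v'_def[symmetric]
    using integral_mean_exp_le(2)[OF I s frob trace small] cos_bound[OF _ v i1] cos_bound[OF _ v' i2] cosh_bound \<delta>
    by (intro add_mono mult_left_mono) (auto simp: a_def c_def d_def \<theta>_def S_def r1_def r2_def)
  \<comment> \<open>The zeroth-order terms form the square of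
    \<open>(1 - \<delta>) + \<delta>\<close>. Replacing \<open>T\<close> by
    \<open>\<delta> * \<tau>\<close> gives all four second-order terms the same factor up to
    sign.\<close>
  also have "\<dots> = 1 + T\<^sup>2 / 2 * (\<theta>\<^sup>2 + S) + C_exp * (\<theta>\<^sup>2 + s ^ 4) + T\<^sup>2 / 2 * (frob_sq I P - a - c + d)
     + (2 * \<delta> * (r1 * e) + \<delta>\<^sup>2 * (r2 * e))"
    unfolding T[symmetric] by (simp add: power2_eq_square field_simps)
  also have "\<dots> \<le> 1 + T\<^sup>2 / 2 * (\<theta>\<^sup>2 + S) + C_exp * (\<theta>\<^sup>2 + s ^ 4) + T\<^sup>2 / 2 * ((z\<^sup>2 * s ^ 4 + e) / 2)
     + (2 * \<delta> * (r1 * e) + \<delta>\<^sup>2 * (r2 * e))"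
    by (intro add_mono mult_left_mono second order_refl) auto
  also have "\<dots> = 1 + T\<^sup>2 / 2 * (\<theta>\<^sup>2 + S) + C_exp * (\<theta>\<^sup>2 + s ^ 4) + C_rest * s ^ 4"
    unfolding C_rest_def e_def r1_def r2_def z_def by (simp add: field_simps)
  also have "\<dots> \<le> 1 + T\<^sup>2 / 2 * (\<theta>\<^sup>2 + S) + (C_exp + C_rest) * (\<theta>\<^sup>2 + s ^ 4)"
    using C_nonneg mult_nonneg_nonneg[OF C_nonneg(2), of "\<theta>\<^sup>2"] by (simp add: algebra_simps)
  finally show ?thesis by (simp add: \<theta>_def S_def)
qed

end

section \<open>Likelihood ratios of the components and their pairwise products\<close>

definition lin :: "'i set \<Rightarrow> ('i \<Rightarrow> 'i \<Rightarrow> real) \<Rightarrow> ('i \<Rightarrow> real) \<Rightarrow> 'i \<Rightarrow> real" where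
  "lin I K y j = (\<Sum>i\<in>I. K j i * y i)"

definition gram :: "'i set \<Rightarrow> ('i \<Rightarrow> 'i \<Rightarrow> real) \<Rightarrow> ('i \<Rightarrow> 'i \<Rightarrow> real) \<Rightarrow> 'i \<Rightarrow> 'i \<Rightarrow> real" where
  "gram J K K' i i' = (\<Sum>j\<in>J. K j i * K' j i')"

text \<open>The likelihood ratio of \<open>(y, t K y + g)\<close> against the standard Gaussian,
  that is the Cameron-Martin density in \<open>z\<close> for fixed \<open>y\<close>.\<close>

definition tilt :: "'i set \<Rightarrow> 'i set \<Rightarrow> ('i \<Rightarrow> 'i \<Rightarrow> real) \<Rightarrow> real \<Rightarrow> ('i \<Rightarrow> real) \<Rightarrow> real" where
  "tilt I J K t x = exp (\<Sum>j\<in>J. t * lin I K x j * x j - (t * lin I K x j)\<^sup>2 / 2)"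

definition damp :: "'i set \<Rightarrow> 'i set \<Rightarrow> real \<Rightarrow> ('i \<Rightarrow> 'i \<Rightarrow> real) \<Rightarrow> ('i \<Rightarrow> real) \<Rightarrow> real" where
  "damp I J \<tau> K x = exp (- (\<tau> * (\<Sum>i\<in>I. (\<Sum>j\<in>J. K j i * x j)\<^sup>2) / 2))"

lemma gram_commute: "gram J K K' i i' = gram J K' K i' i"
  by (simp add: gram_def mult.commute)

lemma sum_lin_lin: "(\<Sum>j\<in>J. lin I K h j * lin I K' g j) = bform I (gram J K K') h g"
proof -
  have "(\<Sum>j\<in>J. lin I K h j * lin I K' g j) = (\<Sum>j\<in>J. \<Sum>i\<in>I. \<Sum>i'\<in>I. K j i * K' j i' * h i * g i')"
    unfolding lin_def sum_product by (simp add: mult_ac)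
  also have "\<dots> = (\<Sum>i\<in>I. \<Sum>j\<in>J. \<Sum>i'\<in>I. K j i * K' j i' * h i * g i')" by (rule sum.swap)
  also have "\<dots> = (\<Sum>i\<in>I. \<Sum>i'\<in>I. \<Sum>j\<in>J. K j i * K' j i' * h i * g i')"
    by (rule sum.cong[OF refl], rule sum.swap)
  finally show ?thesis by (simp add: bform_def gram_def sum_distrib_right)
qed

lemma bform_diag: "bform I P y y = qform I P y"
  by (simp add: bform_def qform_def)

lemma bform_gram_commute: "bform I (gram J K' K) g h = bform I (gram J K K') h g"
  unfolding sum_lin_lin[symmetric] by (simp add: mult.commute)

lemma qform_gram: "qform I (gram J K K) h = (\<Sum>j\<in>J. (lin I K h j)\<^sup>2)"
  by (simp add: bform_diag[symmetric] sum_lin_lin[symmetric] power2_eq_square)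

lemma measurable_lin: "I \<subseteq> L \<Longrightarrow> (\<lambda>x. lin I K x j) \<in> borel_measurable (PiM L (\<lambda>_. borel))"
  unfolding lin_def by (auto intro!: borel_measurable_sum borel_measurable_times measurable_component_singleton)

lemma measurable_tilt: "I \<union> J \<subseteq> L \<Longrightarrow> tilt I J K t \<in> borel_measurable (PiM L (\<lambda>_. borel))"
proof -
  assume L: "I \<union> J \<subseteq> L"
  have [measurable]: "(\<lambda>x. lin I K x j) \<in> borel_measurable (PiM L (\<lambda>_. borel))" for j
    using L by (intro measurable_lin) auto
  have [measurable]: "(\<lambda>x. x j) \<in> borel_measurable (PiM L (\<lambda>_. borel))" if "j \<in> J" for j
    using L that by (intro measurable_component_singleton) auto
  show ?thesis unfolding tilt_def[abs_def] by measurable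
qed

lemma measurable_damp: "J \<subseteq> L \<Longrightarrow> damp I J \<tau> K \<in> borel_measurable (PiM L (\<lambda>_. borel))"
proof -
  assume L: "J \<subseteq> L"
  have [measurable]: "(\<lambda>x. x j) \<in> borel_measurable (PiM L (\<lambda>_. borel))" if "j \<in> J" for j
    using L that by (intro measurable_component_singleton) auto
  show ?thesis unfolding damp_def[abs_def] by measurable
qed

locale blocks =
  fixes I J :: "'i set" and \<tau> :: real
  assumes I: "finite I" and J: "finite J" and IJ: "I \<inter> J = {}" and \<tau>: "0 \<le> \<tau>"
begin

lemma measurable_tilt_damp[measurable]:
  "tilt I J K t \<in> borel_measurable (PiM (I \<union> J) (\<lambda>_. borel))"
  "damp I J \<tau> K \<in> borel_measurable (PiM (I \<union> J) (\<lambda>_. borel))"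
  "damp I J \<tau> K \<in> borel_measurable (PiM J (\<lambda>_. borel))"
  "(\<lambda>y. lin I K y j) \<in> borel_measurable (PiM I (\<lambda>_. borel))"
  by (auto intro: measurable_tilt measurable_damp measurable_lin)

lemma damp_bounds: "0 \<le> damp I J \<tau> K x" "damp I J \<tau> K x \<le> 1"
  using \<tau> by (simp_all add: damp_def sum_nonneg)

lemma tilt_pos: "0 \<le> tilt I J K t x"
  by (simp add: tilt_def)

lemma lin_merge: "lin I K (merge I J (y, z)) = lin I K y"
  unfolding lin_def by (intro ext sum.cong) (auto simp: merge_def)

lemma tilt_merge: "tilt I J K t (merge I J (y, z)) = exp (\<Sum>j\<in>J. t * lin I K y j * z j - (t * lin I K y j)\<^sup>2 / 2)"
  unfolding tilt_def lin_merge by (intro arg_cong[where f=exp] sum.cong) (use IJ in auto)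

lemma damp_merge: "damp I J \<tau> K (merge I J (y, z)) = damp I J \<tau> K z"
proof -
  have "(\<Sum>j\<in>J. K j i * merge I J (y, z) j) = (\<Sum>j\<in>J. K j i * z j)" for i
    by (rule sum.cong) (use IJ in auto)
  then show ?thesis by (simp add: damp_def)
qed

lemma damp_restrict: "damp I J \<tau> K (restrict z J) = damp I J \<tau> K z"
  by (simp add: damp_def)

text \<open>Gaussian linearization: exp (- |v|^2 / 2) is the characteristic function of a Gaussian
  vector \<open>h\<close>, and the sine part vanishes by symmetry. Afterwards \<open>z\<close>
  enters linearly, so all integrals over \<open>z\<close> are explicit.\<close>

lemma damp_eq_cos: "damp I J \<tau> K z = (\<integral>h. cos (\<Sum>j\<in>J. sqrt \<tau> * lin I K h j * z j) \<partial>gauss I)"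
proof -
  have "(\<Sum>j\<in>J. sqrt \<tau> * lin I K h j * z j) = (\<Sum>i\<in>I. (sqrt \<tau> * (\<Sum>j\<in>J. K j i * z j)) * h i)" for h
    unfolding lin_def sum_distrib_left sum_distrib_right by (subst sum.swap) (simp add: mult_ac)
  moreover have "(\<Sum>i\<in>I. (sqrt \<tau> * (\<Sum>j\<in>J. K j i * z j))\<^sup>2) = \<tau> * (\<Sum>i\<in>I. (\<Sum>j\<in>J. K j i * z j)\<^sup>2)"
    using \<tau> by (simp add: power_mult_distrib sum_distrib_left[symmetric])
  ultimately show ?thesis
    using integral_gauss_cos_sin(1)[OF I, of "\<lambda>i. sqrt \<tau> * (\<Sum>j\<in>J. K j i * z j)" 0]
    by (simp add: damp_def)
qed

lemma swap_gauss:
  fixes f :: "_ \<Rightarrow> _ \<Rightarrow> real"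
  assumes [measurable]: "(\<lambda>x. f (fst x) (snd x)) \<in> borel_measurable (PiM M (\<lambda>_. borel) \<Otimes>\<^sub>M PiM N (\<lambda>_. borel))"
    and "\<And>x y. \<bar>f x y\<bar> \<le> c"
  shows "(\<integral>x. (\<integral>y. f x y \<partial>gauss N) \<partial>gauss M) = (\<integral>y. (\<integral>x. f x y \<partial>gauss M) \<partial>gauss N)"
    "(\<integral>x. (\<integral>y. f x y \<partial>gauss N) \<partial>gauss M) = (\<integral>x. f (fst x) (snd x) \<partial>(gauss M \<Otimes>\<^sub>M gauss N))"
    "integrable (gauss M) (\<lambda>x. \<integral>y. f x y \<partial>gauss N)"
    "integrable (gauss M \<Otimes>\<^sub>M gauss N) (\<lambda>x. f (fst x) (snd x))"
proof -
  interpret P: pair_prob_space "gauss M" "gauss N" by (rule pair_gauss)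
  show i: "integrable (gauss M \<Otimes>\<^sub>M gauss N) (\<lambda>x. f (fst x) (snd x))"
    by (rule P.P.integrable_const_bound[where B=c]) (use assms(2) in auto)
  then have i': "integrable (gauss M \<Otimes>\<^sub>M gauss N) (\<lambda>(x, y). f x y)" by (simp add: case_prod_beta')
  show "(\<integral>x. (\<integral>y. f x y \<partial>gauss N) \<partial>gauss M) = (\<integral>y. (\<integral>x. f x y \<partial>gauss M) \<partial>gauss N)"
    by (rule P.Fubini_integral[OF i', symmetric])
  show "(\<integral>x. (\<integral>y. f x y \<partial>gauss N) \<partial>gauss M) = (\<integral>x. f (fst x) (snd x) \<partial>(gauss M \<Otimes>\<^sub>M gauss N))"
    using P.integral_fst'[OF i] by simp
  show "integrable (gauss M) (\<lambda>x. \<integral>y. f x y \<partial>gauss N)"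
    using P.integrable_fst'[OF i] by simp
qed

lemma measurable_lin_fst_snd[measurable]:
  "(\<lambda>x. lin I K (fst x) j) \<in> borel_measurable (PiM I (\<lambda>_. borel) \<Otimes>\<^sub>M N)"
  "(\<lambda>x. lin I K (snd x) j) \<in> borel_measurable (N \<Otimes>\<^sub>M PiM I (\<lambda>_. borel))"
  unfolding lin_def by measurable

lemma sum_square_sqrt_lin: "(\<Sum>j\<in>J. (sqrt \<tau> * lin I K h j)\<^sup>2) = \<tau> * qform I (gram J K K) h"
  using \<tau> by (simp add: power_mult_distrib qform_gram sum_distrib_left)

text \<open>Once linearized, the shift by \<open>t K' y\<close> only adds a phase, and averaging
  over \<open>z\<close> produces the unnormalized \<open>gibbs\<close> weight of
  \<open>h\<close>.\<close>

lemma integral_damp_shift: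
  "(\<integral>z. damp I J \<tau> K (\<lambda>j\<in>J. z j + t * lin I K' y j) \<partial>gauss J)
    = (\<integral>h. exp (- (\<tau> * qform I (gram J K K) h / 2)) * cos (sqrt \<tau> * t * bform I (gram J K' K) y h) \<partial>gauss I)"
proof -
  define a where "a j = t * lin I K' y j" for j
  have "(\<integral>z. damp I J \<tau> K (\<lambda>j\<in>J. z j + a j) \<partial>gauss J)
    = (\<integral>z. (\<integral>h. cos ((\<Sum>j\<in>J. sqrt \<tau> * lin I K h j * z j) + (\<Sum>j\<in>J. sqrt \<tau> * lin I K h j * a j)) \<partial>gauss I) \<partial>gauss J)"
    unfolding damp_restrict damp_eq_cos by (simp add: sum.distrib algebra_simps)
  also have "\<dots> = (\<integral>h. (\<integral>z. cos ((\<Sum>j\<in>J. sqrt \<tau> * lin I K h j * z j) + (\<Sum>j\<in>J. sqrt \<tau> * lin I K h j * a j)) \<partial>gauss J) \<partial>gauss I)"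
    by (rule swap_gauss(1)[where c=1]) (auto intro: abs_cos_le_one)
  also have "\<dots> = (\<integral>h. exp (- (\<tau> * qform I (gram J K K) h / 2)) * cos (sqrt \<tau> * t * bform I (gram J K' K) y h) \<partial>gauss I)"
  proof (rule Bochner_Integration.integral_cong[OF refl])
    fix h
    have "(\<Sum>j\<in>J. sqrt \<tau> * lin I K h j * a j) = sqrt \<tau> * t * bform I (gram J K' K) y h"
      unfolding sum_lin_lin[symmetric] a_def sum_distrib_left by (simp add: mult_ac)
    then show "(\<integral>z. cos ((\<Sum>j\<in>J. sqrt \<tau> * lin I K h j * z j) + (\<Sum>j\<in>J. sqrt \<tau> * lin I K h j * a j)) \<partial>gauss J)
      = exp (- (\<tau> * qform I (gram J K K) h / 2)) * cos (sqrt \<tau> * t * bform I (gram J K' K) y h)"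
      by (simp add: integral_gauss_cos_sin(1)[OF J] sum_square_sqrt_lin)
  qed
  finally show ?thesis by (simp add: a_def)
qed

lemma integral_damp: "(\<integral>z. damp I J \<tau> K z \<partial>gauss J) = gibbs_norm I \<tau> (gram J K K)"
  using integral_damp_shift[of K 0 "\<lambda>_ _. 0" "\<lambda>_. 0"] by (simp add: damp_restrict gibbs_norm_def)

text \<open>Each factor is linearized with its own auxiliary vector. The product-to-sum formula
  gives two Gaussian averages whose exponents differ by the sign of the cross term \<open>q\<close>,
  hence the \<open>cosh\<close>.\<close>

lemma integral_damp_damp:
  "(\<integral>z. damp I J \<tau> K z * damp I J \<tau> K' z \<partial>gauss J)
    = (\<integral>x. exp (- (\<tau> * qform I (gram J K K) (fst x) / 2)) * exp (- (\<tau> * qform I (gram J K' K') (snd x) / 2))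
        * cosh (\<tau> * bform I (gram J K K') (fst x) (snd x)) \<partial>(gauss I \<Otimes>\<^sub>M gauss I))"
proof -
  define b where "b h j = sqrt \<tau> * lin I K h j" for h j
  define b' where "b' h j = sqrt \<tau> * lin I K' h j" for h j
  have [measurable]: "(\<lambda>x. b (fst x) j) \<in> borel_measurable (PiM I (\<lambda>_. borel) \<Otimes>\<^sub>M N)"
    "(\<lambda>x. b (snd x) j) \<in> borel_measurable (N \<Otimes>\<^sub>M PiM I (\<lambda>_. borel))"
    "(\<lambda>x. b' (fst x) j) \<in> borel_measurable (PiM I (\<lambda>_. borel) \<Otimes>\<^sub>M N)"
    "(\<lambda>x. b' (snd x) j) \<in> borel_measurable (N \<Otimes>\<^sub>M PiM I (\<lambda>_. borel))"
    "(\<lambda>x. b x j) \<in> borel_measurable (PiM I (\<lambda>_. borel))"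
    "(\<lambda>x. b' x j) \<in> borel_measurable (PiM I (\<lambda>_. borel))" for j N
    unfolding b_def b'_def by measurable
  have cc: "\<bar>cos x * cos y\<bar> \<le> 1" for x y :: real
    using mult_mono[of "\<bar>cos x\<bar>" 1 "\<bar>cos y\<bar>" 1] by (simp add: abs_mult)
  have inner: "(\<integral>z. cos (\<Sum>j\<in>J. b h j * z j) * cos (\<Sum>j\<in>J. b' g j * z j) \<partial>gauss J)
    = exp (- (\<tau> * qform I (gram J K K) h / 2)) * exp (- (\<tau> * qform I (gram J K' K') g / 2)) * cosh (\<tau> * bform I (gram J K K') h g)" for h g
  proof -
    interpret prob_space "gauss J" by (rule prob_space_gauss)
    define q where "q = (\<Sum>j\<in>J. b h j * b' g j)"
    have q: "q = \<tau> * bform I (gram J K K') h g"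
    proof -
      have "b h j * b' g j = \<tau> * (lin I K h j * lin I K' g j)" for j
        using \<tau> by (simp add: b_def b'_def)
      then show ?thesis by (simp add: q_def sum_lin_lin[symmetric] sum_distrib_left)
    qed
    define A B where "A = (\<Sum>j\<in>J. (b h j)\<^sup>2)" and "B = (\<Sum>j\<in>J. (b' g j)\<^sup>2)"
    have AB: "A = \<tau> * qform I (gram J K K) h" "B = \<tau> * qform I (gram J K' K') g"
      unfolding A_def B_def b_def b'_def by (rule sum_square_sqrt_lin)+
    have "cos (\<Sum>j\<in>J. b h j * z j) * cos (\<Sum>j\<in>J. b' g j * z j)
      = cos ((\<Sum>j\<in>J. (b h j - b' g j) * z j) + 0) / 2 + cos ((\<Sum>j\<in>J. (b h j + b' g j) * z j) + 0) / 2" for z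
      unfolding cos_times_cos left_diff_distrib distrib_right sum_subtractf sum.distrib by simp
    moreover have "integrable (gauss J) (\<lambda>z. cos ((\<Sum>j\<in>J. c j * z j) + 0))" for c
      by (rule integrable_const_bound[where B=1]) auto
    ultimately have "(\<integral>z. cos (\<Sum>j\<in>J. b h j * z j) * cos (\<Sum>j\<in>J. b' g j * z j) \<partial>gauss J)
       = exp (- (\<Sum>j\<in>J. (b h j - b' g j)\<^sup>2) / 2) / 2 + exp (- (\<Sum>j\<in>J. (b h j + b' g j)\<^sup>2) / 2) / 2"
      by (simp add: integral_gauss_cos_sin(1)[OF J, where s=0, simplified])
    also have "(\<Sum>j\<in>J. (b h j - b' g j)\<^sup>2) = A + B - 2 * q"
      by (simp add: power2_diff sum_subtractf sum.distrib A_def B_def q_def sum_distrib_left mult.assoc)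
    also have "(\<Sum>j\<in>J. (b h j + b' g j)\<^sup>2) = A + B + 2 * q"
      by (simp add: power2_sum sum.distrib A_def B_def q_def sum_distrib_left mult.assoc)
    also have "exp (- (A + B - 2 * q) / 2) / 2 + exp (- (A + B + 2 * q) / 2) / 2 = exp (- (A / 2)) * exp (- (B / 2)) * cosh q"
      by (simp add: cosh_field_def exp_add[symmetric] field_simps)
    finally show ?thesis by (simp add: AB q)
  qed
  have "(\<integral>z. damp I J \<tau> K z * damp I J \<tau> K' z \<partial>gauss J)
    = (\<integral>z. (\<integral>h. cos (\<Sum>j\<in>J. b h j * z j) * damp I J \<tau> K' z \<partial>gauss I) \<partial>gauss J)"
    by (simp add: damp_eq_cos[of K] b_def)
  also have "\<dots> = (\<integral>h. (\<integral>z. cos (\<Sum>j\<in>J. b h j * z j) * damp I J \<tau> K' z \<partial>gauss J) \<partial>gauss I)"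
  proof (rule swap_gauss(1)[where c=1])
    show "\<bar>cos (\<Sum>j\<in>J. b y j * x j) * damp I J \<tau> K' x\<bar> \<le> 1" for x y
      unfolding abs_mult using damp_bounds[of K' x] mult_mono[of "\<bar>cos (\<Sum>j\<in>J. b y j * x j)\<bar>" 1 "damp I J \<tau> K' x" 1] by simp
  qed measurable
  also have "\<dots> = (\<integral>h. (\<integral>z. (\<integral>g. cos (\<Sum>j\<in>J. b h j * z j) * cos (\<Sum>j\<in>J. b' g j * z j) \<partial>gauss I) \<partial>gauss J) \<partial>gauss I)"
    by (simp add: damp_eq_cos[of K'] b'_def)
  also have "\<dots> = (\<integral>h. (\<integral>g. (\<integral>z. cos (\<Sum>j\<in>J. b h j * z j) * cos (\<Sum>j\<in>J. b' g j * z j) \<partial>gauss J) \<partial>gauss I) \<partial>gauss I)"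
    by (rule Bochner_Integration.integral_cong[OF refl], rule swap_gauss(1)[where c=1]) (use cc in auto)
  also have "\<dots> = (\<integral>h. (\<integral>g. exp (- (\<tau> * qform I (gram J K K) h / 2)) * exp (- (\<tau> * qform I (gram J K' K') g / 2)) * cosh (\<tau> * bform I (gram J K K') h g) \<partial>gauss I) \<partial>gauss I)"
    by (simp only: inner)
  also have "\<dots> = (\<integral>x. exp (- (\<tau> * qform I (gram J K K) (fst x) / 2)) * exp (- (\<tau> * qform I (gram J K' K') (snd x) / 2))
        * cosh (\<tau> * bform I (gram J K K') (fst x) (snd x)) \<partial>(gauss I \<Otimes>\<^sub>M gauss I))"
  proof (rule swap_gauss(2)[where c=1])
    \<comment> \<open>The \<open>cosh\<close> alone is unbounded; the product is bounded because it
      is an average of products of two cosines.\<close>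
    show "\<bar>exp (- (\<tau> * qform I (gram J K K) h / 2)) * exp (- (\<tau> * qform I (gram J K' K') g / 2)) * cosh (\<tau> * bform I (gram J K K') h g)\<bar> \<le> 1" for h g
    proof -
      interpret prob_space "gauss J" by (rule prob_space_gauss)
      have "\<bar>\<integral>z. cos (\<Sum>j\<in>J. b h j * z j) * cos (\<Sum>j\<in>J. b' g j * z j) \<partial>gauss J\<bar> \<le> (\<integral>z. \<bar>cos (\<Sum>j\<in>J. b h j * z j) * cos (\<Sum>j\<in>J. b' g j * z j)\<bar> \<partial>gauss J)"
        by (rule integral_abs_bound)
      also have "\<dots> \<le> (\<integral>z. 1 \<partial>gauss J)"
        using cc by (intro integral_mono integrable_const_bound[where B=1]) auto
      finally show ?thesis by (simp add: inner prob_space)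
    qed
  qed (unfold cosh_field_def, measurable)
  finally show ?thesis .
qed

end

lemma nn_integral_gauss_tilt:
  assumes "finite J"
  shows "(\<integral>\<^sup>+z. ennreal (exp (\<Sum>j\<in>J. a j * z j - (a j)\<^sup>2 / 2)) \<partial>gauss J) = 1"
proof -
  interpret prob_space "gauss J" by (rule prob_space_gauss)
  show ?thesis using nn_integral_gauss_shift[OF assms, of "\<lambda>_. 1" a] by (simp add: emeasure_space_1)
qed

context blocks
begin

lemma has_integral_tilt: "has_bochner_integral (gauss (I \<union> J)) (tilt I J K t) 1"
proof (rule has_bochner_integral_nn_integral)
  interpret prob_space "gauss I" by (rule prob_space_gauss)
  have "(\<integral>\<^sup>+x. ennreal (tilt I J K t x) \<partial>gauss (I \<union> J))
    = (\<integral>\<^sup>+y. (\<integral>\<^sup>+z. ennreal (tilt I J K t (merge I J (y, z))) \<partial>gauss J) \<partial>gauss I)"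
    by (rule nn_integral_gauss_union[OF I J IJ]) measurable
  then show "(\<integral>\<^sup>+x. ennreal (tilt I J K t x) \<partial>gauss (I \<union> J)) = ennreal 1"
    by (simp add: tilt_merge nn_integral_gauss_tilt[OF J] emeasure_space_1)
qed (auto simp: tilt_pos)

lemma has_integral_damp: "has_bochner_integral (gauss (I \<union> J)) (damp I J \<tau> K) (gibbs_norm I \<tau> (gram J K K))"
proof (rule has_bochner_integral_nn_integral)
  interpret G: prob_space "gauss I" by (rule prob_space_gauss)
  interpret prob_space "gauss J" by (rule prob_space_gauss)
  have i: "integrable (gauss J) (damp I J \<tau> K)"
    by (rule integrable_const_bound[where B=1]) (use damp_bounds in auto)
  have "(\<integral>\<^sup>+x. ennreal (damp I J \<tau> K x) \<partial>gauss (I \<union> J))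
    = (\<integral>\<^sup>+y. (\<integral>\<^sup>+z. ennreal (damp I J \<tau> K (merge I J (y, z))) \<partial>gauss J) \<partial>gauss I)"
    by (rule nn_integral_gauss_union[OF I J IJ]) measurable
  then show "(\<integral>\<^sup>+x. ennreal (damp I J \<tau> K x) \<partial>gauss (I \<union> J)) = ennreal (gibbs_norm I \<tau> (gram J K K))"
    using i damp_bounds by (simp add: damp_merge nn_integral_eq_integral integral_damp G.emeasure_space_1)
  show "0 \<le> gibbs_norm I \<tau> (gram J K K)" by (simp add: gibbs_norm_def)
qed (auto simp: damp_bounds)

text \<open>The first tilt shifts \<open>z\<close> by its drift, and the second one then has mean
  exp of the inner product of both drifts. Integrability is assumed, since the remaining exponential
  of a quadratic form in \<open>y\<close> can diverge for large \<open>t * u\<close>.\<close>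

lemma has_integral_tilt_tilt:
  assumes i: "integrable (gauss I) (\<lambda>y. exp (t * u * qform I (gram J K K') y))"
  shows "has_bochner_integral (gauss (I \<union> J)) (\<lambda>x. tilt I J K t x * tilt I J K' u x)
    (\<integral>y. exp (t * u * qform I (gram J K K') y) \<partial>gauss I)"
proof (rule has_bochner_integral_nn_integral)
  have inner: "(\<integral>\<^sup>+z. ennreal (tilt I J K t (merge I J (y, z)) * tilt I J K' u (merge I J (y, z))) \<partial>gauss J)
      = ennreal (exp (t * u * qform I (gram J K K') y))" for y
  proof -
    define a a' where "a j = t * lin I K y j" and "a' j = u * lin I K' y j" for j
    have aa: "(\<Sum>j\<in>J. a j * a' j) = t * u * qform I (gram J K K') y"
      unfolding bform_diag[symmetric] sum_lin_lin[symmetric] a_def a'_def sum_distrib_left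
      by (simp add: mult_ac)
    have "(\<integral>\<^sup>+z. ennreal (tilt I J K t (merge I J (y, z)) * tilt I J K' u (merge I J (y, z))) \<partial>gauss J)
      = (\<integral>\<^sup>+z. ennreal (exp (\<Sum>j\<in>J. a j * z j - (a j)\<^sup>2 / 2)) * ennreal (exp (\<Sum>j\<in>J. a' j * z j - (a' j)\<^sup>2 / 2)) \<partial>gauss J)"
      by (simp add: tilt_merge a_def a'_def ennreal_mult')
    also have "\<dots> = (\<integral>\<^sup>+z. ennreal (exp (\<Sum>j\<in>J. a' j * (\<lambda>j\<in>J. z j + a j) j - (a' j)\<^sup>2 / 2)) \<partial>gauss J)"
      by (rule nn_integral_gauss_shift[OF J]) measurable
    also have "\<dots> = (\<integral>\<^sup>+z. ennreal (exp (\<Sum>j\<in>J. a j * a' j)) * ennreal (exp (\<Sum>j\<in>J. a' j * z j - (a' j)\<^sup>2 / 2)) \<partial>gauss J)"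
    proof -
      have "(\<Sum>j\<in>J. a' j * (\<lambda>j\<in>J. z j + a j) j - (a' j)\<^sup>2 / 2) = (\<Sum>j\<in>J. a j * a' j) + (\<Sum>j\<in>J. a' j * z j - (a' j)\<^sup>2 / 2)" for z
        unfolding sum.distrib[symmetric] by (intro sum.cong) (auto simp: algebra_simps)
      then show ?thesis by (simp only: exp_add ennreal_mult' exp_ge_zero)
    qed
    also have "\<dots> = ennreal (exp (\<Sum>j\<in>J. a j * a' j)) * 1"
      by (subst nn_integral_cmult) (simp_all add: nn_integral_gauss_tilt[OF J])
    finally show ?thesis by (simp add: aa)
  qed
  have "(\<integral>\<^sup>+x. ennreal (tilt I J K t x * tilt I J K' u x) \<partial>gauss (I \<union> J))
    = (\<integral>\<^sup>+y. (\<integral>\<^sup>+z. ennreal (tilt I J K t (merge I J (y, z)) * tilt I J K' u (merge I J (y, z))) \<partial>gauss J) \<partial>gauss I)"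
    by (rule nn_integral_gauss_union[OF I J IJ]) measurable
  then show "(\<integral>\<^sup>+x. ennreal (tilt I J K t x * tilt I J K' u x) \<partial>gauss (I \<union> J))
    = ennreal (\<integral>y. exp (t * u * qform I (gram J K K') y) \<partial>gauss I)"
    using i by (simp add: inner nn_integral_eq_integral)
qed (auto simp: tilt_pos)

lemma exp_qform_gram_bounds: "0 \<le> \<tau> * qform I (gram J K K) h / 2"
  using \<tau> by (simp add: qform_gram sum_nonneg)

lemma abs_exp_cos_le: "\<bar>exp (- (\<tau> * qform I (gram J K K) h / 2)) * cos z\<bar> \<le> 1"
  unfolding abs_mult using exp_qform_gram_bounds[of K h] mult_mono[of "exp (- (\<tau> * qform I (gram J K K) h / 2))" 1 "\<bar>cos z\<bar>" 1] by simp

text \<open>The two versions differ by the order of \<open>y\<close> and the auxiliary vector in the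
  pair; they match the two mixed terms of \<open>overlap\<close>, in which the weight sits on the
  second and on the first vector.\<close>

lemma has_integral_tilt_damp:
  "has_bochner_integral (gauss (I \<union> J)) (\<lambda>x. tilt I J K t x * damp I J \<tau> K' x)
    (\<integral>x. exp (- (\<tau> * qform I (gram J K' K') (snd x) / 2)) * cos (sqrt \<tau> * t * bform I (gram J K K') (fst x) (snd x)) \<partial>(gauss I \<Otimes>\<^sub>M gauss I))"
  "has_bochner_integral (gauss (I \<union> J)) (\<lambda>x. tilt I J K t x * damp I J \<tau> K' x)
    (\<integral>x. exp (- (\<tau> * qform I (gram J K' K') (fst x) / 2)) * cos (sqrt \<tau> * t * bform I (gram J K' K) (fst x) (snd x)) \<partial>(gauss I \<Otimes>\<^sub>M gauss I))"
proof -
  interpret prob_space "gauss J" by (rule prob_space_gauss)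
  define f where "f y h = exp (- (\<tau> * qform I (gram J K' K') h / 2)) * cos (sqrt \<tau> * t * bform I (gram J K K') y h)" for y h
  have fm: "(\<lambda>x. f (fst x) (snd x)) \<in> borel_measurable (PiM I (\<lambda>_. borel) \<Otimes>\<^sub>M PiM I (\<lambda>_. borel))"
    "(\<lambda>x. f (snd x) (fst x)) \<in> borel_measurable (PiM I (\<lambda>_. borel) \<Otimes>\<^sub>M PiM I (\<lambda>_. borel))"
    unfolding f_def bform_def by measurable
  have fb: "\<bar>f y h\<bar> \<le> 1" for y h unfolding f_def by (rule abs_exp_cos_le)
  note sw = swap_gauss[OF fm(1) fb]
  have inner: "(\<integral>\<^sup>+z. ennreal (tilt I J K t (merge I J (y, z)) * damp I J \<tau> K' (merge I J (y, z))) \<partial>gauss J)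
      = ennreal (\<integral>h. f y h \<partial>gauss I)" "0 \<le> (\<integral>h. f y h \<partial>gauss I)" for y
  proof -
    define a where "a j = t * lin I K y j" for j
    have m: "(\<lambda>z. damp I J \<tau> K' (\<lambda>j\<in>J. z j + a j)) \<in> borel_measurable (gauss J)"
      by (rule measurable_compose[OF _ measurable_tilt_damp(3)]) measurable
    have v: "(\<integral>z. damp I J \<tau> K' (\<lambda>j\<in>J. z j + a j) \<partial>gauss J) = (\<integral>h. f y h \<partial>gauss I)"
      unfolding f_def a_def by (rule integral_damp_shift)
    have "(\<integral>\<^sup>+z. ennreal (tilt I J K t (merge I J (y, z)) * damp I J \<tau> K' (merge I J (y, z))) \<partial>gauss J)
      = (\<integral>\<^sup>+z. ennreal (exp (\<Sum>j\<in>J. a j * z j - (a j)\<^sup>2 / 2)) * ennreal (damp I J \<tau> K' z) \<partial>gauss J)"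
      by (simp add: tilt_merge damp_merge a_def ennreal_mult')
    also have "\<dots> = (\<integral>\<^sup>+z. ennreal (damp I J \<tau> K' (\<lambda>j\<in>J. z j + a j)) \<partial>gauss J)"
      by (rule nn_integral_gauss_shift[OF J]) measurable
    also have "\<dots> = ennreal (\<integral>z. damp I J \<tau> K' (\<lambda>j\<in>J. z j + a j) \<partial>gauss J)"
      using damp_bounds m by (intro nn_integral_eq_integral integrable_const_bound[where B=1]) auto
    finally show "(\<integral>\<^sup>+z. ennreal (tilt I J K t (merge I J (y, z)) * damp I J \<tau> K' (merge I J (y, z))) \<partial>gauss J)
      = ennreal (\<integral>h. f y h \<partial>gauss I)" unfolding v .
    show "0 \<le> (\<integral>h. f y h \<partial>gauss I)" unfolding v[symmetric] using damp_bounds by simp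
  qed
  have "(\<integral>\<^sup>+x. ennreal (tilt I J K t x * damp I J \<tau> K' x) \<partial>gauss (I \<union> J))
    = (\<integral>\<^sup>+y. (\<integral>\<^sup>+z. ennreal (tilt I J K t (merge I J (y, z)) * damp I J \<tau> K' (merge I J (y, z))) \<partial>gauss J) \<partial>gauss I)"
    by (rule nn_integral_gauss_union[OF I J IJ]) measurable
  also have "\<dots> = ennreal (\<integral>y. (\<integral>h. f y h \<partial>gauss I) \<partial>gauss I)"
    unfolding inner(1) using sw(3) inner(2) by (intro nn_integral_eq_integral) auto
  finally have "has_bochner_integral (gauss (I \<union> J)) (\<lambda>x. tilt I J K t x * damp I J \<tau> K' x) (\<integral>y. (\<integral>h. f y h \<partial>gauss I) \<partial>gauss I)"
    using inner(2) by (intro has_bochner_integral_nn_integral) (auto simp: tilt_pos damp_bounds)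
  moreover note sw(2)
  moreover have "(\<integral>y. (\<integral>h. f y h \<partial>gauss I) \<partial>gauss I) = (\<integral>x. f (snd x) (fst x) \<partial>(gauss I \<Otimes>\<^sub>M gauss I))"
    unfolding sw(1) by (rule swap_gauss(2)[OF fm(2) fb])
  ultimately show "has_bochner_integral (gauss (I \<union> J)) (\<lambda>x. tilt I J K t x * damp I J \<tau> K' x)
    (\<integral>x. exp (- (\<tau> * qform I (gram J K' K') (snd x) / 2)) * cos (sqrt \<tau> * t * bform I (gram J K K') (fst x) (snd x)) \<partial>(gauss I \<Otimes>\<^sub>M gauss I))"
  "has_bochner_integral (gauss (I \<union> J)) (\<lambda>x. tilt I J K t x * damp I J \<tau> K' x)
    (\<integral>x. exp (- (\<tau> * qform I (gram J K' K') (fst x) / 2)) * cos (sqrt \<tau> * t * bform I (gram J K' K) (fst x) (snd x)) \<partial>(gauss I \<Otimes>\<^sub>M gauss I))"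
    unfolding f_def by (simp_all add: bform_gram_commute[of I J K K'])
qed

lemma has_integral_damp_damp:
  "has_bochner_integral (gauss (I \<union> J)) (\<lambda>x. damp I J \<tau> K x * damp I J \<tau> K' x)
    (\<integral>x. exp (- (\<tau> * qform I (gram J K K) (fst x) / 2)) * exp (- (\<tau> * qform I (gram J K' K') (snd x) / 2))
        * cosh (\<tau> * bform I (gram J K K') (fst x) (snd x)) \<partial>(gauss I \<Otimes>\<^sub>M gauss I))"
proof (rule has_bochner_integral_nn_integral)
  interpret G: prob_space "gauss I" by (rule prob_space_gauss)
  interpret prob_space "gauss J" by (rule prob_space_gauss)
  have "\<bar>damp I J \<tau> K z * damp I J \<tau> K' z\<bar> \<le> 1" for z
    using damp_bounds[of K z] damp_bounds[of K' z] mult_mono[of "damp I J \<tau> K z" 1 "damp I J \<tau> K' z" 1] by (simp add: abs_mult)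
  then have i: "integrable (gauss J) (\<lambda>z. damp I J \<tau> K z * damp I J \<tau> K' z)"
    by (intro integrable_const_bound[where B=1]) auto
  have "(\<integral>\<^sup>+x. ennreal (damp I J \<tau> K x * damp I J \<tau> K' x) \<partial>gauss (I \<union> J))
    = (\<integral>\<^sup>+y. (\<integral>\<^sup>+z. ennreal (damp I J \<tau> K (merge I J (y, z)) * damp I J \<tau> K' (merge I J (y, z))) \<partial>gauss J) \<partial>gauss I)"
    by (rule nn_integral_gauss_union[OF I J IJ]) measurable
  also have "\<dots> = ennreal (\<integral>z. damp I J \<tau> K z * damp I J \<tau> K' z \<partial>gauss J)"
    using i damp_bounds by (simp add: damp_merge nn_integral_eq_integral G.emeasure_space_1)
  finally show "(\<integral>\<^sup>+x. ennreal (damp I J \<tau> K x * damp I J \<tau> K' x) \<partial>gauss (I \<union> J)) = ennreal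
    (\<integral>x. exp (- (\<tau> * qform I (gram J K K) (fst x) / 2)) * exp (- (\<tau> * qform I (gram J K' K') (snd x) / 2))
        * cosh (\<tau> * bform I (gram J K K') (fst x) (snd x)) \<partial>(gauss I \<Otimes>\<^sub>M gauss I))"
    by (simp only: integral_damp_damp)
qed (auto simp: damp_bounds)

end

section \<open>The contaminated likelihood ratio\<close>

locale contaminated_model = test_weights A p \<delta> \<tau> T l + blocks I J \<tau>
  for A p \<delta> \<tau> T l and I J :: "'i set"
begin

definition rho :: "('i \<Rightarrow> 'i \<Rightarrow> real) \<Rightarrow> ('i \<Rightarrow> real) \<Rightarrow> real" where
  "rho K x = (\<Sum>t\<in>A. p t * tilt I J K t x) + \<delta> / gibbs_norm I \<tau> (gram J K K) * damp I J \<tau> K x"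

lemma measurable_rho[measurable]: "rho K \<in> borel_measurable (PiM (I \<union> J) (\<lambda>_. borel))"
  unfolding rho_def[abs_def] by measurable

lemma gibbs_norm_nonneg: "0 \<le> gibbs_norm I \<tau> U"
  by (simp add: gibbs_norm_def)

lemma rho_nonneg: "0 \<le> rho K x"
  unfolding rho_def using p \<delta> tilt_pos damp_bounds gibbs_norm_nonneg
  by (intro add_nonneg_nonneg sum_nonneg mult_nonneg_nonneg divide_nonneg_nonneg) (auto simp: less_imp_le)

lemma has_integral_rho_rho:
  assumes K: "gibbs_matrix I \<tau> (gram J K K) s" and K': "gibbs_matrix I \<tau> (gram J K' K') s"
    and s: "0 < s" and frob: "frob_sq I (gram J K K') \<le> s\<^sup>2" and trace: "\<bar>mtrace I (gram J K K')\<bar> \<le> 1"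
    and small: "32 * l\<^sup>2 * s \<le> 1" "8 * \<tau> * s \<le> 1"
  shows "has_bochner_integral (gauss (I \<union> J)) (\<lambda>x. rho K x * rho K' x)
    (overlap I (gram J K K') (gram J K K) (gram J K' K'))"
proof -
  interpret K: gibbs_matrix I \<tau> "gram J K K" s by fact
  interpret K': gibbs_matrix I \<tau> "gram J K' K'" s by fact
  define n n' where "n = gibbs_norm I \<tau> (gram J K K)" and "n' = gibbs_norm I \<tau> (gram J K' K')"
  define P where "P = gram J K K'"
  let ?G = "gauss I \<Otimes>\<^sub>M gauss I"
  have ie: "integrable (gauss I) (\<lambda>y. exp (t * u * qform I P y))" if "t \<in> A" "u \<in> A" for t u
    unfolding P_def by (rule integral_mean_exp_le(1)[OF I s frob trace small abs_mult_le[OF that]])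
  define e where "e t u = (\<integral>y. exp (t * u * qform I P y) \<partial>gauss I)" for t u
  define f where "f t x = exp (- (\<tau> * qform I (gram J K' K') (snd x) / 2)) * cos (sqrt \<tau> * t * bform I P (fst x) (snd x))" for t x
  define g where "g t x = exp (- (\<tau> * qform I (gram J K K) (fst x) / 2)) * cos (sqrt \<tau> * t * bform I P (fst x) (snd x))" for t x
  define h where "h x = exp (- (\<tau> * qform I (gram J K K) (fst x) / 2)) * exp (- (\<tau> * qform I (gram J K' K') (snd x) / 2))
        * cosh (\<tau> * bform I P (fst x) (snd x))" for x
  have "rho K x * rho K' x = (\<Sum>t\<in>A. \<Sum>u\<in>A. p t * p u * (tilt I J K t x * tilt I J K' u x))
      + (\<Sum>t\<in>A. (p t * (\<delta> / n')) * (tilt I J K t x * damp I J \<tau> K' x))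
      + (\<Sum>t\<in>A. (p t * (\<delta> / n)) * (tilt I J K' t x * damp I J \<tau> K x))
      + (\<delta> / n * (\<delta> / n')) * (damp I J \<tau> K x * damp I J \<tau> K' x)" for x
  proof -
    have "(\<Sum>t\<in>A. \<Sum>u\<in>A. p t * p u * (tilt I J K t x * tilt I J K' u x)) = (\<Sum>t\<in>A. p t * tilt I J K t x) * (\<Sum>t\<in>A. p t * tilt I J K' t x)"
      unfolding sum_product by (simp add: mult_ac)
    moreover have "(\<Sum>t\<in>A. (p t * (\<delta> / n')) * (tilt I J K t x * damp I J \<tau> K' x)) = (\<Sum>t\<in>A. p t * tilt I J K t x) * (\<delta> / n' * damp I J \<tau> K' x)"
      "(\<Sum>t\<in>A. (p t * (\<delta> / n)) * (tilt I J K' t x * damp I J \<tau> K x)) = (\<Sum>t\<in>A. p t * tilt I J K' t x) * (\<delta> / n * damp I J \<tau> K x)"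
      unfolding sum_distrib_right by (simp_all add: mult_ac)
    ultimately show ?thesis unfolding rho_def n_def[symmetric] n'_def[symmetric] by (simp only:) (simp add: algebra_simps)
  qed
  moreover have "has_bochner_integral (gauss (I \<union> J)) (\<lambda>x. (\<Sum>t\<in>A. \<Sum>u\<in>A. p t * p u * (tilt I J K t x * tilt I J K' u x))
      + (\<Sum>t\<in>A. (p t * (\<delta> / n')) * (tilt I J K t x * damp I J \<tau> K' x))
      + (\<Sum>t\<in>A. (p t * (\<delta> / n)) * (tilt I J K' t x * damp I J \<tau> K x))
      + (\<delta> / n * (\<delta> / n')) * (damp I J \<tau> K x * damp I J \<tau> K' x))
    ((\<Sum>t\<in>A. \<Sum>u\<in>A. p t * p u * e t u) + (\<Sum>t\<in>A. (p t * (\<delta> / n')) * (\<integral>x. f t x \<partial>?G))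
      + (\<Sum>t\<in>A. (p t * (\<delta> / n)) * (\<integral>x. g t x \<partial>?G)) + (\<delta> / n * (\<delta> / n')) * (\<integral>x. h x \<partial>?G))"
    unfolding e_def f_def g_def h_def P_def
    by (intro has_bochner_integral_add has_bochner_integral_sum has_bochner_integral_mult_right
        has_integral_tilt_tilt ie[unfolded P_def] has_integral_tilt_damp has_integral_damp_damp) auto
  moreover have "(\<Sum>t\<in>A. \<Sum>u\<in>A. p t * p u * e t u) = (\<integral>y. mean_exp (qform I P y) \<partial>gauss I)"
    unfolding mean_exp_def e_def using ie
    by (subst Bochner_Integration.integral_sum; (intro Bochner_Integration.integrable_sum)?; simp)
  moreover have "(\<Sum>t\<in>A. (p t * (\<delta> / n')) * (\<integral>x. f t x \<partial>?G)) = \<delta> * (\<integral>x. gibbs I \<tau> (gram J K' K') (snd x) * mean_cos (bform I P (fst x) (snd x)) \<partial>?G)"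
  proof -
    interpret P: pair_prob_space "gauss I" "gauss I" by (rule pair_gauss)
    have "integrable ?G (f t)" for t
      by (rule P.P.integrable_const_bound[where B=1]) (auto simp: f_def[abs_def] abs_exp_cos_le)
    then have "(\<integral>x. (\<Sum>t\<in>A. (p t / n') * f t x) \<partial>?G) = (\<Sum>t\<in>A. (p t / n') * (\<integral>x. f t x \<partial>?G))"
      by simp
    moreover have "gibbs I \<tau> (gram J K' K') (snd x) * mean_cos (bform I P (fst x) (snd x)) = (\<Sum>t\<in>A. (p t / n') * f t x)" for x
      unfolding gibbs_def mean_cos_def f_def n'_def sum_distrib_left by (simp add: field_simps)
    ultimately show ?thesis by (simp add: sum_distrib_left mult_ac)
  qed
  moreover have "(\<Sum>t\<in>A. (p t * (\<delta> / n)) * (\<integral>x. g t x \<partial>?G)) = \<delta> * (\<integral>x. gibbs I \<tau> (gram J K K) (fst x) * mean_cos (bform I P (fst x) (snd x)) \<partial>?G)"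
  proof -
    interpret P: pair_prob_space "gauss I" "gauss I" by (rule pair_gauss)
    have "integrable ?G (g t)" for t
      by (rule P.P.integrable_const_bound[where B=1]) (auto simp: g_def[abs_def] abs_exp_cos_le)
    then have "(\<integral>x. (\<Sum>t\<in>A. (p t / n) * g t x) \<partial>?G) = (\<Sum>t\<in>A. (p t / n) * (\<integral>x. g t x \<partial>?G))"
      by simp
    moreover have "gibbs I \<tau> (gram J K K) (fst x) * mean_cos (bform I P (fst x) (snd x)) = (\<Sum>t\<in>A. (p t / n) * g t x)" for x
      unfolding gibbs_def mean_cos_def g_def n_def sum_distrib_left by (simp add: field_simps)
    ultimately show ?thesis by (simp add: sum_distrib_left mult_ac)
  qed
  moreover have "(\<delta> / n * (\<delta> / n')) * (\<integral>x. h x \<partial>?G)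
     = \<delta>\<^sup>2 * (\<integral>x. gibbs I \<tau> (gram J K K) (fst x) * gibbs I \<tau> (gram J K' K') (snd x) * cosh (\<tau> * bform I P (fst x) (snd x)) \<partial>?G)"
  proof -
    have "gibbs I \<tau> (gram J K K) (fst x) * gibbs I \<tau> (gram J K' K') (snd x) * cosh (\<tau> * bform I P (fst x) (snd x)) = 1 / (n * n') * h x" for x
      unfolding gibbs_def h_def n_def n'_def by simp
    then show ?thesis by (simp add: power2_eq_square)
  qed
  ultimately show ?thesis unfolding overlap_def P_def[symmetric] by simp
qed

lemma has_integral_rho:
  assumes K: "gibbs_matrix I \<tau> (gram J K K) s"
  shows "has_bochner_integral (gauss (I \<union> J)) (rho K) 1"
proof -
  interpret K: gibbs_matrix I \<tau> "gram J K K" s by fact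
  have "has_bochner_integral (gauss (I \<union> J)) (rho K) ((\<Sum>t\<in>A. p t * 1) + \<delta> / gibbs_norm I \<tau> (gram J K K) * gibbs_norm I \<tau> (gram J K K))"
    unfolding rho_def[abs_def]
    by (intro has_bochner_integral_add has_bochner_integral_sum has_bochner_integral_mult_right has_integral_tilt has_integral_damp)
  then show ?thesis using K.gibbs_norm_pos by (simp add: p0)
qed

end

section \<open>The hidden Gaussian as an admissible alternative\<close>

definition block_root :: "nat set \<Rightarrow> nat set \<Rightarrow> (nat \<Rightarrow> nat \<Rightarrow> real) \<Rightarrow> nat \<Rightarrow> nat \<Rightarrow> real" where
  "block_root I J K i k = (if i = k then 1 else 0) + (if i \<in> J \<and> k \<in> I then K i k else 0)"

definition block_cov :: "nat \<Rightarrow> nat set \<Rightarrow> nat set \<Rightarrow> (nat \<Rightarrow> nat \<Rightarrow> real) \<Rightarrow> nat \<Rightarrow> nat \<Rightarrow> real" where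
  "block_cov d I J K i j = (\<Sum>k<d. block_root I J K i k * block_root I J K j k)"

context
  fixes d :: nat and I J :: "nat set" and K :: "nat \<Rightarrow> nat \<Rightarrow> real"
  assumes IJ: "I \<inter> J = {}" and U: "I \<union> J = {..<d}"
begin

lemma finite_blocks: "finite I" "finite J"
  using U by (metis finite_Un finite_lessThan)+

lemma block_root_apply:
  assumes "i < d"
  shows "(\<Sum>k<d. block_root I J K i k * g k) = g i + (if i \<in> J then lin I K g i else 0)"
proof -
  have "(\<Sum>k<d. block_root I J K i k * g k) = (\<Sum>k<d. (if i = k then g k else 0)) + (\<Sum>k<d. if k \<in> I then (if i \<in> J then K i k * g k else 0) else 0)"
    unfolding sum.distrib[symmetric] block_root_def by (intro sum.cong) (auto simp: algebra_simps)
  also have "(\<Sum>k<d. if k \<in> I then (if i \<in> J then K i k * g k else 0) else 0) = (\<Sum>k\<in>{..<d} \<inter> I. if i \<in> J then K i k * g k else 0)"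
    by (rule sum.inter_restrict[symmetric]) simp
  also have "{..<d} \<inter> I = I" using U by auto
  finally show ?thesis using assms by (simp add: lin_def)
qed

text \<open>\<open>block_root\<close> is the matrix of the map (y, z) -> (y, z + K y), and by
  \<open>gaussian_eq_distr\<close> any root of the covariance may be used. For fixed
  \<open>y\<close> the map is a shift of \<open>z\<close>, whose density is given by
  Cameron-Martin.\<close>

lemma gaussian_block_cov:
  "gaussian d (block_cov d I J K) = density (std_gaussian d) (\<lambda>x. ennreal (tilt I J K 1 x))"
proof -
  note fin = finite_blocks
  interpret blocks I J 0 by standard (use fin IJ in auto)
  define F where "F = (\<lambda>g. \<lambda>i\<in>{..<d}. \<Sum>k<d. block_root I J K i k * g k)"
  have Fm[measurable]: "F \<in> measurable (PiM {..<d} (\<lambda>_. borel)) (PiM {..<d} (\<lambda>_. borel))"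
    unfolding F_def by measurable
  have "gaussian d (block_cov d I J K) = distr (gauss {..<d}) (PiM {..<d} (\<lambda>_. borel)) F"
    unfolding F_def by (subst gaussian_eq_distr) (auto simp: block_cov_def std_gaussian_gauss Rd_def)
  also have "\<dots> = density (gauss {..<d}) (\<lambda>x. ennreal (tilt I J K 1 x))"
  proof (rule measure_eqI)
    fix X assume "X \<in> sets (distr (gauss {..<d}) (PiM {..<d} (\<lambda>_. borel)) F)"
    then have X[measurable]: "X \<in> sets (PiM (I \<union> J) (\<lambda>_. borel))" by (simp add: U)
    have Fm'[measurable]: "F \<in> measurable (PiM (I \<union> J) (\<lambda>_. borel)) (PiM (I \<union> J) (\<lambda>_. borel))" using Fm by (simp add: U)
    have F_merge: "F (merge I J (y, z)) = merge I J (y, \<lambda>j\<in>J. z j + lin I K y j)" for y z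
    proof
      fix i show "F (merge I J (y, z)) i = merge I J (y, \<lambda>j\<in>J. z j + lin I K y j) i"
      proof (cases "i < d")
        case True
        then have "F (merge I J (y, z)) i = merge I J (y, z) i + (if i \<in> J then lin I K y i else 0)"
          by (simp add: F_def block_root_apply lin_merge)
        then show ?thesis using U IJ True by (auto simp: merge_def)
      qed (use U in \<open>auto simp: F_def merge_def\<close>)
    qed
    have "emeasure (distr (gauss {..<d}) (PiM {..<d} (\<lambda>_. borel)) F) X = (\<integral>\<^sup>+x. indicator X (F x) \<partial>gauss (I \<union> J))"
      using X by (subst nn_integral_indicator[symmetric], simp add: U, subst nn_integral_distr) (auto simp: U)
    also have "\<dots> = (\<integral>\<^sup>+y. (\<integral>\<^sup>+z. indicator X (F (merge I J (y, z))) \<partial>gauss J) \<partial>gauss I)"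
      by (rule nn_integral_gauss_union[OF fin IJ]) measurable
    also have "\<dots> = (\<integral>\<^sup>+y. (\<integral>\<^sup>+z. ennreal (tilt I J K 1 (merge I J (y, z))) * indicator X (merge I J (y, z)) \<partial>gauss J) \<partial>gauss I)"
    proof (rule nn_integral_cong)
      fix y assume y: "y \<in> space (gauss I)"
      then have y': "y \<in> space (PiM I (\<lambda>_. borel :: real measure))" by (simp add: space_gauss space_PiM PiE_def)
      have m: "(\<lambda>z. indicator X (merge I J (y, z)) :: ennreal) \<in> borel_measurable (PiM J (\<lambda>_. borel))"
        by (rule measurable_compose[OF measurable_compose[OF measurable_Pair1'[OF y'] measurable_merge]]) simp
      show "(\<integral>\<^sup>+z. indicator X (F (merge I J (y, z))) \<partial>gauss J)
        = (\<integral>\<^sup>+z. ennreal (tilt I J K 1 (merge I J (y, z))) * indicator X (merge I J (y, z)) \<partial>gauss J)"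
        unfolding F_merge tilt_merge
        using nn_integral_gauss_shift[OF fin(2) m, of "\<lambda>j. lin I K y j"] by simp
    qed
    also have "\<dots> = (\<integral>\<^sup>+x. ennreal (tilt I J K 1 x) * indicator X x \<partial>gauss (I \<union> J))"
      by (rule nn_integral_gauss_union[OF fin IJ, symmetric]) measurable
    also have "\<dots> = emeasure (density (gauss {..<d}) (\<lambda>x. ennreal (tilt I J K 1 x))) X"
      unfolding U[symmetric] by (rule emeasure_density[symmetric]) measurable
    finally show "emeasure (distr (gauss {..<d}) (PiM {..<d} (\<lambda>_. borel)) F) X = \<dots>" .
  qed simp
  finally show ?thesis by (simp add: std_gaussian_gauss)
qed

lemma sym_pos_def_block_cov: "sym_pos_def d (block_cov d I J K)"
  unfolding sym_pos_def_def
proof (intro conjI allI impI)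
  show "block_cov d I J K i j = block_cov d I J K j i" for i j by (simp add: block_cov_def mult.commute)
  fix x :: "nat \<Rightarrow> real" assume x: "\<exists>i<d. x i \<noteq> 0"
  define c where "c k = (\<Sum>i<d. x i * block_root I J K i k)" for k
  have "(\<Sum>i<d. \<Sum>j<d. x i * block_cov d I J K i j * x j) = (\<Sum>i<d. \<Sum>j<d. \<Sum>k<d. (x i * block_root I J K i k) * (x j * block_root I J K j k))"
    by (simp add: block_cov_def sum_distrib_left sum_distrib_right mult_ac)
  also have "\<dots> = (\<Sum>i<d. \<Sum>k<d. \<Sum>j<d. (x i * block_root I J K i k) * (x j * block_root I J K j k))"
    by (rule sum.cong[OF refl], rule sum.swap)
  also have "\<dots> = (\<Sum>k<d. \<Sum>i<d. \<Sum>j<d. (x i * block_root I J K i k) * (x j * block_root I J K j k))" by (rule sum.swap)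
  also have "\<dots> = (\<Sum>k<d. (c k)\<^sup>2)" by (simp add: c_def power2_eq_square sum_product)
  finally have eq: "(\<Sum>i<d. \<Sum>j<d. x i * block_cov d I J K i j * x j) = (\<Sum>k<d. (c k)\<^sup>2)" .
  have "(\<Sum>k<d. (c k)\<^sup>2) \<noteq> 0"
  proof
    assume "(\<Sum>k<d. (c k)\<^sup>2) = 0"
    then have c0: "c k = 0" if "k < d" for k using that by (simp add: sum_nonneg_eq_0_iff)
    have ck: "c k = x k + (if k \<in> I then \<Sum>j\<in>J. x j * K j k else 0)" if "k < d" for k
    proof -
      have "c k = (\<Sum>i<d. if i = k then x i else 0) + (\<Sum>i<d. if i \<in> J then (if k \<in> I then x i * K i k else 0) else 0)"
        unfolding c_def sum.distrib[symmetric] block_root_def by (intro sum.cong) (auto simp: algebra_simps)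
      also have "(\<Sum>i<d. if i \<in> J then (if k \<in> I then x i * K i k else 0) else 0) = (\<Sum>i\<in>{..<d} \<inter> J. if k \<in> I then x i * K i k else 0)"
        by (rule sum.inter_restrict[symmetric]) simp
      also have "{..<d} \<inter> J = J" using U by auto
      finally show ?thesis using that by simp
    qed
    \<comment> \<open>The transposed root is triangular: its equations for \<open>J\<close> involve
      a single unknown each, and inserting these zeros settles those for \<open>I\<close>.\<close>
    have xJ: "x j = 0" if "j \<in> J" for j
    proof -
      have "j < d" "j \<notin> I" using that U IJ by auto
      then show ?thesis using ck[of j] c0[of j] by simp
    qed
    have "x i = 0" if "i < d" for i
      using ck[of i] c0[of i] that xJ U by (cases "i \<in> I") auto
    then show False using x by auto
  qed
  then show "0 < (\<Sum>i<d. \<Sum>j<d. x i * block_cov d I J K i j * x j)"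
    unfolding eq by (simp add: less_le sum_nonneg)
qed

text \<open>The lower left block of the covariance is \<open>K\<close> itself, so the distance is at
  least the Frobenius norm of \<open>K\<close>, which is 1.\<close>

lemma frob_dist_block_cov:
  assumes "(\<Sum>j\<in>J. \<Sum>i\<in>I. (K j i)\<^sup>2) = 1"
  shows "frob_dist_id d (block_cov d I J K) > 1 / 2"
proof -
  have e: "block_cov d I J K j i = K j i" if "j \<in> J" "i \<in> I" for i j
  proof -
    have "i < d" "j < d" "i \<notin> J" using that U IJ by auto
    then have "block_cov d I J K j i = block_root I J K j i"
      unfolding block_cov_def by (subst mult.commute, subst block_root_apply) auto
    then show ?thesis using that IJ by (auto simp: block_root_def)
  qed
  let ?D = "\<lambda>i j. (block_cov d I J K i j - (if i = j then 1 else 0))\<^sup>2"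
  have "1 = (\<Sum>j\<in>J. \<Sum>i\<in>I. ?D j i)"
    unfolding assms[symmetric] using e IJ by (intro sum.cong) auto
  also have "\<dots> \<le> (\<Sum>j\<in>J. \<Sum>i<d. ?D j i)"
    using U by (intro sum_mono sum_mono2) auto
  also have "\<dots> \<le> (\<Sum>j<d. \<Sum>i<d. ?D j i)"
  proof (rule sum_mono2)
    show "J \<subseteq> {..<d}" using U by blast
  qed (simp_all add: sum_nonneg)
  finally have "1 \<le> frob_dist_id d (block_cov d I J K)" unfolding frob_dist_id_def by simp
  then show ?thesis by simp
qed

end

text \<open>The atom 1 is the Gaussian part, and everything else is declared to be the
  contamination. Its density \<open>q\<close> has mass \<open>\<epsilon>\<close> because
  \<open>rho\<close> and \<open>tilt\<close> both integrate to 1, so that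
  \<open>q / \<epsilon>\<close> is a probability density.\<close>

lemma (in contaminated_model) mixture_eq_density_rho:
  fixes d :: nat
  assumes K: "gibbs_matrix I \<tau> (gram J K K) s"
    and one: "1 \<in> A" "p 1 = 1 - \<epsilon>" and \<epsilon>: "0 < \<epsilon>" "\<epsilon> < 1"
  shows "\<exists>B. prob_space B \<and> sets B = sets (gauss (I \<union> J)) \<and>
    mixture \<epsilon> (density (gauss (I \<union> J)) (\<lambda>x. ennreal (tilt I J K 1 x))) B = density (gauss (I \<union> J)) (\<lambda>x. ennreal (rho K x))"
proof -
  let ?M = "gauss (I \<union> J)"
  interpret prob_space ?M by (rule prob_space_gauss)
  define q where "q x = (\<Sum>t\<in>A - {1}. p t * tilt I J K t x) + \<delta> / gibbs_norm I \<tau> (gram J K K) * damp I J \<tau> K x" for x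
  have rho: "rho K x = (1 - \<epsilon>) * tilt I J K 1 x + q x" for x
    unfolding rho_def q_def sum.remove[OF A one(1)] one(2) by simp
  have q0: "0 \<le> q x" for x
    unfolding q_def using p \<delta> tilt_pos damp_bounds gibbs_norm_nonneg
    by (intro add_nonneg_nonneg sum_nonneg mult_nonneg_nonneg divide_nonneg_nonneg) (auto simp: less_imp_le)
  have [measurable]: "q \<in> borel_measurable (PiM (I \<union> J) (\<lambda>_. borel))" unfolding q_def[abs_def] by measurable
  have "has_bochner_integral ?M (\<lambda>x. rho K x - (1 - \<epsilon>) * tilt I J K 1 x) (1 - (1 - \<epsilon>) * 1)"
    by (intro has_bochner_integral_diff has_bochner_integral_mult_right has_integral_rho[OF K] has_integral_tilt)
  then have hq: "has_bochner_integral ?M q \<epsilon>" by (simp add: rho)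
  define B where "B = density ?M (\<lambda>x. ennreal (q x / \<epsilon>))"
  have "emeasure B (space B) = (\<integral>\<^sup>+x. ennreal (q x / \<epsilon>) \<partial>?M)"
    unfolding B_def by (subst emeasure_density) (auto intro!: nn_integral_cong simp del: sets_gauss)
  also have "\<dots> = ennreal (\<integral>x. q x / \<epsilon> \<partial>?M)"
    using hq q0 \<epsilon> by (intro nn_integral_eq_integral) (auto simp: has_bochner_integral_iff)
  also have "\<dots> = 1" using hq \<epsilon> by (simp add: has_bochner_integral_iff)
  finally have pB: "prob_space B" by (rule prob_spaceI)
  \<comment> \<open>\<open>mixture\<close> is given by a bare set function under
    \<open>measure_of\<close>; agreement on the sigma-algebra with the set function of an actual
    measure identifies it.\<close>
  have "mixture \<epsilon> (density ?M (\<lambda>x. ennreal (tilt I J K 1 x))) B = measure_of (space ?M) (sets ?M) (emeasure (density ?M (\<lambda>x. ennreal (rho K x))))"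
    unfolding mixture_def space_density sets_density
  proof (rule measure_of_eq[OF sets.space_closed])
    fix X assume "X \<in> sigma_sets (space ?M) (sets ?M)"
    then have X[measurable]: "X \<in> sets ?M" using sets.sigma_sets_eq[of ?M] by blast
    have e: "emeasure (density ?M g) X = (\<integral>\<^sup>+x. g x * indicator X x \<partial>?M)"
      if "g \<in> borel_measurable (PiM (I \<union> J) (\<lambda>_. borel))" for g
      by (intro emeasure_density X) (use that in simp)
    have split: "ennreal (rho K x) = ennreal (1 - \<epsilon>) * ennreal (tilt I J K 1 x) + ennreal \<epsilon> * ennreal (q x / \<epsilon>)" for x
    proof -
      have "ennreal \<epsilon> * ennreal (q x / \<epsilon>) = ennreal (q x)" using \<epsilon> q0[of x] by (simp add: ennreal_mult'[symmetric])
      moreover have "ennreal (1 - \<epsilon>) * ennreal (tilt I J K 1 x) = ennreal ((1 - \<epsilon>) * tilt I J K 1 x)"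
        using \<epsilon> by (simp add: ennreal_mult')
      ultimately show ?thesis using \<epsilon> q0[of x] tilt_pos[of K 1 x] by (simp add: rho ennreal_plus)
    qed
    have "emeasure (density ?M (\<lambda>x. ennreal (rho K x))) X = (\<integral>\<^sup>+x. ennreal (1 - \<epsilon>) * (ennreal (tilt I J K 1 x) * indicator X x) + ennreal \<epsilon> * (ennreal (q x / \<epsilon>) * indicator X x) \<partial>?M)"
      by (subst e) (auto intro!: nn_integral_cong simp: split distrib_right mult.assoc)
    also have "\<dots> = ennreal (1 - \<epsilon>) * emeasure (density ?M (\<lambda>x. ennreal (tilt I J K 1 x))) X + ennreal \<epsilon> * emeasure B X"
      unfolding B_def by (simp add: e nn_integral_add nn_integral_cmult)
    finally show "ennreal (1 - \<epsilon>) * emeasure (density ?M (\<lambda>x. ennreal (tilt I J K 1 x))) X + ennreal \<epsilon> * emeasure B X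
      = emeasure (density ?M (\<lambda>x. ennreal (rho K x))) X" by (rule sym)
  qed
  also have "\<dots> = density ?M (\<lambda>x. ennreal (rho K x))"
    using measure_of_of_measure[of "density ?M (\<lambda>x. ennreal (rho K x))"] unfolding space_density sets_density .
  finally show ?thesis using pB by (intro exI[of _ B]) (simp add: B_def)
qed

subsection \<open>The second moment method\<close>

lemma iid_density:
  assumes M: "prob_space M" and D: "prob_space (density M r)" and r: "r \<in> borel_measurable M"
  shows "iid N (density M r) = density (iid N M) (\<lambda>x. \<Prod>n<N. r (x n))"
  unfolding iid_def
  by (rule density_PiM) (auto intro: prob_space_imp_sigma_finite M D r)

text \<open>Independence turns the integral of one factor into its \<open>N\<close>-th power;
  applied to products of two likelihood ratios it makes correlations tensorize.\<close>

lemma has_integral_iid_prod: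
  fixes g :: "'a \<Rightarrow> real"
  assumes M: "prob_space M" and g: "has_bochner_integral M g v"
  shows "has_bochner_integral (iid N M) (\<lambda>x. \<Prod>n<N. g (x n)) (v ^ N)"
proof -
  interpret M: prob_space M by fact
  interpret product_prob_space "\<lambda>_. M" "{..<N}" by (rule product_prob_spaceI) (rule M)
  have i: "integrable M g" "integral\<^sup>L M g = v" using g by (auto simp: has_bochner_integral_iff)
  show ?thesis unfolding iid_def has_bochner_integral_iff
    using product_integrable_prod[of "{..<N}" "\<lambda>_. g"] product_integral_prod[of "{..<N}" "\<lambda>_. g"] i by simp
qed

text \<open>The average of the product alternatives has density \<open>L\<close> under the null with
  \<open>E L = 1\<close>, and a test separates the two only as far as \<open>E |L - 1|\<close> allows.\<close>
theorem second_moment_test: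
  fixes r :: "'k \<Rightarrow> 'a \<Rightarrow> real" and f :: "(nat \<Rightarrow> 'a) \<Rightarrow> real"
  assumes M: "prob_space M" and S: "finite S" "S \<noteq> {}"
    and r0: "\<And>k x. k \<in> S \<Longrightarrow> 0 \<le> r k x" and r1: "\<And>k. k \<in> S \<Longrightarrow> has_bochner_integral M (r k) 1"
    and chi: "\<And>k k'. k \<in> S \<Longrightarrow> k' \<in> S \<Longrightarrow> has_bochner_integral M (\<lambda>x. r k x * r k' x) (c k k')"
    and small: "(\<Sum>k\<in>S. \<Sum>k'\<in>S. c k k' ^ N) / (real (card S))\<^sup>2 - 1 < 1 / 9"
    and f: "f \<in> borel_measurable (iid N M)" "\<And>x. x \<in> space (iid N M) \<Longrightarrow> 0 \<le> f x \<and> f x \<le> 1"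
    and null: "(\<integral>x. (1 - f x) \<partial>(iid N M)) \<ge> 2 / 3"
  shows "\<exists>k\<in>S. (\<integral>x. f x \<partial>(iid N (density M (\<lambda>x. ennreal (r k x))))) < 2 / 3"
proof (rule ccontr)
  assume "\<not> ?thesis"
  then have alt: "2 / 3 \<le> (\<integral>x. f x \<partial>(iid N (density M (\<lambda>x. ennreal (r k x)))))" if "k \<in> S" for k
    using that by force
  interpret M: prob_space M by fact
  interpret P: prob_space "iid N M" unfolding iid_def by (rule prob_space_PiM) (rule M)
  note f(1)[measurable]
  define R where "R k x = (\<Prod>n<N. r k (x n))" for k x
  define m where "m = real (card S)"
  have m: "0 < m" using S by (simp add: m_def card_gt_0_iff)
  define L where "L x = (\<Sum>k\<in>S. R k x) / m" for x
  have R1: "has_bochner_integral (iid N M) (R k) 1" if "k \<in> S" for k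
    using has_integral_iid_prod[OF M r1[OF that], of N] by (simp add: R_def[abs_def])
  have RR: "has_bochner_integral (iid N M) (\<lambda>x. R k x * R k' x) (c k k' ^ N)" if "k \<in> S" "k' \<in> S" for k k'
    using has_integral_iid_prod[OF M chi[OF that], of N] by (simp add: R_def prod.distrib)
  have R0: "0 \<le> R k x" if "k \<in> S" for k x unfolding R_def using r0[OF that] by (intro prod_nonneg) auto
  have fi: "integrable (iid N M) f"
    by (rule P.integrable_const_bound[where B=1]) (use f(2) in auto)
  have Ef: "(\<integral>x. f x \<partial>(iid N M)) \<le> 1 / 3" using null fi by (simp add: P.prob_space)
  have fR: "integrable (iid N M) (\<lambda>x. R k x * f x)" if "k \<in> S" for k
  proof (rule Bochner_Integration.integrable_bound)
    show "integrable (iid N M) (R k)" using R1[OF that] by (simp add: has_bochner_integral_iff)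
    then show "(\<lambda>x. R k x * f x) \<in> borel_measurable (iid N M)" by auto
    have "\<bar>R k x * f x\<bar> \<le> \<bar>R k x\<bar>" if "x \<in> space (iid N M)" for x
      using f(2)[OF that] mult_left_mono[of "\<bar>f x\<bar>" 1 "\<bar>R k x\<bar>"] by (simp add: abs_mult)
    then show "AE x in iid N M. norm (R k x * f x) \<le> norm (R k x)" by (simp add: AE_I2)
  qed
  have alt': "2 / 3 \<le> (\<integral>x. R k x * f x \<partial>(iid N M))" if k: "k \<in> S" for k
  proof -
    have [measurable]: "r k \<in> borel_measurable M" using r1[OF k] by (auto simp: has_bochner_integral_iff)
    have "emeasure (density M (\<lambda>x. ennreal (r k x))) (space (density M (\<lambda>x. ennreal (r k x)))) = (\<integral>\<^sup>+x. ennreal (r k x) \<partial>M)"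
      by (subst emeasure_density) (auto intro!: nn_integral_cong)
    also have "\<dots> = 1" using r1[OF k] r0[OF k] by (subst nn_integral_eq_integral) (auto simp: has_bochner_integral_iff)
    finally have "prob_space (density M (\<lambda>x. ennreal (r k x)))" by (rule prob_spaceI)
    then have "iid N (density M (\<lambda>x. ennreal (r k x))) = density (iid N M) (\<lambda>x. \<Prod>n<N. ennreal (r k (x n)))"
      by (intro iid_density M) auto
    also have "\<dots> = density (iid N M) (\<lambda>x. ennreal (R k x))"
      using r0[OF k] by (simp add: R_def prod_ennreal)
    finally have e: "iid N (density M (\<lambda>x. ennreal (r k x))) = density (iid N M) (\<lambda>x. ennreal (R k x))" .
    have [measurable]: "R k \<in> borel_measurable (iid N M)" using R1[OF k] by (auto simp: has_bochner_integral_iff)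
    show ?thesis using alt[OF k] unfolding e by (subst (asm) integral_density) (auto simp: R0[OF k])
  qed
  have L1: "has_bochner_integral (iid N M) L ((\<Sum>k\<in>S. 1) / m)"
    unfolding L_def[abs_def] by (intro has_bochner_integral_divide_zero has_bochner_integral_sum R1)
  then have L1: "has_bochner_integral (iid N M) L 1" using m by (simp add: m_def)
  have L2: "has_bochner_integral (iid N M) (\<lambda>x. (L x)\<^sup>2) ((\<Sum>k\<in>S. \<Sum>k'\<in>S. c k k' ^ N) / m\<^sup>2)"
  proof -
    have "has_bochner_integral (iid N M) (\<lambda>x. (\<Sum>k\<in>S. \<Sum>k'\<in>S. R k x * R k' x) / m\<^sup>2) ((\<Sum>k\<in>S. \<Sum>k'\<in>S. c k k' ^ N) / m\<^sup>2)"
      by (intro has_bochner_integral_divide_zero has_bochner_integral_sum RR)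
    moreover have "(L x)\<^sup>2 = (\<Sum>k\<in>S. \<Sum>k'\<in>S. R k x * R k' x) / m\<^sup>2" for x
      by (simp add: L_def power_divide power2_eq_square sum_product)
    ultimately show ?thesis by simp
  qed
  define v where "v = (\<Sum>k\<in>S. \<Sum>k'\<in>S. c k k' ^ N) / m\<^sup>2"
  have v: "v - 1 < 1 / 9" using small by (simp add: v_def m_def)
  have Li: "integrable (iid N M) L" "integral\<^sup>L (iid N M) L = 1" "integrable (iid N M) (\<lambda>x. (L x)\<^sup>2)" "(\<integral>x. (L x)\<^sup>2 \<partial>iid N M) = v"
    using L1 L2 by (auto simp: has_bochner_integral_iff v_def)
  have fL: "integrable (iid N M) (\<lambda>x. L x * f x)" "2 / 3 \<le> (\<integral>x. L x * f x \<partial>iid N M)"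
  proof -
    have e: "L x * f x = (\<Sum>k\<in>S. R k x * f x) / m" for x by (simp add: L_def sum_distrib_right)
    show "integrable (iid N M) (\<lambda>x. L x * f x)" unfolding e using fR by auto
    have "(\<integral>x. L x * f x \<partial>iid N M) = (\<Sum>k\<in>S. \<integral>x. R k x * f x \<partial>iid N M) / m" unfolding e using fR by simp
    moreover have "(\<Sum>k\<in>S. 2 / 3) \<le> (\<Sum>k\<in>S. \<integral>x. R k x * f x \<partial>iid N M)" by (intro sum_mono alt')
    then have "2 / 3 * m \<le> (\<Sum>k\<in>S. \<integral>x. R k x * f x \<partial>iid N M)" by (simp add: m_def)
    ultimately show "2 / 3 \<le> (\<integral>x. L x * f x \<partial>iid N M)" using m by (simp only: pos_le_divide_eq)
  qed
  have "1 / 3 \<le> (\<integral>x. L x * f x \<partial>iid N M) - (\<integral>x. f x \<partial>iid N M)" using fL(2) Ef by linarith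
  also have "\<dots> = (\<integral>x. L x * f x - f x \<partial>iid N M)" using fL(1) fi by simp
  also have "\<dots> \<le> (\<integral>x. 1 / 6 + 3 / 2 * ((L x)\<^sup>2 - 2 * L x + 1) \<partial>iid N M)"
  proof (rule integral_mono)
    show "integrable (iid N M) (\<lambda>x. L x * f x - f x)" using fL(1) fi by simp
    show "integrable (iid N M) (\<lambda>x. 1 / 6 + 3 / 2 * ((L x)\<^sup>2 - 2 * L x + 1))" using Li by simp
    fix x assume x: "x \<in> space (iid N M)"
    have "L x * f x - f x \<le> \<bar>L x - 1\<bar> * f x"
      using f(2)[OF x] mult_right_mono[OF abs_ge_self[of "L x - 1"], of "f x"] by (simp add: algebra_simps)
    also have "\<dots> \<le> \<bar>L x - 1\<bar> * 1" using f(2)[OF x] by (intro mult_left_mono) auto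
    also have "\<dots> \<le> 1 / 6 + 3 / 2 * (L x - 1)\<^sup>2"
    proof -
      \<comment> \<open>Equality holds at a = 1/3, the gap between the two success probabilities.
        With second moment below 1 + 1/9 the right-hand side integrates to less than 1/6 + 1/6,
        contradicting the gap.\<close>
      have "a \<le> 1 / 6 + 3 / 2 * a\<^sup>2" for a :: real
        using zero_le_power2[of "3 * a - 1"] by (simp add: power2_eq_square field_simps)
      from this[of "\<bar>L x - 1\<bar>"] show ?thesis by simp
    qed
    finally show "L x * f x - f x \<le> 1 / 6 + 3 / 2 * ((L x)\<^sup>2 - 2 * L x + 1)" by (simp add: power2_diff algebra_simps)
  qed
  also have "\<dots> = 1 / 6 + 3 / 2 * (v - 1)" using Li by (simp add: P.prob_space)
  finally show False using v by argo
qed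

subsection \<open>Sign matrices\<close>

text \<open>The squared Frobenius norm of \<open>K\<^sup>T K'\<close> is the inner product of
  \<open>K K\<^sup>T\<close> and \<open>K' K'\<^sup>T\<close>.\<close>

lemma frob_sq_gram:
  "frob_sq I (gram J K K') = (\<Sum>j\<in>J. \<Sum>j'\<in>J. (\<Sum>i\<in>I. K j i * K j' i) * (\<Sum>i\<in>I. K' j i * K' j' i))"
proof -
  have "frob_sq I (gram J K K') = (\<Sum>i\<in>I. \<Sum>i'\<in>I. \<Sum>j\<in>J. \<Sum>j'\<in>J. (K j i * K j' i) * (K' j i' * K' j' i'))"
    unfolding frob_sq_def gram_def power2_eq_square sum_product by (simp add: mult_ac)
  also have "\<dots> = (\<Sum>i\<in>I. \<Sum>j\<in>J. \<Sum>i'\<in>I. \<Sum>j'\<in>J. (K j i * K j' i) * (K' j i' * K' j' i'))"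
    by (rule sum.cong[OF refl], rule sum.swap)
  also have "\<dots> = (\<Sum>j\<in>J. \<Sum>i\<in>I. \<Sum>i'\<in>I. \<Sum>j'\<in>J. (K j i * K j' i) * (K' j i' * K' j' i'))"
    by (rule sum.swap)
  also have "\<dots> = (\<Sum>j\<in>J. \<Sum>i\<in>I. \<Sum>j'\<in>J. \<Sum>i'\<in>I. (K j i * K j' i) * (K' j i' * K' j' i'))"
    by (rule sum.cong[OF refl], rule sum.cong[OF refl], rule sum.swap)
  also have "\<dots> = (\<Sum>j\<in>J. \<Sum>j'\<in>J. \<Sum>i\<in>I. \<Sum>i'\<in>I. (K j i * K j' i) * (K' j i' * K' j' i'))"
    by (rule sum.cong[OF refl], rule sum.swap)
  finally show ?thesis by (simp add: sum_product)
qed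

text \<open>By Cauchy-Schwarz in \<open>frob_sq_gram\<close>, a condition on single matrices
  controls all pairs. This allows the restriction to a set of good matrices.\<close>

lemma frob_sq_gram_le:
  assumes "frob_sq I (gram J K K) \<le> s\<^sup>2" "frob_sq I (gram J K' K') \<le> s\<^sup>2"
  shows "frob_sq I (gram J K K') \<le> s\<^sup>2"
proof -
  define G where "G K p = (\<Sum>i\<in>I. K (fst p) i * K (snd p) i)" for K :: "'a \<Rightarrow> 'a \<Rightarrow> real" and p
  have e: "frob_sq I (gram J K K') = (\<Sum>p\<in>J\<times>J. G K p * G K' p)" for K K'
    unfolding frob_sq_gram G_def by (simp add: sum.cartesian_product case_prod_beta)
  have "(frob_sq I (gram J K K'))\<^sup>2 \<le> frob_sq I (gram J K K) * frob_sq I (gram J K' K')"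
    unfolding e using Cauchy_Schwarz_ineq_sum[of "G K" "G K'" "J \<times> J"] by (simp add: power2_eq_square)
  also have "\<dots> \<le> s\<^sup>2 * s\<^sup>2" using assms by (intro mult_mono) (auto simp: frob_sq_nonneg)
  finally have "(frob_sq I (gram J K K'))\<^sup>2 \<le> (s\<^sup>2)\<^sup>2" by (simp add: power2_eq_square)
  then show ?thesis by (rule power2_le_imp_le) simp
qed

lemma sum_signs_flip:
  assumes k: "k \<in> A" and f: "\<And>\<sigma>. \<sigma> \<in> signs A \<Longrightarrow> f (\<sigma>(k := - \<sigma> k)) = - (f \<sigma> :: real)"
  shows "(\<Sum>\<sigma>\<in>signs A. f \<sigma>) = 0"
proof -
  define F :: "('a \<Rightarrow> real) \<Rightarrow> 'a \<Rightarrow> real" where "F \<sigma> = \<sigma>(k := - \<sigma> k)" for \<sigma>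
  have F: "F \<sigma> \<in> signs A" if "\<sigma> \<in> signs A" for \<sigma>
    using that k by (auto simp: F_def signs_def PiE_def Pi_def extensional_def)
  have FF: "F (F \<sigma>) = \<sigma>" for \<sigma> by (simp add: F_def)
  have "bij_betw F (signs A) (signs A)"
    by (rule bij_betw_byWitness[where f'=F]) (use F FF in auto)
  then have "(\<Sum>\<sigma>\<in>signs A. f (F \<sigma>)) = (\<Sum>\<sigma>\<in>signs A. f \<sigma>)" by (rule sum.reindex_bij_betw)
  moreover have "(\<Sum>\<sigma>\<in>signs A. f (F \<sigma>)) = - (\<Sum>\<sigma>\<in>signs A. f \<sigma>)"
    unfolding sum_negf[symmetric] F_def by (rule sum.cong[OF refl f])
  ultimately show ?thesis by simp
qed

lemma signs_square: "\<sigma> \<in> signs A \<Longrightarrow> a \<in> A \<Longrightarrow> \<sigma> a * \<sigma> a = 1"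
  by (auto simp: signs_def PiE_def Pi_def)

lemma signs_abs: "\<sigma> \<in> signs A \<Longrightarrow> a \<in> A \<Longrightarrow> \<bar>\<sigma> a\<bar> = 1"
  by (auto simp: signs_def PiE_def Pi_def)

locale sign_matrices =
  fixes I J :: "'i set"
  assumes I: "finite I" "I \<noteq> {}" and J: "finite J" "J \<noteq> {}"
begin

definition n :: real where "n = real (card I * card J)"

definition sgn_mat :: "('i \<times> 'i \<Rightarrow> real) \<Rightarrow> 'i \<Rightarrow> 'i \<Rightarrow> real" where
  "sgn_mat \<sigma> j i = \<sigma> (j, i) / sqrt n"

lemma n_pos: "0 < n"
  using I J by (simp add: n_def card_gt_0_iff)

lemma card_JI: "real (card (J \<times> I)) = n"
  by (simp add: n_def card_cartesian_product)

lemma gram_mat: "gram J (sgn_mat \<sigma>) (sgn_mat \<sigma>') i i' = (\<Sum>j\<in>J. \<sigma> (j, i) * \<sigma>' (j, i')) / n"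
  using n_pos by (simp add: gram_def sgn_mat_def sum_divide_distrib)

lemma mtrace_gram_mat: "mtrace I (gram J (sgn_mat \<sigma>) (sgn_mat \<sigma>')) = (\<Sum>a\<in>J \<times> I. \<sigma> a * \<sigma>' a) / n"
proof -
  have "mtrace I (gram J (sgn_mat \<sigma>) (sgn_mat \<sigma>')) = (\<Sum>i\<in>I. \<Sum>j\<in>J. \<sigma> (j, i) * \<sigma>' (j, i)) / n"
    unfolding mtrace_def gram_mat by (simp add: sum_divide_distrib)
  also have "(\<Sum>i\<in>I. \<Sum>j\<in>J. \<sigma> (j, i) * \<sigma>' (j, i)) = (\<Sum>j\<in>J. \<Sum>i\<in>I. \<sigma> (j, i) * \<sigma>' (j, i))" by (rule sum.swap)
  finally show ?thesis by (simp add: sum.cartesian_product case_prod_beta')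
qed

lemma mtrace_self: "\<sigma> \<in> signs (J \<times> I) \<Longrightarrow> mtrace I (gram J (sgn_mat \<sigma>) (sgn_mat \<sigma>)) = 1"
  unfolding mtrace_gram_mat using n_pos by (simp add: signs_square card_JI)

lemma sum_mat_square: "\<sigma> \<in> signs (J \<times> I) \<Longrightarrow> (\<Sum>j\<in>J. \<Sum>i\<in>I. (sgn_mat \<sigma> j i)\<^sup>2) = 1"
  using mtrace_self[of \<sigma>] sum.swap[of "\<lambda>j i. (sgn_mat \<sigma> j i)\<^sup>2" I J] by (simp add: mtrace_def gram_def power2_eq_square)

lemma abs_mtrace_le:
  assumes "\<sigma> \<in> signs (J \<times> I)" "\<sigma>' \<in> signs (J \<times> I)"
  shows "\<bar>mtrace I (gram J (sgn_mat \<sigma>) (sgn_mat \<sigma>'))\<bar> \<le> 1"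
proof -
  have "\<bar>\<Sum>a\<in>J \<times> I. \<sigma> a * \<sigma>' a\<bar> \<le> (\<Sum>a\<in>J \<times> I. 1)"
    using assms by (intro order_trans[OF sum_abs] sum_mono) (simp add: signs_abs abs_mult)
  then show ?thesis using n_pos by (simp add: mtrace_gram_mat card_JI)
qed

text \<open>With \<open>\<sigma>'\<close> held fixed, \<open>coeff1\<close> and
  \<open>coeff2\<close> are the coefficients of the squared trace and of the trace of the square of
  the overlap matrix, as quadratic forms in \<open>\<sigma>\<close> up to the factor
  \<open>n\<^sup>2\<close>. On sign matrices all of them have modulus 1.\<close>

definition coeff1 :: "('i \<times> 'i \<Rightarrow> real) \<Rightarrow> 'i \<times> 'i \<Rightarrow> 'i \<times> 'i \<Rightarrow> real" where
  "coeff1 \<sigma>' a b = \<sigma>' a * \<sigma>' b"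

definition coeff2 :: "('i \<times> 'i \<Rightarrow> real) \<Rightarrow> 'i \<times> 'i \<Rightarrow> 'i \<times> 'i \<Rightarrow> real" where
  "coeff2 \<sigma>' a b = \<sigma>' (fst a, snd b) * \<sigma>' (fst b, snd a)"

lemma mtrace_square_qform:
  "(mtrace I (gram J (sgn_mat \<sigma>) (sgn_mat \<sigma>')))\<^sup>2 = qform (J \<times> I) (coeff1 \<sigma>') \<sigma> / n\<^sup>2"
  unfolding mtrace_gram_mat power_divide coeff1_def qform_rank_one by (simp add: mult.commute)

lemma trace_square_qform:
  "(\<Sum>i\<in>I. \<Sum>i'\<in>I. gram J (sgn_mat \<sigma>) (sgn_mat \<sigma>') i i' * gram J (sgn_mat \<sigma>) (sgn_mat \<sigma>') i' i)
    = qform (J \<times> I) (coeff2 \<sigma>') \<sigma> / n\<^sup>2"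
proof -
  let ?t = "\<lambda>i i' j j'. \<sigma> (j, i) * \<sigma>' (j, i') * (\<sigma> (j', i') * \<sigma>' (j', i))"
  have "(\<Sum>i\<in>I. \<Sum>i'\<in>I. gram J (sgn_mat \<sigma>) (sgn_mat \<sigma>') i i' * gram J (sgn_mat \<sigma>) (sgn_mat \<sigma>') i' i)
    = (\<Sum>i\<in>I. \<Sum>i'\<in>I. \<Sum>j\<in>J. \<Sum>j'\<in>J. ?t i i' j j') / n\<^sup>2"
    unfolding gram_mat by (simp add: sum_product sum_divide_distrib power2_eq_square)
  also have "(\<Sum>i\<in>I. \<Sum>i'\<in>I. \<Sum>j\<in>J. \<Sum>j'\<in>J. ?t i i' j j') = (\<Sum>i\<in>I. \<Sum>j\<in>J. \<Sum>i'\<in>I. \<Sum>j'\<in>J. ?t i i' j j')"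
    by (rule sum.cong[OF refl], rule sum.swap)
  also have "\<dots> = (\<Sum>j\<in>J. \<Sum>i\<in>I. \<Sum>i'\<in>I. \<Sum>j'\<in>J. ?t i i' j j')" by (rule sum.swap)
  also have "\<dots> = (\<Sum>j\<in>J. \<Sum>i\<in>I. \<Sum>j'\<in>J. \<Sum>i'\<in>I. ?t i i' j j')"
    by (rule sum.cong[OF refl], rule sum.cong[OF refl], rule sum.swap)
  also have "\<dots> = (\<Sum>a\<in>J \<times> I. \<Sum>b\<in>J \<times> I. ?t (snd a) (snd b) (fst a) (fst b))"
    by (simp add: sum.cartesian_product')
  also have "\<dots> = qform (J \<times> I) (coeff2 \<sigma>') \<sigma>"
    unfolding qform_def coeff2_def by (intro sum.cong refl) (simp add: mult_ac)
  finally show ?thesis .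
qed

text \<open>A column paired with itself gives the square of \<open>card J\<close>, while distinct
  columns have inner products of mean square \<open>card J\<close>. Dividing the total by
  \<open>n\<^sup>2\<close> yields the two reciprocals.\<close>

lemma sum_frob_sq_gram_mat:
  "(\<Sum>\<sigma>\<in>signs (J \<times> I). frob_sq I (gram J (sgn_mat \<sigma>) (sgn_mat \<sigma>))) \<le> real (card (signs (J \<times> I))) * (1 / card I + 1 / card J)"
proof -
  let ?A = "J \<times> I"
  have each: "(\<Sum>\<sigma>\<in>signs ?A. (\<Sum>j\<in>J. \<sigma> (j, i) * \<sigma> (j, i'))\<^sup>2) \<le> real (card (signs ?A)) * ((if i = i' then (real (card J))\<^sup>2 else 0) + real (card J))"
    if i: "i \<in> I" "i' \<in> I" for i i'
  proof (cases "i = i'")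
    case True
    then have "(\<Sum>\<sigma>\<in>signs ?A. (\<Sum>j\<in>J. \<sigma> (j, i) * \<sigma> (j, i'))\<^sup>2) = (\<Sum>\<sigma>\<in>signs ?A. (real (card J))\<^sup>2)"
      using i by (intro sum.cong refl) (simp add: signs_square)
    then show ?thesis using True by (simp add: mult_left_mono)
  next
    case False
    have "(\<Sum>\<sigma>\<in>signs ?A. (\<Sum>j\<in>J. \<sigma> (j, i) * \<sigma> (j, i'))\<^sup>2)
      = (\<Sum>\<sigma>\<in>signs ?A. \<Sum>j\<in>J. \<Sum>j'\<in>J. \<sigma> (j, i) * \<sigma> (j, i') * (\<sigma> (j', i) * \<sigma> (j', i')))"
      by (simp add: power2_eq_square sum_product)
    also have "\<dots> = (\<Sum>j\<in>J. \<Sum>\<sigma>\<in>signs ?A. \<Sum>j'\<in>J. \<sigma> (j, i) * \<sigma> (j, i') * (\<sigma> (j', i) * \<sigma> (j', i')))" by (rule sum.swap)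
    also have "\<dots> = (\<Sum>j\<in>J. \<Sum>j'\<in>J. \<Sum>\<sigma>\<in>signs ?A. \<sigma> (j, i) * \<sigma> (j, i') * (\<sigma> (j', i) * \<sigma> (j', i')))"
      by (rule sum.cong[OF refl], rule sum.swap)
    also have "\<dots> = (\<Sum>j\<in>J. \<Sum>j'\<in>J. if j = j' then real (card (signs ?A)) else 0)"
    proof (intro sum.cong refl)
      fix j j' assume j: "j \<in> J" "j' \<in> J"
      show "(\<Sum>\<sigma>\<in>signs ?A. \<sigma> (j, i) * \<sigma> (j, i') * (\<sigma> (j', i) * \<sigma> (j', i'))) = (if j = j' then real (card (signs ?A)) else 0)"
      proof (cases "j = j'")
        case True
        have "\<sigma> (j, i) * \<sigma> (j, i') * (\<sigma> (j, i) * \<sigma> (j, i')) = 1" if "\<sigma> \<in> signs ?A" for \<sigma>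
        proof -
          have "\<sigma> (j, i) * \<sigma> (j, i') * (\<sigma> (j, i) * \<sigma> (j, i')) = (\<sigma> (j, i) * \<sigma> (j, i)) * (\<sigma> (j, i') * \<sigma> (j, i'))" by (simp add: mult_ac)
          then show ?thesis using signs_square[OF that, of "(j, i)"] signs_square[OF that, of "(j, i')"] i j by simp
        qed
        then show ?thesis using True by simp
      next
        case False
        \<comment> \<open>For distinct rows and distinct columns the four entries are different, so
          flipping the sign at \<open>(j, i)\<close> reverses the summand.\<close>
        have "(\<Sum>\<sigma>\<in>signs ?A. \<sigma> (j, i) * \<sigma> (j, i') * (\<sigma> (j', i) * \<sigma> (j', i'))) = 0"
          by (rule sum_signs_flip[of "(j, i)"]) (use i j False \<open>i \<noteq> i'\<close> in auto)
        then show ?thesis using False by simp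
      qed
    qed
    also have "\<dots> = real (card (signs ?A)) * real (card J)" using J by simp
    finally show ?thesis using False by simp
  qed
  have "(\<Sum>\<sigma>\<in>signs ?A. frob_sq I (gram J (sgn_mat \<sigma>) (sgn_mat \<sigma>))) = (\<Sum>\<sigma>\<in>signs ?A. \<Sum>i\<in>I. \<Sum>i'\<in>I. (\<Sum>j\<in>J. \<sigma> (j, i) * \<sigma> (j, i'))\<^sup>2) / n\<^sup>2"
    unfolding frob_sq_def gram_mat power_divide sum_divide_distrib[symmetric] ..
  also have "(\<Sum>\<sigma>\<in>signs ?A. \<Sum>i\<in>I. \<Sum>i'\<in>I. (\<Sum>j\<in>J. \<sigma> (j, i) * \<sigma> (j, i'))\<^sup>2)
      = (\<Sum>i\<in>I. \<Sum>\<sigma>\<in>signs ?A. \<Sum>i'\<in>I. (\<Sum>j\<in>J. \<sigma> (j, i) * \<sigma> (j, i'))\<^sup>2)" by (rule sum.swap)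
  also have "\<dots> = (\<Sum>i\<in>I. \<Sum>i'\<in>I. \<Sum>\<sigma>\<in>signs ?A. (\<Sum>j\<in>J. \<sigma> (j, i) * \<sigma> (j, i'))\<^sup>2)"
    by (rule sum.cong[OF refl], rule sum.swap)
  also have "\<dots> \<le> (\<Sum>i\<in>I. \<Sum>i'\<in>I. real (card (signs ?A)) * ((if i = i' then (real (card J))\<^sup>2 else 0) + real (card J)))"
    by (intro sum_mono each)
  also have "\<dots> = real (card (signs ?A)) * (real (card I) * (real (card J))\<^sup>2 + (real (card I))\<^sup>2 * real (card J))"
    using I by (simp add: sum_distrib_left[symmetric] sum.distrib power2_eq_square algebra_simps)
  finally have "(\<Sum>\<sigma>\<in>signs ?A. frob_sq I (gram J (sgn_mat \<sigma>) (sgn_mat \<sigma>))) \<le> real (card (signs ?A)) * (real (card I) * (real (card J))\<^sup>2 + (real (card I))\<^sup>2 * real (card J)) / n\<^sup>2"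
    by (simp add: divide_right_mono)
  also have "\<dots> = real (card (signs ?A)) * (1 / card I + 1 / card J)"
    using I J by (simp add: n_def power2_eq_square field_simps card_eq_0_iff)
  finally show ?thesis .
qed

text \<open>Its square is twice the bound on the average in \<open>sum_frob_sq_gram_mat\<close>, so
  Markov's inequality leaves at least half of all sign matrices in \<open>good\<close>. For halves
  of size d/2 it is of order d^(-1/2).\<close>

definition radius :: real where "radius = sqrt (2 * (1 / card I + 1 / card J))"

definition good :: "('i \<times> 'i \<Rightarrow> real) set" where
  "good = {\<sigma> \<in> signs (J \<times> I). frob_sq I (gram J (sgn_mat \<sigma>) (sgn_mat \<sigma>)) \<le> radius\<^sup>2}"

lemma radius: "0 < radius" "radius\<^sup>2 = 2 * (1 / card I + 1 / card J)"
  using I J by (simp_all add: radius_def card_gt_0_iff add_pos_pos)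

lemma finite_good: "finite good"
  using I J by (simp add: good_def finite_signs)

lemma card_good: "real (card (signs (J \<times> I))) \<le> 2 * real (card good)"
proof -
  let ?S = "signs (J \<times> I)"
  let ?F = "\<lambda>\<sigma>. frob_sq I (gram J (sgn_mat \<sigma>) (sgn_mat \<sigma>))"
  have fin: "finite ?S" using I J by (simp add: finite_signs)
  have "(\<Sum>\<sigma>\<in>?S - good. radius\<^sup>2) \<le> (\<Sum>\<sigma>\<in>?S - good. ?F \<sigma>)"
    by (intro sum_mono) (auto simp: good_def)
  also have "\<dots> \<le> (\<Sum>\<sigma>\<in>?S. ?F \<sigma>)" using fin by (intro sum_mono2) (auto simp: frob_sq_nonneg)
  also have "\<dots> \<le> real (card ?S) * (radius\<^sup>2 / 2)" 
  proof -
    have "radius\<^sup>2 / 2 = 1 / card I + 1 / card J" by (simp add: radius)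
    then show ?thesis using sum_frob_sq_gram_mat by (simp only:)
  qed
  finally have "real (card (?S - good)) * radius\<^sup>2 \<le> real (card ?S) / 2 * radius\<^sup>2" by simp
  then have "real (card (?S - good)) \<le> real (card ?S) / 2" using radius(1) by (simp only: mult_le_cancel_right zero_less_power)
  moreover have "card (?S - good) = card ?S - card good"
    by (rule card_Diff_subset[OF finite_good]) (auto simp: good_def)
  moreover have "card good \<le> card ?S" using fin by (intro card_mono) (auto simp: good_def)
  ultimately show ?thesis by (simp add: of_nat_diff)
qed

text \<open>There are \<open>n\<^sup>2\<close> entries of modulus at most
  \<open>1 / (16 * n)\<close>, which gives squared Frobenius norm at most 1/256, the threshold of
  \<open>sum_signs_exp_qform\<close>, and trace at most 1/16. Treating the form and its negative
  separately doubles the bound from 2 to 4.\<close>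

lemma sum_signs_exp_abs_qform:
  assumes sym: "\<And>a b. M a b = M b a" and M: "\<And>a b. a \<in> J \<times> I \<Longrightarrow> b \<in> J \<times> I \<Longrightarrow> \<bar>M a b\<bar> \<le> 1 / (16 * n)"
  shows "(\<Sum>\<sigma>\<in>signs (J \<times> I). exp \<bar>qform (J \<times> I) M \<sigma>\<bar>) \<le> 4 * real (card (signs (J \<times> I)))"
proof -
  let ?A = "J \<times> I"
  have fin: "finite ?A" using I J by simp
  have one: "(\<Sum>\<sigma>\<in>signs ?A. exp (qform ?A M' \<sigma>)) \<le> 2 * real (card (signs ?A))"
    if sym: "\<And>a b. M' a b = M' b a" and M': "\<And>a b. a \<in> ?A \<Longrightarrow> b \<in> ?A \<Longrightarrow> \<bar>M' a b\<bar> \<le> 1 / (16 * n)" for M'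
  proof -
    have "mtrace ?A M' \<le> (\<Sum>a\<in>?A. 1 / (16 * n))"
      unfolding mtrace_def using M' by (intro sum_mono) (simp add: abs_le_D1)
    also have "\<dots> = 1 / 16" using n_pos by (simp add: card_JI)
    finally have t: "mtrace ?A M' \<le> 1 / 16" .
    have "frob_sq ?A M' \<le> (\<Sum>a\<in>?A. \<Sum>b\<in>?A. (1 / (16 * n))\<^sup>2)"
      unfolding frob_sq_def
    proof (intro sum_mono)
      fix a b assume "a \<in> ?A" "b \<in> ?A"
      from power_mono[OF M'[OF this], of 2] show "(M' a b)\<^sup>2 \<le> (1 / (16 * n))\<^sup>2" by simp
    qed
    also have "\<dots> = 1 / 256" using n_pos by (simp add: card_JI power2_eq_square)
    finally have f: "frob_sq ?A M' \<le> 1 / 256" .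
    have "(\<Sum>\<sigma>\<in>signs ?A. exp (qform ?A M' \<sigma>)) \<le> 2 ^ card ?A * exp (mtrace ?A M' + 4 * frob_sq ?A M')"
      by (rule sum_signs_exp_qform[OF fin sym f])
    also have "\<dots> \<le> 2 ^ card ?A * exp (1 / 2)" using t f by (intro mult_left_mono) auto
    also have "\<dots> \<le> 2 ^ card ?A * 2" using exp_half_le2 by (intro mult_left_mono) auto
    also have "\<dots> = 2 * real (card (signs ?A))" using card_signs[OF fin] by simp
    finally show ?thesis .
  qed
  have "(\<Sum>\<sigma>\<in>signs ?A. exp \<bar>qform ?A M \<sigma>\<bar>) \<le> (\<Sum>\<sigma>\<in>signs ?A. exp (qform ?A M \<sigma>) + exp (qform ?A (\<lambda>a b. - 1 * M a b) \<sigma>))"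
    unfolding qform_scale by (intro sum_mono) (auto simp: abs_if)
  also have "\<dots> \<le> 2 * real (card (signs ?A)) + 2 * real (card (signs ?A))"
    unfolding sum.distrib by (intro add_mono one) (use sym M in auto)
  finally show ?thesis by simp
qed

end

section \<open>Averaging the powers of the correlation\<close>

lemma exp_scale_le:
  fixes x g :: real
  assumes "0 \<le> g" "g \<le> 1"
  shows "exp (g * x) \<le> 1 + g * (exp x - 1)"
proof -
  have "exp ((1 - g) *\<^sub>R 0 + g *\<^sub>R x) \<le> (1 - g) * exp 0 + g * exp x"
    using assms by (intro convex_onD[OF exp_convex]) auto
  then show ?thesis by (simp add: algebra_simps)
qed

text \<open>From \<open>overlap \<le> 1 + W \<le> exp W\<close> the \<open>N\<close>-th power is at
  most \<open>exp (real N * W)\<close>. For fixed \<open>\<sigma>'\<close> the exponent is a small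
  multiple of a quadratic form in \<open>\<sigma>\<close> plus a small constant, and the exponential
  moment of that form is bounded uniformly in \<open>\<sigma>'\<close>.\<close>

lemma (in contaminated_model) overlap_power_sum:
  assumes ne: "I \<noteq> {}" "J \<noteq> {}"
  defines "s \<equiv> sign_matrices.radius I J" and "m \<equiv> sign_matrices.n I J" and "G \<equiv> sign_matrices.good I J"
  defines "X \<equiv> sign_matrices.sgn_mat I J"
  assumes small: "32 * l\<^sup>2 * s \<le> 1" "8 * \<tau> * s \<le> 1"
    and N: "real N * (16 * (T\<^sup>2 + C_exp + C_rest + 1)) / m \<le> 1 / 500" "real N * (C_exp + C_rest) * s ^ 4 \<le> 1 / 500"
  shows "G \<noteq> {}" "finite G"
    and "\<And>\<sigma>. \<sigma> \<in> G \<Longrightarrow> gibbs_matrix I \<tau> (gram J (X \<sigma>) (X \<sigma>)) s"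
    and "\<And>\<sigma>. \<sigma> \<in> G \<Longrightarrow> (\<Sum>j\<in>J. \<Sum>i\<in>I. (X \<sigma> j i)\<^sup>2) = 1"
    and "\<And>\<sigma> \<sigma>'. \<sigma> \<in> G \<Longrightarrow> \<sigma>' \<in> G \<Longrightarrow> has_bochner_integral (gauss (I \<union> J)) (\<lambda>x. rho (X \<sigma>) x * rho (X \<sigma>') x)
        (overlap I (gram J (X \<sigma>) (X \<sigma>')) (gram J (X \<sigma>) (X \<sigma>)) (gram J (X \<sigma>') (X \<sigma>')))"
    and "(\<Sum>\<sigma>\<in>G. \<Sum>\<sigma>'\<in>G. overlap I (gram J (X \<sigma>) (X \<sigma>')) (gram J (X \<sigma>) (X \<sigma>)) (gram J (X \<sigma>') (X \<sigma>')) ^ N)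
        / (real (card G))\<^sup>2 - 1 < 1 / 9"
proof -
  interpret S: sign_matrices I J by standard (use I J ne in auto)
  note [simp] = s_def m_def G_def X_def
  let ?S = "signs (J \<times> I)"
  have GS: "\<sigma> \<in> ?S" "frob_sq I (gram J (X \<sigma>) (X \<sigma>)) \<le> s\<^sup>2" if "\<sigma> \<in> G" for \<sigma>
    using that by (auto simp: S.good_def)
  have finS: "finite ?S" using I J by (simp add: finite_signs)
  have cS: "0 < card ?S" using I J by (simp add: card_signs)
  have cG: "0 < card G" using S.card_good cS by (cases "card G = 0") auto
  then show "G \<noteq> {}" by auto
  show finG: "finite G" by (simp add: S.finite_good)
  have s0: "0 < s" by (simp add: S.radius)
  show gm: "gibbs_matrix I \<tau> (gram J (X \<sigma>) (X \<sigma>)) s" if "\<sigma> \<in> G" for \<sigma>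
  proof
    show "0 \<le> qform I (gram J (X \<sigma>) (X \<sigma>)) h" for h by (simp add: qform_gram sum_nonneg)
    show "gram J (X \<sigma>) (X \<sigma>) i j = gram J (X \<sigma>) (X \<sigma>) j i" for i j by (rule gram_commute)
    show "mtrace I (gram J (X \<sigma>) (X \<sigma>)) = 1" using S.mtrace_self[OF GS(1)[OF that]] by simp
  qed (use I \<tau> GS[OF that] in auto)
  show "(\<Sum>j\<in>J. \<Sum>i\<in>I. (X \<sigma> j i)\<^sup>2) = 1" if "\<sigma> \<in> G" for \<sigma>
    using S.sum_mat_square[OF GS(1)[OF that]] by simp
  define ov where "ov \<sigma> \<sigma>' = overlap I (gram J (X \<sigma>) (X \<sigma>')) (gram J (X \<sigma>) (X \<sigma>)) (gram J (X \<sigma>') (X \<sigma>'))" for \<sigma> \<sigma>'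
  have frob: "frob_sq I (gram J (X \<sigma>) (X \<sigma>')) \<le> s\<^sup>2" if "\<sigma> \<in> G" "\<sigma>' \<in> G" for \<sigma> \<sigma>'
    by (rule frob_sq_gram_le[OF GS(2)[OF that(1)] GS(2)[OF that(2)]])
  have trace: "\<bar>mtrace I (gram J (X \<sigma>) (X \<sigma>'))\<bar> \<le> 1" if "\<sigma> \<in> G" "\<sigma>' \<in> G" for \<sigma> \<sigma>'
    using S.abs_mtrace_le[OF GS(1)[OF that(1)] GS(1)[OF that(2)]] by simp
  show hb: "has_bochner_integral (gauss (I \<union> J)) (\<lambda>x. rho (X \<sigma>) x * rho (X \<sigma>') x)
        (overlap I (gram J (X \<sigma>) (X \<sigma>')) (gram J (X \<sigma>) (X \<sigma>)) (gram J (X \<sigma>') (X \<sigma>')))" if "\<sigma> \<in> G" "\<sigma>' \<in> G" for \<sigma> \<sigma>'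
    by (rule has_integral_rho_rho[OF gm[OF that(1)] gm[OF that(2)] s0 frob[OF that] trace[OF that] small])
  define C where "C = C_exp + C_rest"
  define D where "D = T\<^sup>2 + C + 1"
  have C0: "0 \<le> C" "0 < D" using C_nonneg zero_le_power2[of T] by (simp_all add: C_def D_def add_nonneg_pos)
  have m0: "0 < m" by (simp add: S.n_pos)
  define M where "M \<sigma>' a b = (T\<^sup>2 / 2 + C) * S.coeff1 \<sigma>' a b + T\<^sup>2 / 2 * S.coeff2 \<sigma>' a b" for \<sigma>' a b
  \<comment> \<open>The entries of \<open>M\<close> are at most \<open>D\<close> in modulus, so this
    scaling meets the hypothesis of \<open>sum_signs_exp_abs_qform\<close>; the factor
    \<open>16 * D * m\<close> reappears in the first bound on \<open>N\<close>.\<close>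
  define M0 where "M0 \<sigma>' a b = 1 / (16 * D * m) * M \<sigma>' a b" for \<sigma>' a b
  have Mq: "qform (J \<times> I) (M \<sigma>') \<sigma> = (T\<^sup>2 / 2 + C) * qform (J \<times> I) (S.coeff1 \<sigma>') \<sigma> + T\<^sup>2 / 2 * qform (J \<times> I) (S.coeff2 \<sigma>') \<sigma>" for \<sigma> \<sigma>'
    unfolding qform_scale[symmetric] unfolding qform_def M_def sum.distrib[symmetric] by (simp add: algebra_simps)
  have q0: "qform (J \<times> I) (M \<sigma>') \<sigma> = 16 * D * m * qform (J \<times> I) (M0 \<sigma>') \<sigma>" for \<sigma> \<sigma>'
    unfolding M0_def[abs_def] qform_scale using C0 m0 by simp
  have M0: "(\<Sum>\<sigma>\<in>?S. exp \<bar>qform (J \<times> I) (M0 \<sigma>') \<sigma>\<bar>) \<le> 4 * real (card ?S)" if "\<sigma>' \<in> G" for \<sigma>'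
  proof (rule S.sum_signs_exp_abs_qform)
    show "M0 \<sigma>' a b = M0 \<sigma>' b a" for a b
      by (simp add: M0_def M_def S.coeff1_def S.coeff2_def mult.commute)
    fix a b assume ab: "a \<in> J \<times> I" "b \<in> J \<times> I"
    have "\<bar>S.coeff1 \<sigma>' a b\<bar> = 1" "\<bar>S.coeff2 \<sigma>' a b\<bar> = 1"
      using ab signs_abs[OF GS(1)[OF that]] by (auto simp: S.coeff1_def S.coeff2_def abs_mult)
    then have "\<bar>M \<sigma>' a b\<bar> \<le> (T\<^sup>2 / 2 + C) + T\<^sup>2 / 2"
      unfolding M_def using C0 by (intro order_trans[OF abs_triangle_ineq]) (simp add: abs_mult)
    then have "\<bar>M \<sigma>' a b\<bar> \<le> D" by (simp add: D_def)
    then have "1 / (16 * D * m) * \<bar>M \<sigma>' a b\<bar> \<le> 1 / (16 * D * m) * D"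
      using C0 m0 by (intro mult_left_mono) auto
    then show "\<bar>M0 \<sigma>' a b\<bar> \<le> 1 / (16 * S.n)"
      using C0 m0 by (simp add: M0_def abs_mult)
  qed
  have pw: "ov \<sigma> \<sigma>' ^ N \<le> 1 + 3 / 500 * exp \<bar>qform (J \<times> I) (M0 \<sigma>') \<sigma>\<bar>" if "\<sigma> \<in> G" "\<sigma>' \<in> G" for \<sigma> \<sigma>'
  proof -
    define q where "q = qform (J \<times> I) (M0 \<sigma>') \<sigma>"
    define P where "P = gram J (X \<sigma>) (X \<sigma>')"
    define W where "W = T\<^sup>2 / 2 * ((mtrace I P)\<^sup>2 + (\<Sum>i\<in>I. \<Sum>j\<in>I. P i j * P j i)) + C * ((mtrace I P)\<^sup>2 + s ^ 4)"
    have "ov \<sigma> \<sigma>' \<le> 1 + W"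
      unfolding ov_def W_def P_def C_def
      using overlap_le[OF gm[OF that(1)] gm[OF that(2)] s0 frob[OF that] trace[OF that] small] by simp
    also have "\<dots> \<le> exp W" by (rule exp_ge_add_one_self)
    finally have "ov \<sigma> \<sigma>' \<le> exp W" .
    \<comment> \<open>Raising an upper bound to the \<open>N\<close>-th power requires a nonnegative
      base; it is the integral of a product of two nonnegative likelihood ratios.\<close>
    moreover have "0 \<le> ov \<sigma> \<sigma>'"
      unfolding ov_def has_bochner_integral_integral_eq[OF hb[OF that], symmetric]
      by (intro Bochner_Integration.integral_nonneg mult_nonneg_nonneg rho_nonneg)
    ultimately have "ov \<sigma> \<sigma>' ^ N \<le> exp W ^ N" by (intro power_mono)
    also have "\<dots> = exp (real N * W)" by (simp add: exp_of_nat_mult)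
    also have "real N * W \<le> 1 / 500 * (\<bar>q\<bar> + 1)"
    proof -
      have "W = (T\<^sup>2 / 2 + C) * (mtrace I P)\<^sup>2 + T\<^sup>2 / 2 * (\<Sum>i\<in>I. \<Sum>j\<in>I. P i j * P j i) + C * s ^ 4"
        by (simp add: W_def algebra_simps)
      also have "\<dots> = qform (J \<times> I) (M \<sigma>') \<sigma> / m\<^sup>2 + C * s ^ 4"
        unfolding P_def X_def S.mtrace_square_qform S.trace_square_qform Mq by (simp add: add_divide_distrib)
      also have "\<dots> = (16 * D) / m * q + C * s ^ 4"
        unfolding q0 q_def using m0 by (simp add: power2_eq_square)
      finally have "real N * W = real N * (16 * D) / m * q + real N * C * s ^ 4" by (simp add: algebra_simps)
      also have "\<dots> \<le> real N * (16 * D) / m * \<bar>q\<bar> + real N * C * s ^ 4"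
        using C0 m0 by (intro add_right_mono mult_left_mono) auto
      also have "\<dots> \<le> 1 / 500 * \<bar>q\<bar> + 1 / 500"
        using N by (intro add_mono mult_right_mono) (auto simp: C_def D_def add.assoc)
      finally show ?thesis by (simp add: algebra_simps)
    qed
    then have "exp (real N * W) \<le> exp (1 / 500 * (\<bar>q\<bar> + 1))" by simp
    \<comment> \<open>Convexity moves the small factor from the exponent to the front, so that one
      bounded exponential moment yields a deviation of order 1/500.\<close>
    also have "\<dots> \<le> 1 + 1 / 500 * (exp (\<bar>q\<bar> + 1) - 1)" by (rule exp_scale_le) auto
    also have "\<dots> \<le> 1 + 1 / 500 * (3 * exp \<bar>q\<bar>)"
    proof -
      have "exp \<bar>q\<bar> * exp 1 \<le> exp \<bar>q\<bar> * 3" using exp_le by (intro mult_left_mono) auto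
      then show ?thesis unfolding exp_add by argo
    qed
    finally show ?thesis by (simp add: q_def)
  qed
  have "(\<Sum>\<sigma>\<in>G. \<Sum>\<sigma>'\<in>G. ov \<sigma> \<sigma>' ^ N) \<le> (\<Sum>\<sigma>\<in>G. \<Sum>\<sigma>'\<in>G. 1 + 3 / 500 * exp \<bar>qform (J \<times> I) (M0 \<sigma>') \<sigma>\<bar>)"
    by (intro sum_mono pw)
  also have "\<dots> = (real (card G))\<^sup>2 + 3 / 500 * (\<Sum>\<sigma>'\<in>G. \<Sum>\<sigma>\<in>G. exp \<bar>qform (J \<times> I) (M0 \<sigma>') \<sigma>\<bar>)"
    unfolding sum.distrib sum_distrib_left[symmetric]
    by (subst (2) sum.swap) (simp add: power2_eq_square)
  also have "\<dots> \<le> (real (card G))\<^sup>2 + 3 / 500 * (real (card G) * (8 * real (card G)))"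
  proof (intro add_left_mono mult_left_mono)
    have "(\<Sum>\<sigma>'\<in>G. \<Sum>\<sigma>\<in>G. exp \<bar>qform (J \<times> I) (M0 \<sigma>') \<sigma>\<bar>) \<le> (\<Sum>\<sigma>'\<in>G. 8 * real (card G))"
    proof (rule sum_mono)
      fix \<sigma>' assume g: "\<sigma>' \<in> G"
      \<comment> \<open>The exponential moment is known for the uniform distribution on all signs.
        Restricting to good ones costs a factor 2, since they make up at least half.\<close>
      have "(\<Sum>\<sigma>\<in>G. exp \<bar>qform (J \<times> I) (M0 \<sigma>') \<sigma>\<bar>) \<le> (\<Sum>\<sigma>\<in>?S. exp \<bar>qform (J \<times> I) (M0 \<sigma>') \<sigma>\<bar>)"
        using finS GS(1) by (intro sum_mono2) auto
      also have "\<dots> \<le> 4 * real (card ?S)" by (rule M0[OF g])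
      also have "\<dots> \<le> 8 * real (card G)" using S.card_good by simp
      finally show "(\<Sum>\<sigma>\<in>G. exp \<bar>qform (J \<times> I) (M0 \<sigma>') \<sigma>\<bar>) \<le> 8 * real (card G)" .
    qed
    then show "(\<Sum>\<sigma>'\<in>G. \<Sum>\<sigma>\<in>G. exp \<bar>qform (J \<times> I) (M0 \<sigma>') \<sigma>\<bar>) \<le> real (card G) * (8 * real (card G))" by simp
  qed auto
  \<comment> \<open>Here 24 is 3 times 8, and 500 is chosen such that 24/500 stays below the 1/9
    demanded by \<open>second_moment_test\<close>.\<close>
  also have "\<dots> = (1 + 24 / 500) * (real (card G))\<^sup>2" by (simp add: power2_eq_square)
  finally have "(\<Sum>\<sigma>\<in>G. \<Sum>\<sigma>'\<in>G. ov \<sigma> \<sigma>' ^ N) / (real (card G))\<^sup>2 \<le> 1 + 24 / 500"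
    using cG by (subst pos_divide_le_eq) auto
  then show "(\<Sum>\<sigma>\<in>G. \<Sum>\<sigma>'\<in>G. overlap I (gram J (X \<sigma>) (X \<sigma>')) (gram J (X \<sigma>) (X \<sigma>)) (gram J (X \<sigma>') (X \<sigma>')) ^ N)
        / (real (card G))\<^sup>2 - 1 < 1 / 9"
    by (simp add: ov_def)
qed

text \<open>The atoms \<open>1\<close> (the Gaussian itself), \<open>- a\<close> and \<open>2 a\<close> with \<open>a = 3 / \<epsilon>\<close>: the two latter
  weights solve the linear system for vanishing first and third moments.\<close>
lemma exists_test_weights:
  fixes \<epsilon> :: real
  assumes \<epsilon>: "0 < \<epsilon>" "\<epsilon> \<le> 1 / 2"
  shows "\<exists>A p \<delta> \<tau> T l. test_weights A p \<delta> \<tau> T l \<and> 1 \<in> A \<and> p 1 = 1 - \<epsilon>"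
proof -
  define a where "a = 3 / \<epsilon>"
  \<comment> \<open>The first-moment equation yields the formula for \<open>q\<close> below;
    inserted into the third-moment equation
    \<open>(1 - \<epsilon>) - a ^ 3 * q + 8 * a ^ 3 * r = 0\<close> it leaves
    \<open>6 * a ^ 3 * r = (1 - \<epsilon>) * (a\<^sup>2 - 1)\<close>.\<close>
  define r where "r = (1 - \<epsilon>) * (a\<^sup>2 - 1) / (6 * a ^ 3)"
  define q where "q = (1 - \<epsilon>) / a + 2 * r"
  define A where "A = {1, - a, 2 * a}"
  define p where "p t = (if t = 1 then 1 - \<epsilon> else if t = - a then q else r)" for t
  define \<delta> where "\<delta> = \<epsilon> - q - r"
  have a: "6 \<le> a" using \<epsilon> by (simp add: a_def field_simps)
  have a\<epsilon>: "a * \<epsilon> = 3" using \<epsilon> by (simp add: a_def)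
  have a2: "1 \<le> a\<^sup>2" using a power_mono[of 1 a 2] by simp
  have ne: "1 \<noteq> - a" "1 \<noteq> 2 * a" "- a \<noteq> 2 * a" using a by auto
  have r0: "0 \<le> r" unfolding r_def using \<epsilon> a a2 by (intro divide_nonneg_nonneg mult_nonneg_nonneg) auto
  have q0: "0 \<le> q" unfolding q_def using r0 \<epsilon> a by (intro add_nonneg_nonneg divide_nonneg_nonneg) auto
  have S: "(\<Sum>t\<in>A. f t) = f 1 + f (- a) + f (2 * a)" for f :: "real \<Rightarrow> real"
    using ne by (simp add: A_def)
  have pv: "p 1 = 1 - \<epsilon>" "p (- a) = q" "p (2 * a) = r" using ne by (auto simp: p_def)
  have \<delta>: "0 < \<delta>"
  proof -
    have "r \<le> 1 / (6 * a)"
    proof -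
      have "(1 - \<epsilon>) * (a\<^sup>2 - 1) \<le> 1 * a\<^sup>2" using \<epsilon> a2 by (intro mult_mono) auto
      then have "r \<le> a\<^sup>2 / (6 * a ^ 3)" unfolding r_def using a by (intro divide_right_mono) auto
      also have "\<dots> = 1 / (6 * a)" using a by (simp add: power2_eq_square eval_nat_numeral)
      finally show ?thesis .
    qed
    moreover have "(1 - \<epsilon>) / a \<le> 1 / a" using \<epsilon> a by (intro divide_right_mono) auto
    moreover have "1 / a = \<epsilon> / 3" using \<epsilon> by (simp add: a_def)
    moreover have "1 / (6 * a) = \<epsilon> / 18" using \<epsilon> by (simp add: a_def)
    \<comment> \<open>The right-hand side is \<open>\<epsilon> / 2\<close>: with
      \<open>a = 3 / \<epsilon>\<close> the two extra atoms use at most half of the contamination,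
      and at least half is left for the compensating component.\<close>
    ultimately have "q + r \<le> \<epsilon> / 3 + 3 * (\<epsilon> / 18)" unfolding q_def by linarith
    then show ?thesis using \<epsilon> by (simp add: \<delta>_def)
  qed
  define T where "T = (\<Sum>t\<in>A. p t * t\<^sup>2)"
  have T0: "0 \<le> T" unfolding T_def S pv using \<epsilon> q0 r0 by (intro add_nonneg_nonneg mult_nonneg_nonneg) auto
  have "test_weights A p \<delta> (T / \<delta>) T (2 * a)"
  proof
    show "finite A" by (simp add: A_def)
    show "0 \<le> p t" if "t \<in> A" for t using q0 r0 \<epsilon> by (auto simp: p_def)
    show "0 < \<delta>" "0 \<le> T / \<delta>" "\<delta> * (T / \<delta>) = T" using \<delta> T0 by auto
    show "(\<Sum>t\<in>A. p t) = 1 - \<delta>" unfolding S pv by (simp add: \<delta>_def)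
    show "(\<Sum>t\<in>A. p t * t) = 0" unfolding S pv q_def using a by (simp add: field_simps)
    show "(\<Sum>t\<in>A. p t * t ^ 3) = 0"
    proof -
      have "6 * a ^ 3 * r = (1 - \<epsilon>) * (a\<^sup>2 - 1)" using a by (simp add: r_def)
      moreover have "q * a ^ 3 = (1 - \<epsilon>) * a\<^sup>2 + 2 * r * a ^ 3" using a by (simp add: q_def field_simps eval_nat_numeral)
      ultimately show ?thesis unfolding S pv by (simp add: power_mult_distrib algebra_simps)
    qed
    show "\<bar>t\<bar> \<le> 2 * a" if "t \<in> A" for t using that a by (auto simp: A_def)
  qed (simp add: T_def)
  moreover have "1 \<in> A" by (simp add: A_def)
  ultimately show ?thesis using pv(1) by blast
qed

section \<open>Splitting the coordinates and fixing the constants\<close>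

lemma half_split_bounds:
  fixes d :: nat
  assumes d: "5 \<le> d"
  defines "m \<equiv> real (d div 2)"
  shows "0 < m" "0 < real d - m" "(real d)\<^sup>2 / 5 \<le> m * (real d - m)"
    "2 * (1 / m + 1 / (real d - m)) = 2 * real d / (m * (real d - m))"
proof -
  have m: "real d - 1 \<le> 2 * m" "2 * m \<le> real d" unfolding m_def by linarith+
  show 1: "0 < m" "0 < real d - m" using m d by auto
  \<comment> \<open>An odd dimension splits unevenly; from dimension 5 on the loss is covered by
    writing 5 instead of 4.\<close>
  have "(real d)\<^sup>2 / 5 \<le> (real d - 1) / 2 * (real d / 2)"
  proof -
    have "real d * 5 \<le> real d * real d" using d by (intro mult_left_mono) auto
    then show ?thesis by (simp add: power2_eq_square field_simps)
  qed
  also have "\<dots> \<le> m * (real d - m)" using m d by (intro mult_mono) auto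
  finally show "(real d)\<^sup>2 / 5 \<le> m * (real d - m)" .
  show "2 * (1 / m + 1 / (real d - m)) = 2 * real d / (m * (real d - m))"
    using 1 by (simp add: field_simps)
qed

theorem theorem1:
  shows "\<exists>\<epsilon>0 :: real. \<epsilon>0 > 0 \<and>
    (\<forall>\<epsilon>. 0 < \<epsilon> \<and> \<epsilon> \<le> \<epsilon>0 \<longrightarrow>
      (\<exists>c :: real. c > 0 \<and> (\<exists>d0 :: nat.
        \<forall>d N. d \<ge> d0 \<and> real N \<le> c * (real d)\<^sup>2 \<longrightarrow>
        (\<forall>f :: (nat \<Rightarrow> nat \<Rightarrow> real) \<Rightarrow> real.
           f \<in> borel_measurable (iid N (Rd d)) \<and>
           (\<forall>x \<in> space (iid N (Rd d)). 0 \<le> f x \<and> f x \<le> 1) \<longrightarrow>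
           \<not> ((\<integral>x. (1 - f x) \<partial>(iid N (std_gaussian d))) \<ge> 2/3 \<and>
              (\<forall>S B. sym_pos_def d S \<and> frob_dist_id d S > 1/2 \<and>
                     prob_space B \<and> sets B = sets (Rd d) \<longrightarrow>
                     (\<integral>x. f x \<partial>(iid N (mixture \<epsilon> (gaussian d S) B))) \<ge> 2/3))))))"
proof (rule exI[of _ "1/2"], intro conjI allI impI)
  fix \<epsilon> :: real assume eps: "0 < \<epsilon> \<and> \<epsilon> \<le> 1 / 2"
  then obtain A p \<delta> \<tau> T l where W: "test_weights A p \<delta> \<tau> T l" and one: "1 \<in> A" "p 1 = 1 - \<epsilon>"
    using exists_test_weights by blast
  interpret W: test_weights A p \<delta> \<tau> T l by (rule W)
  define C where "C = W.C_exp + W.C_rest"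
  define D where "D = T\<^sup>2 + W.C_exp + W.C_rest + 1"
  have CD: "0 \<le> C" "0 < D" using W.C_nonneg zero_le_power2[of T] by (simp_all add: C_def D_def add_nonneg_pos)
  \<comment> \<open>Since d^2 is at most 5 times the number of matrix entries, the first bound on
    \<open>N\<close> becomes \<open>80 * D * c\<close>; since the radius to the fourth power is at
    most 100 / d^2, the second becomes \<open>100 * C * c\<close>.\<close>
  define c where "c = 1 / (500 * (80 * D + 100 * C))"
  have c0: "0 < c" using CD by (simp add: c_def add_pos_nonneg)
  have cD: "80 * D * c \<le> 1 / 500" "100 * C * c \<le> 1 / 500"
    using CD unfolding c_def by (simp_all add: field_simps add_pos_nonneg)
  \<comment> \<open>A radius of at most \<open>1 / y\<close> satisfies both smallness conditions at
    once; the summand 1 keeps \<open>y\<close> positive.\<close>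
  define y where "y = 32 * l\<^sup>2 + 8 * \<tau> + 1"
  define z where "z = 1 / y"
  have y: "0 < y" "32 * l\<^sup>2 \<le> y" "8 * \<tau> \<le> y" using W.\<tau> by (simp_all add: y_def add_nonneg_pos)
  have z0: "0 < z" using y by (simp add: z_def)
  have zs: "32 * l\<^sup>2 * z \<le> 1" "8 * \<tau> * z \<le> 1"
    using y by (simp_all add: z_def)
  \<comment> \<open>The 5 is for \<open>half_split_bounds\<close>; the other bound makes the squared
    radius, which is at most 10 / d, at most \<open>z\<^sup>2\<close>.\<close>
  define d0 where "d0 = max 5 (nat \<lceil>10 / z\<^sup>2\<rceil>)"
  show "\<exists>c :: real. c > 0 \<and> (\<exists>d0 :: nat.
        \<forall>d N. d \<ge> d0 \<and> real N \<le> c * (real d)\<^sup>2 \<longrightarrow>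
        (\<forall>f :: (nat \<Rightarrow> nat \<Rightarrow> real) \<Rightarrow> real.
           f \<in> borel_measurable (iid N (Rd d)) \<and>
           (\<forall>x \<in> space (iid N (Rd d)). 0 \<le> f x \<and> f x \<le> 1) \<longrightarrow>
           \<not> ((\<integral>x. (1 - f x) \<partial>(iid N (std_gaussian d))) \<ge> 2/3 \<and>
              (\<forall>S B. sym_pos_def d S \<and> frob_dist_id d S > 1/2 \<and>
                     prob_space B \<and> sets B = sets (Rd d) \<longrightarrow>
                     (\<integral>x. f x \<partial>(iid N (mixture \<epsilon> (gaussian d S) B))) \<ge> 2/3))))"
  proof (intro exI[of _ c] exI[of _ d0] conjI allI impI c0 notI)
    fix d N :: nat and f :: "(nat \<Rightarrow> nat \<Rightarrow> real) \<Rightarrow> real"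
    assume dN: "d0 \<le> d \<and> real N \<le> c * (real d)\<^sup>2"
      and f: "f \<in> borel_measurable (iid N (Rd d)) \<and> (\<forall>x \<in> space (iid N (Rd d)). 0 \<le> f x \<and> f x \<le> 1)"
      and test: "(\<integral>x. (1 - f x) \<partial>(iid N (std_gaussian d))) \<ge> 2/3 \<and>
              (\<forall>S B. sym_pos_def d S \<and> frob_dist_id d S > 1/2 \<and>
                     prob_space B \<and> sets B = sets (Rd d) \<longrightarrow>
                     (\<integral>x. f x \<partial>(iid N (mixture \<epsilon> (gaussian d S) B))) \<ge> 2/3)"
    have d5: "5 \<le> d" and dz: "10 / z\<^sup>2 \<le> real d" using dN unfolding d0_def by linarith+
    define I J :: "nat set" where "I = {..<d div 2}" and "J = {d div 2..<d}"
    have fin: "finite I" "finite J" and IJ: "I \<inter> J = {}" and U: "I \<union> J = {..<d}"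
      by (auto simp: I_def J_def)
    have "0 \<in> I" "d div 2 \<in> J" using d5 by (auto simp: I_def J_def)
    then have ne: "I \<noteq> {}" "J \<noteq> {}" by auto
    interpret contaminated_model A p \<delta> \<tau> T l I J by standard (use fin IJ W.\<tau> in auto)
    interpret S: sign_matrices I J by standard (use fin ne in auto)
    define m where "m = real (d div 2)"
    note m = half_split_bounds[OF d5, folded m_def]
    have cards: "real (card I) = m" "real (card J) = real d - m"
      by (simp_all add: I_def J_def m_def of_nat_diff)
    have n: "S.n = m * (real d - m)"
      by (simp add: S.n_def cards)
    have s2: "S.radius\<^sup>2 = 2 * real d / S.n"
      unfolding n m(4)[symmetric] S.radius(2) by (simp add: cards)
    have n5: "(real d)\<^sup>2 \<le> 5 * S.n" using m(3) n by simp
    have s10: "S.radius\<^sup>2 \<le> 10 / real d"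
      unfolding s2 using n5 S.n_pos d5 by (simp add: field_simps power2_eq_square)
    have "10 / real d \<le> z\<^sup>2" using dz z0 d5 by (simp add: field_simps)
    then have "S.radius\<^sup>2 \<le> z\<^sup>2" using s10 by (rule order_trans[rotated])
    then have sz: "S.radius \<le> z" by (rule power2_le_imp_le) (use z0 in simp)
    have small: "32 * l\<^sup>2 * S.radius \<le> 1" "8 * \<tau> * S.radius \<le> 1"
      using zs mult_left_mono[OF sz, of "32 * l\<^sup>2"] mult_left_mono[OF sz, of "8 * \<tau>"] W.\<tau> by auto
    have N1: "real N * (16 * (T\<^sup>2 + W.C_exp + W.C_rest + 1)) / S.n \<le> 1 / 500"
    proof -
      have "real N \<le> c * (5 * S.n)" using dN n5 c0 by (meson mult_left_mono less_imp_le order_trans)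
      then have "real N * (16 * D) \<le> c * (5 * S.n) * (16 * D)" using CD by (intro mult_right_mono) auto
      also have "\<dots> = (80 * D * c) * S.n" by simp
      also have "\<dots> \<le> 1 / 500 * S.n" using cD S.n_pos by (intro mult_right_mono) auto
      finally show ?thesis using S.n_pos by (simp add: D_def pos_divide_le_eq)
    qed
    have N2: "real N * (W.C_exp + W.C_rest) * S.radius ^ 4 \<le> 1 / 500"
    proof -
      have "S.radius ^ 4 = (S.radius\<^sup>2)\<^sup>2" by (simp add: power_mult[symmetric])
      also have "\<dots> \<le> (10 / real d)\<^sup>2" using s10 by (intro power_mono) auto
      finally have "real N * C * S.radius ^ 4 \<le> (c * (real d)\<^sup>2) * C * (10 / real d)\<^sup>2"
        using dN CD c0 by (intro mult_mono) auto
      also have "\<dots> = 100 * C * c" using d5 by (simp add: power2_eq_square)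
      also have "\<dots> \<le> 1 / 500" by (rule cD)
      finally show ?thesis by (simp add: C_def)
    qed
    note O = overlap_power_sum[OF ne small N1 N2]
    have gg: "std_gaussian d = gauss (I \<union> J)" by (simp add: std_gaussian_gauss U)
    have sets_iid: "sets (iid N (std_gaussian d)) = sets (iid N (Rd d))"
      unfolding iid_def by (intro sets_PiM_cong) (auto simp: gg Rd_def U)
    \<comment> \<open>The average of the alternatives is itself not of the form in (ii), but a test
      that succeeds against every single matrix would succeed against the average. So there is one
      good matrix on which the test fails, and it determines the covariance and
      \<open>B\<close>.\<close>
    have "\<exists>\<sigma>\<in>S.good. (\<integral>x. f x \<partial>(iid N (density (std_gaussian d) (\<lambda>x. ennreal (rho (S.sgn_mat \<sigma>) x))))) < 2 / 3"
    proof (rule second_moment_test[OF _ O(2,1)])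
      show "prob_space (std_gaussian d)" by (simp add: std_gaussian_gauss prob_space_gauss)
      show "0 \<le> rho (S.sgn_mat \<sigma>) x" for \<sigma> x by (rule rho_nonneg)
      show "has_bochner_integral (std_gaussian d) (rho (S.sgn_mat \<sigma>)) 1" if "\<sigma> \<in> S.good" for \<sigma>
        unfolding gg by (rule has_integral_rho[OF O(3)[OF that]])
      show "has_bochner_integral (std_gaussian d) (\<lambda>x. rho (S.sgn_mat \<sigma>) x * rho (S.sgn_mat \<sigma>') x)
        (W.overlap I (gram J (S.sgn_mat \<sigma>) (S.sgn_mat \<sigma>')) (gram J (S.sgn_mat \<sigma>) (S.sgn_mat \<sigma>)) (gram J (S.sgn_mat \<sigma>') (S.sgn_mat \<sigma>')))"
        if "\<sigma> \<in> S.good" "\<sigma>' \<in> S.good" for \<sigma> \<sigma>'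
        unfolding gg by (rule O(5)[OF that])
      show "f \<in> borel_measurable (iid N (std_gaussian d))"
        using f measurable_cong_sets[OF sets_iid refl] by blast
      show "0 \<le> f x \<and> f x \<le> 1" if "x \<in> space (iid N (std_gaussian d))" for x
        using f that sets_eq_imp_space_eq[OF sets_iid] by auto
      show "(\<integral>x. (1 - f x) \<partial>(iid N (std_gaussian d))) \<ge> 2 / 3" using test by blast
    qed (rule O(6))
    then obtain \<sigma> where \<sigma>: "\<sigma> \<in> S.good"
      and less: "(\<integral>x. f x \<partial>(iid N (density (std_gaussian d) (\<lambda>x. ennreal (rho (S.sgn_mat \<sigma>) x))))) < 2 / 3" by blast
    define K where "K = S.sgn_mat \<sigma>"
    obtain B where B: "prob_space B" "sets B = sets (gauss (I \<union> J))"
      "mixture \<epsilon> (density (gauss (I \<union> J)) (\<lambda>x. ennreal (tilt I J K 1 x))) B = density (gauss (I \<union> J)) (\<lambda>x. ennreal (rho K x))"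
      using mixture_eq_density_rho[OF O(3)[OF \<sigma>] one] eps unfolding K_def by auto
    have "mixture \<epsilon> (gaussian d (block_cov d I J K)) B = density (std_gaussian d) (\<lambda>x. ennreal (rho K x))"
      using B(3) by (simp add: gaussian_block_cov[OF IJ U] gg)
    moreover have "sym_pos_def d (block_cov d I J K)" by (rule sym_pos_def_block_cov[OF IJ U])
    moreover have "frob_dist_id d (block_cov d I J K) > 1 / 2"
      using O(4)[OF \<sigma>] by (intro frob_dist_block_cov[OF IJ U]) (simp add: K_def)
    moreover have "sets B = sets (Rd d)" using B(2) by (simp add: Rd_def U)
    ultimately have "2 / 3 \<le> (\<integral>x. f x \<partial>(iid N (density (std_gaussian d) (\<lambda>x. ennreal (rho K x)))))"
      using test B(1) by metis
    then show False using less by (simp add: K_def)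
  qed
qed simp

end
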